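(* Let $k$ be an algebraically closed field of characteristic $0$, let $S$ be a non-empty set, let $N$ be the affine group scheme over $k$ with free unipotent generators $S$, and let $V$ be an $N$-module given by $\rho:N\to {\rm GL}(V)$. Then the $H^*(N,V)$ are the cohomology groups of the complex \[0\to V\to V^S\to 0\] (with $V$ in degree $0$ and $V^S$, the space of all maps $S\to V$, in degree $1$), where the non-trivial map is given by $v\mapsto(\rho(s)v-v)_{s\in S}$.
   Context: For an affine group scheme $G$ over $k$, a $G$-module is a finite dimensional $k$-vector space $V$ with a morphism of affine group schemes $\rho:G\to{\rm GL}(V)$; $H^*(G,V)$ denotes rational cohomology, i.e. the derived functors of $V\mapsto V^G$ (on the category of direct limits of finite dimensional $G$-modules). Definition of $N$: let $Unipotent(S)$ be the category of pairs $(V,\alpha)$ with $V$ a finite dimensional $k$-vector space and $\alpha:S\to{\rm GL}(V)$ a map such that $\alpha(s)$ is unipotent for every $s\in S$; morphisms are linear maps commuting with the $\alpha(s)$. With the obvious tensor product and fibre functor $(V,\alpha)\mapsto V$ this is a neutral Tannakian category, and $N$ is the affine group scheme over $k$ such that $Unipotent(S)$ is equivalent to the category of finite dimensional representations of $N$. Each $s\in S$ defines an element, again called $s$, of $N(k)$, such that $\rho(s)=\alpha(s)$ whenever the representation $\rho:N\to{\rm GL}(V)$ corresponds to $(V,\alpha)$. $N$ is called the group with free unipotent generators $S$. *)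

theory Defs
  imports "HOL-Algebra.Algebraic_Closure" "Jordan_Normal_Form.Missing_VectorSpace"
begin

hide_const (open) Multiset.mult Modules.module

text \<open>
  Vector spaces are records of type \<open>('k, 'v) module\<close> satisfying \<open>vectorspace K V\<close>.  Such a record
  also has the fields \<open>mult\<close> and \<open>one\<close>; they are meaningful only for algebras and are filled
  arbitrarily below for spaces that are not algebras.
\<close>

section \<open>Quotients, tensor products, cohomology of complexes\<close>

definition zero_space :: "('k, unit) module" where
  "zero_space = \<lparr>carrier = {()}, mult = (\<lambda>_ _. ()), one = (), zero = (), add = (\<lambda>_ _. ()),
     smult = (\<lambda>_ _. ())\<rparr>"

definition quot_space :: "('k, 'm, 'x) module_scheme \<Rightarrow> 'm set \<Rightarrow> ('k, 'm set) module" where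
  "quot_space M W = \<lparr>carrier = a_rcosets\<^bsub>M\<^esub> W, mult = (\<lambda>_ _. W), one = W, zero = W,
     add = (\<lambda>A B. A <+>\<^bsub>M\<^esub> B),
     smult = (\<lambda>c A. \<Union>x\<in>A. W +>\<^bsub>M\<^esub> (c \<odot>\<^bsub>M\<^esub> x))\<rparr>"

definition space_iso ::
    "('k, 'r) ring_scheme \<Rightarrow> ('k, 'v, 'x) module_scheme \<Rightarrow> ('k, 'w, 'y) module_scheme \<Rightarrow> bool" where
  "space_iso K V W \<longleftrightarrow> (\<exists>f \<in> module_hom K V W. bij_betw f (carrier V) (carrier W))"

text \<open>The cohomology \<open>ker g / im f\<close> at the middle term of a complex \<open>L \<rightarrow> M \<rightarrow> N\<close>.\<close>

definition cohomology_at ::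
    "('k, 'l, 'x) module_scheme \<Rightarrow> ('l \<Rightarrow> 'm) \<Rightarrow> ('k, 'm, 'y) module_scheme \<Rightarrow> ('m \<Rightarrow> 'n)
      \<Rightarrow> ('k, 'n, 'z) module_scheme \<Rightarrow> ('k, 'm set) module" where
  "cohomology_at L f M g N =
     quot_space (M\<lparr>carrier := {x \<in> carrier M. g x = \<zero>\<^bsub>N\<^esub>}\<rparr>) (f ` carrier L)"

definition map_space :: "'s set \<Rightarrow> ('k, 'v, 'x) module_scheme \<Rightarrow> ('k, 's \<Rightarrow> 'v) module" where
  "map_space S V = \<lparr>carrier = S \<rightarrow>\<^sub>E carrier V, mult = (\<lambda>_ _. \<lambda>s\<in>S. \<zero>\<^bsub>V\<^esub>),
     one = (\<lambda>s\<in>S. \<zero>\<^bsub>V\<^esub>), zero = (\<lambda>s\<in>S. \<zero>\<^bsub>V\<^esub>),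
     add = (\<lambda>f g. \<lambda>s\<in>S. f s \<oplus>\<^bsub>V\<^esub> g s),
     smult = (\<lambda>c f. \<lambda>s\<in>S. c \<odot>\<^bsub>V\<^esub> f s)\<rparr>"

text \<open>
  The tensor product of \<open>V\<close> and \<open>W\<close> is the free vector space on \<open>carrier V \<times> carrier W\<close> (finitely
  supported functions) modulo the span of the bilinearity relations.
\<close>

definition free_space :: "('k, 'r) ring_scheme \<Rightarrow> 'x set \<Rightarrow> ('k, 'x \<Rightarrow> 'k) module" where
  "free_space K B = \<lparr>carrier = {f. f ` B \<subseteq> carrier K \<and> (\<forall>x. x \<notin> B \<longrightarrow> f x = \<zero>\<^bsub>K\<^esub>)
                                   \<and> finite {x. f x \<noteq> \<zero>\<^bsub>K\<^esub>}},
     mult = (\<lambda>_ _ _. \<zero>\<^bsub>K\<^esub>), one = (\<lambda>_. \<zero>\<^bsub>K\<^esub>), zero = (\<lambda>_. \<zero>\<^bsub>K\<^esub>),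
     add = (\<lambda>f g x. f x \<oplus>\<^bsub>K\<^esub> g x),
     smult = (\<lambda>c f x. c \<otimes>\<^bsub>K\<^esub> f x)\<rparr>"

definition free_gen :: "('k, 'r) ring_scheme \<Rightarrow> 'x \<Rightarrow> 'x \<Rightarrow> 'k" where
  "free_gen K x = (\<lambda>y. if y = x then \<one>\<^bsub>K\<^esub> else \<zero>\<^bsub>K\<^esub>)"

definition bilinear_relations ::
    "('k, 'r) ring_scheme \<Rightarrow> ('k, 'v, 'x) module_scheme \<Rightarrow> ('k, 'w, 'y) module_scheme
      \<Rightarrow> ('v \<times> 'w \<Rightarrow> 'k) set" where
  "bilinear_relations K V W =
    (let F = free_space K (carrier V \<times> carrier W) in
       {free_gen K (v \<oplus>\<^bsub>V\<^esub> v', w) \<ominus>\<^bsub>F\<^esub> (free_gen K (v, w) \<oplus>\<^bsub>F\<^esub> free_gen K (v', w)) | v v' w.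
          v \<in> carrier V \<and> v' \<in> carrier V \<and> w \<in> carrier W}
     \<union> {free_gen K (v, w \<oplus>\<^bsub>W\<^esub> w') \<ominus>\<^bsub>F\<^esub> (free_gen K (v, w) \<oplus>\<^bsub>F\<^esub> free_gen K (v, w')) | v w w'.
          v \<in> carrier V \<and> w \<in> carrier W \<and> w' \<in> carrier W}
     \<union> {free_gen K (c \<odot>\<^bsub>V\<^esub> v, w) \<ominus>\<^bsub>F\<^esub> (c \<odot>\<^bsub>F\<^esub> free_gen K (v, w)) | c v w.
          c \<in> carrier K \<and> v \<in> carrier V \<and> w \<in> carrier W}
     \<union> {free_gen K (v, c \<odot>\<^bsub>W\<^esub> w) \<ominus>\<^bsub>F\<^esub> (c \<odot>\<^bsub>F\<^esub> free_gen K (v, w)) | c v w.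
          c \<in> carrier K \<and> v \<in> carrier V \<and> w \<in> carrier W})"

definition tensor_kernel ::
    "('k, 'r) ring_scheme \<Rightarrow> ('k, 'v, 'x) module_scheme \<Rightarrow> ('k, 'w, 'y) module_scheme
      \<Rightarrow> ('v \<times> 'w \<Rightarrow> 'k) set" where
  "tensor_kernel K V W = LinearCombinations.module.span K (free_space K (carrier V \<times> carrier W))
     (bilinear_relations K V W)"

definition tensor ::
    "('k, 'r) ring_scheme \<Rightarrow> ('k, 'v, 'x) module_scheme \<Rightarrow> ('k, 'w, 'y) module_scheme
      \<Rightarrow> ('k, ('v \<times> 'w \<Rightarrow> 'k) set) module" where
  "tensor K V W = quot_space (free_space K (carrier V \<times> carrier W)) (tensor_kernel K V W)"

definition pure_tensor ::
    "('k, 'r) ring_scheme \<Rightarrow> ('k, 'v, 'x) module_scheme \<Rightarrow> ('k, 'w, 'y) module_scheme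
      \<Rightarrow> 'v \<Rightarrow> 'w \<Rightarrow> ('v \<times> 'w \<Rightarrow> 'k) set" where
  "pure_tensor K V W v w =
     tensor_kernel K V W +>\<^bsub>free_space K (carrier V \<times> carrier W)\<^esub> free_gen K (v, w)"

text \<open>
  For a \<open>K\<close>-bilinear \<open>\<beta>\<close> with values in \<open>T\<close>, \<open>tensor_lift K T \<beta>\<close> is the linear map sending
  \<open>v \<otimes> w\<close> to \<open>\<beta> v w\<close>; the result is then independent of the chosen representative.
  It is only ever applied to bilinear \<open>\<beta>\<close>.
\<close>

definition tensor_lift ::
    "('k, 'r) ring_scheme \<Rightarrow> ('k, 't, 'x) module_scheme \<Rightarrow> ('v \<Rightarrow> 'w \<Rightarrow> 't)
      \<Rightarrow> ('v \<times> 'w \<Rightarrow> 'k) set \<Rightarrow> 't" where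
  "tensor_lift K T \<beta> t =
    (let f = (SOME f. f \<in> t)
     in \<Oplus>\<^bsub>T\<^esub>p \<in> {p. f p \<noteq> \<zero>\<^bsub>K\<^esub>}. f p \<odot>\<^bsub>T\<^esub> \<beta> (fst p) (snd p))"

text \<open>\<open>f \<otimes> g\<close>, with values in the tensor product of \<open>V'\<close> and \<open>W'\<close>\<close>

definition tensor_map ::
    "('k, 'r) ring_scheme \<Rightarrow> ('k, 'v1, 'x) module_scheme \<Rightarrow> ('k, 'w1, 'y) module_scheme
      \<Rightarrow> ('v \<Rightarrow> 'v1) \<Rightarrow> ('w \<Rightarrow> 'w1) \<Rightarrow> ('v \<times> 'w \<Rightarrow> 'k) set \<Rightarrow> ('v1 \<times> 'w1 \<Rightarrow> 'k) set" where
  "tensor_map K V' W' f g =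
     tensor_lift K (tensor K V' W') (\<lambda>v w. pure_tensor K V' W' (f v) (g w))"

text \<open>\<open>U \<otimes> (V \<otimes> W) \<rightarrow> (U \<otimes> V) \<otimes> W\<close>\<close>

definition tensor_assoc ::
    "('k, 'r) ring_scheme \<Rightarrow> ('k, 'u, 'x) module_scheme \<Rightarrow> ('k, 'v, 'y) module_scheme
      \<Rightarrow> ('k, 'w, 'z) module_scheme
      \<Rightarrow> ('u \<times> ('v \<times> 'w \<Rightarrow> 'k) set \<Rightarrow> 'k) set \<Rightarrow> (('u \<times> 'v \<Rightarrow> 'k) set \<times> 'w \<Rightarrow> 'k) set" where
  "tensor_assoc K U V W =
    (let T = tensor K (tensor K U V) W
     in tensor_lift K T (\<lambda>u. tensor_lift K T
          (\<lambda>v w. pure_tensor K (tensor K U V) W (pure_tensor K U V u v) w)))"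

text \<open>Multiplication of the algebra \<open>A \<otimes> B\<close>: \<open>(a \<otimes> b)(a' \<otimes> b') = aa' \<otimes> bb'\<close>\<close>

definition tensor_mult ::
    "('k, 'r) ring_scheme \<Rightarrow> ('k, 'a, 'x) module_scheme \<Rightarrow> ('k, 'b, 'y) module_scheme
      \<Rightarrow> ('a \<times> 'b \<Rightarrow> 'k) set \<Rightarrow> ('a \<times> 'b \<Rightarrow> 'k) set \<Rightarrow> ('a \<times> 'b \<Rightarrow> 'k) set" where
  "tensor_mult K A B t t' =
     tensor_lift K (tensor K A B)
       (\<lambda>a b. tensor_lift K (tensor K A B)
          (\<lambda>a' b'. pure_tensor K A B (a \<otimes>\<^bsub>A\<^esub> a') (b \<otimes>\<^bsub>B\<^esub> b')) t') t"

section \<open>Affine group schemes and their modules\<close>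

text \<open>
  An affine group scheme over \<open>K\<close> is given by its coordinate ring, a commutative Hopf algebra;
  \<open>comult\<close>, \<open>counit\<close> and \<open>antipode\<close> are the comorphisms of multiplication, unit and inverse.
\<close>

record ('k, 'a) group_scheme = "('k, 'a) module" +
  comult :: "'a \<Rightarrow> ('a \<times> 'a \<Rightarrow> 'k) set"
  counit :: "'a \<Rightarrow> 'k"
  antipode :: "'a \<Rightarrow> 'a"

text \<open>The group \<open>G(K)\<close> of rational points: \<open>K\<close>-algebra homomorphisms from the coordinate ring to \<open>K\<close>\<close>

definition points :: "('k, 'r) ring_scheme \<Rightarrow> ('k, 'a, 'x) module_scheme \<Rightarrow> ('a \<Rightarrow> 'k) set" where
  "points K G = {g \<in> ring_hom G K.
     \<forall>c \<in> carrier K. \<forall>a \<in> carrier G. g (c \<odot>\<^bsub>G\<^esub> a) = c \<otimes>\<^bsub>K\<^esub> g a}"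

definition affine_group_scheme ::
    "('k, 'r) ring_scheme \<Rightarrow> ('k, 'a) group_scheme \<Rightarrow> bool" where
  "affine_group_scheme K G \<longleftrightarrow> field K \<and> algebra K G
     \<and> comult G \<in> module_hom K G (tensor K G G)
     \<and> comult G \<one>\<^bsub>G\<^esub> = pure_tensor K G G \<one>\<^bsub>G\<^esub> \<one>\<^bsub>G\<^esub>
     \<and> (\<forall>a \<in> carrier G. \<forall>b \<in> carrier G.
          comult G (a \<otimes>\<^bsub>G\<^esub> b) = tensor_mult K G G (comult G a) (comult G b))
     \<and> counit G \<in> points K G
     \<and> antipode G \<in> module_hom K G G
     \<and> antipode G \<in> ring_hom G G
     \<and> (\<forall>a \<in> carrier G.
          tensor_map K (tensor K G G) G (comult G) (\<lambda>b. b) (comult G a)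
          = tensor_assoc K G G G (tensor_map K G (tensor K G G) (\<lambda>b. b) (comult G) (comult G a)))
     \<and> (\<forall>a \<in> carrier G. tensor_lift K G (\<lambda>b c. counit G b \<odot>\<^bsub>G\<^esub> c) (comult G a) = a)
     \<and> (\<forall>a \<in> carrier G. tensor_lift K G (\<lambda>b c. counit G c \<odot>\<^bsub>G\<^esub> b) (comult G a) = a)
     \<and> (\<forall>a \<in> carrier G.
          tensor_lift K G (\<lambda>b c. antipode G b \<otimes>\<^bsub>G\<^esub> c) (comult G a) = counit G a \<odot>\<^bsub>G\<^esub> \<one>\<^bsub>G\<^esub>)
     \<and> (\<forall>a \<in> carrier G.
          tensor_lift K G (\<lambda>b c. b \<otimes>\<^bsub>G\<^esub> antipode G c) (comult G a) = counit G a \<odot>\<^bsub>G\<^esub> \<one>\<^bsub>G\<^esub>)"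

text \<open>
  A linear action of \<open>G\<close> on \<open>V\<close> is given by its coaction \<open>V \<rightarrow> V \<otimes> K[G]\<close>; for finite-dimensional
  \<open>V\<close> this is the same as a morphism of group schemes from \<open>G\<close> to \<open>GL(V)\<close>.
\<close>

record ('k, 'a, 'u) rep = "('k, 'u) module" +
  coact :: "'u \<Rightarrow> ('u \<times> 'a \<Rightarrow> 'k) set"

definition comodule ::
    "('k, 'r) ring_scheme \<Rightarrow> ('k, 'a) group_scheme \<Rightarrow> ('k, 'a, 'u) rep \<Rightarrow> bool" where
  "comodule K G V \<longleftrightarrow> vectorspace K V
     \<and> coact V \<in> module_hom K V (tensor K V G)
     \<and> (\<forall>v \<in> carrier V.
          tensor_map K (tensor K V G) G (coact V) (\<lambda>a. a) (coact V v)
          = tensor_assoc K V G G (tensor_map K V (tensor K G G) (\<lambda>w. w) (comult G) (coact V v)))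
     \<and> (\<forall>v \<in> carrier V. tensor_lift K V (\<lambda>w a. counit G a \<odot>\<^bsub>V\<^esub> w) (coact V v) = v)"

text \<open>The automorphism \<open>\<rho>(g)\<close> of \<open>V\<close> for a rational point \<open>g\<close> of \<open>G\<close>\<close>

definition action ::
    "('k, 'r) ring_scheme \<Rightarrow> ('k, 'a, 'u) rep \<Rightarrow> ('a \<Rightarrow> 'k) \<Rightarrow> 'u \<Rightarrow> 'u" where
  "action K V g v = tensor_lift K V (\<lambda>w a. g a \<odot>\<^bsub>V\<^esub> w) (coact V v)"

definition rep_hom ::
    "('k, 'r) ring_scheme \<Rightarrow> ('k, 'a) group_scheme \<Rightarrow> ('k, 'a, 'u) rep \<Rightarrow> ('k, 'a, 'u) rep
      \<Rightarrow> ('u \<Rightarrow> 'u) set" where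
  "rep_hom K G V W = {f \<in> module_hom K V W.
     \<forall>v \<in> carrier V. coact W (f v) = tensor_map K W G f (\<lambda>a. a) (coact V v)}"

definition fd_module ::
    "('k, 'r) ring_scheme \<Rightarrow> ('k, 'a) group_scheme \<Rightarrow> ('k, 'a, 'u) rep \<Rightarrow> bool" where
  "fd_module K G V \<longleftrightarrow> comodule K G V \<and> vectorspace.fin_dim K V"

text \<open>
  Direct limits of finite-dimensional modules: every vector comes from a finite-dimensional module.
  (By local finiteness this holds for every comodule.)

  The type \<open>'u\<close> plays the role of a universe: the categories below consist of the modules whose
  underlying set is a subset of \<open>'u\<close>.  As soon as one of them is nonzero, \<open>'u\<close> has at least the
  cardinality of \<open>K\<close>; for infinite \<open>K\<close> it then contains a copy of every finite-dimensional vector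
  space, and testing injectivity against modules in \<open>'u\<close> is the same as testing it against
  all modules, since by local finiteness finite-dimensional test modules suffice.
\<close>

definition rational_module ::
    "('k, 'r) ring_scheme \<Rightarrow> ('k, 'a) group_scheme \<Rightarrow> ('k, 'a, 'u) rep \<Rightarrow> bool" where
  "rational_module K G V \<longleftrightarrow> comodule K G V
     \<and> (\<forall>v \<in> carrier V. \<exists>(W :: ('k, 'a, 'u) rep) f.
          fd_module K G W \<and> f \<in> rep_hom K G W V \<and> v \<in> f ` carrier W)"

section \<open>Rational cohomology\<close>

definition invariants ::
    "('k, 'r) ring_scheme \<Rightarrow> ('k, 'a) group_scheme \<Rightarrow> ('k, 'a, 'u) rep \<Rightarrow> ('k, 'a, 'u) rep" where
  "invariants K G V =
     V\<lparr>carrier := {v \<in> carrier V. coact V v = pure_tensor K V G v \<one>\<^bsub>G\<^esub>}\<rparr>"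

definition injective_module ::
    "('k, 'r) ring_scheme \<Rightarrow> ('k, 'a) group_scheme \<Rightarrow> ('k, 'a, 'u) rep \<Rightarrow> bool" where
  "injective_module K G I \<longleftrightarrow> rational_module K G I
     \<and> (\<forall>(P :: ('k, 'a, 'u) rep) (Q :: ('k, 'a, 'u) rep). \<forall>i \<in> rep_hom K G P Q. \<forall>f \<in> rep_hom K G P I.
          rational_module K G P \<longrightarrow> rational_module K G Q \<longrightarrow> inj_on i (carrier P) \<longrightarrow>
          (\<exists>g \<in> rep_hom K G Q I. \<forall>x \<in> carrier P. g (i x) = f x))"

text \<open>An exact sequence \<open>0 \<rightarrow> V \<rightarrow> I 0 \<rightarrow> I 1 \<rightarrow> \<dots>\<close> with augmentation \<open>\<eta>\<close> and all \<open>I n\<close> injective\<close>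

definition injective_resolution ::
    "('k, 'r) ring_scheme \<Rightarrow> ('k, 'a) group_scheme \<Rightarrow> ('k, 'a, 'u) rep \<Rightarrow> ('u \<Rightarrow> 'u)
      \<Rightarrow> (nat \<Rightarrow> ('k, 'a, 'u) rep) \<Rightarrow> (nat \<Rightarrow> 'u \<Rightarrow> 'u) \<Rightarrow> bool" where
  "injective_resolution K G V \<eta> I d \<longleftrightarrow>
     (\<forall>n. injective_module K G (I n))
     \<and> \<eta> \<in> rep_hom K G V (I 0) \<and> (\<forall>n. d n \<in> rep_hom K G (I n) (I (Suc n)))
     \<and> inj_on \<eta> (carrier V)
     \<and> \<eta> ` carrier V = {x \<in> carrier (I 0). d 0 x = \<zero>\<^bsub>I 1\<^esub>}
     \<and> (\<forall>n. d n ` carrier (I n) = {x \<in> carrier (I (Suc n)). d (Suc n) x = \<zero>\<^bsub>I (Suc (Suc n))\<^esub>})"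

text \<open>
  The derived functors of invariants, computed from an injective resolution: \<open>H\<^sup>n(G, V)\<close> is the
  cohomology in degree \<open>n\<close> of \<open>0 \<rightarrow> (I 0)\<^sup>G \<rightarrow> (I 1)\<^sup>G \<rightarrow> \<dots>\<close> for a resolution \<open>I\<close> of \<open>V\<close>.
\<close>

definition rational_cohomology ::
    "('k, 'r) ring_scheme \<Rightarrow> ('k, 'a) group_scheme \<Rightarrow> (nat \<Rightarrow> ('k, 'a, 'u) rep) \<Rightarrow> (nat \<Rightarrow> 'u \<Rightarrow> 'u)
      \<Rightarrow> nat \<Rightarrow> ('k, 'u set) module" where
  "rational_cohomology K G I d n =
    (case n of
       0 \<Rightarrow> cohomology_at (zero_space :: ('k, unit) module) (\<lambda>_. \<zero>\<^bsub>I 0\<^esub>)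
              (invariants K G (I 0)) (d 0) (invariants K G (I 1))
     | Suc m \<Rightarrow> cohomology_at (invariants K G (I m)) (d m)
              (invariants K G (I (Suc m))) (d (Suc m)) (invariants K G (I (Suc (Suc m)))))"

section \<open>The group with free unipotent generators\<close>

definition unipotent ::
    "('k, 'r) ring_scheme \<Rightarrow> ('k, 'v, 'x) module_scheme \<Rightarrow> ('v \<Rightarrow> 'v) \<Rightarrow> bool" where
  "unipotent K V f \<longleftrightarrow> f \<in> module_hom K V V \<and> bij_betw f (carrier V) (carrier V)
     \<and> (\<exists>n. \<forall>v \<in> carrier V. ((\<lambda>w. f w \<ominus>\<^bsub>V\<^esub> w) ^^ n) v = \<zero>\<^bsub>V\<^esub>)"

text \<open>Objects and morphisms of the category \<open>Unipotent(S)\<close>\<close>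

definition unipotent_object ::
    "('k, 'r) ring_scheme \<Rightarrow> 's set \<Rightarrow> ('k, 'v, 'x) module_scheme \<Rightarrow> ('s \<Rightarrow> 'v \<Rightarrow> 'v) \<Rightarrow> bool" where
  "unipotent_object K S V \<alpha> \<longleftrightarrow>
     vectorspace K V \<and> vectorspace.fin_dim K V \<and> (\<forall>s \<in> S. unipotent K V (\<alpha> s))"

definition unipotent_hom ::
    "('k, 'r) ring_scheme \<Rightarrow> 's set \<Rightarrow> ('k, 'v, 'x) module_scheme \<Rightarrow> ('s \<Rightarrow> 'v \<Rightarrow> 'v)
      \<Rightarrow> ('k, 'w, 'y) module_scheme \<Rightarrow> ('s \<Rightarrow> 'w \<Rightarrow> 'w) \<Rightarrow> ('v \<Rightarrow> 'w) set" where
  "unipotent_hom K S V \<alpha> W \<beta> = {f \<in> module_hom K V W.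
     \<forall>s \<in> S. \<forall>v \<in> carrier V. f (\<alpha> s v) = \<beta> s (f v)}"

text \<open>
  \<open>N\<close> together with points \<open>\<sigma> s\<close> of \<open>N(K)\<close> is the group with free unipotent generators \<open>S\<close> if
  \<open>(V, \<rho>) \<mapsto> (V, s \<mapsto> \<rho>(\<sigma> s))\<close> is an equivalence from the category of finite-dimensional
  \<open>N\<close>-modules to \<open>Unipotent(S)\<close>, i.e. well defined on objects, fully faithful and essentially
  surjective.  It is the identity on underlying spaces, hence compatible with the fibre functors
  (and faithful), and compatible with tensor products because the \<open>\<sigma> s\<close> are algebra homomorphisms.
\<close>

definition free_unipotent_group ::
    "'u itself \<Rightarrow> ('k, 'r) ring_scheme \<Rightarrow> 's set \<Rightarrow> ('k, 'a) group_scheme \<Rightarrow> ('s \<Rightarrow> 'a \<Rightarrow> 'k)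
      \<Rightarrow> bool" where
  "free_unipotent_group _ K S N \<sigma> \<longleftrightarrow>
     affine_group_scheme K N
     \<and> (\<forall>s \<in> S. \<sigma> s \<in> points K N)
     \<and> (\<forall>V :: ('k, 'a, 'u) rep. fd_module K N V \<longrightarrow>
          unipotent_object K S V (\<lambda>s. action K V (\<sigma> s)))
     \<and> (\<forall>(V :: ('k, 'a, 'u) rep) (W :: ('k, 'a, 'u) rep). fd_module K N V \<longrightarrow> fd_module K N W \<longrightarrow>
          rep_hom K N V W
          = unipotent_hom K S V (\<lambda>s. action K V (\<sigma> s)) W (\<lambda>s. action K W (\<sigma> s)))
     \<and> (\<forall>(V :: ('k, 'u) module) \<alpha>. unipotent_object K S V \<alpha> \<longrightarrow>
          (\<exists>W :: ('k, 'a, 'u) rep. fd_module K N W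
             \<and> (\<exists>\<phi> \<in> unipotent_hom K S V \<alpha> W (\<lambda>s. action K W (\<sigma> s)).
                  bij_betw \<phi> (carrier V) (carrier W))))"

text \<open>The differential \<open>v \<mapsto> (\<rho>(s)v - v)\<close> of the complex \<open>V \<rightarrow> V\<^sup>S\<close>\<close>

definition displacement ::
    "('k, 'r) ring_scheme \<Rightarrow> 's set \<Rightarrow> ('s \<Rightarrow> 'a \<Rightarrow> 'k) \<Rightarrow> ('k, 'a, 'u) rep \<Rightarrow> 'u \<Rightarrow> 's \<Rightarrow> 'u" where
  "displacement K S \<sigma> V = (\<lambda>v. \<lambda>s\<in>S. action K V (\<sigma> s) v \<ominus>\<^bsub>V\<^esub> v)"

end

theory Submission
  imports Defs
begin

text \<open>
  For a module \<open>M\<close> and a generator \<open>s\<close> let \<open>disp M s v = \<rho>(s) v - v\<close>.  The equivalence with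
  \<open>Unipotent(S)\<close> shows that \<open>M\<^sup>N\<close> is the common kernel of the maps \<open>disp M s\<close>.  A map \<open>c\<close> from \<open>S\<close>
  to a finite-dimensional module \<open>Q\<close> defines a unipotent action on \<open>Q \<oplus> K\<close>, with
  \<open>s (q, t) = (s q + t c(s), t)\<close>, hence an \<open>N\<close>-module; if \<open>Q\<close> maps to an injective module \<open>I\<close>, the
  map extends to \<open>Q \<oplus> K\<close>, and the image \<open>y\<close> of \<open>(0, 1)\<close> satisfies \<open>disp I s y = c(s)\<close> for all \<open>s\<close>.
  Maps \<open>c\<close> into a finite-dimensional submodule lift along surjections of modules, so quotients of
  injective modules inherit this property.  Hence the cohomology vanishes in degrees above 1, and
  the snake lemma for the displacements on \<open>0 \<rightarrow> V \<rightarrow> I 0 \<rightarrow> I 1\<close> gives degrees 0 and 1.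
\<close>

section \<open>Quotient modules\<close>

text \<open>The equivalence speaks only about spaces carried by subsets of \<open>'u\<close>, and
  injectivity is tested only against modules on such subsets. The space Q \<oplus> K lives on
  another type and has to be copied into \<open>'u\<close> before it can serve as a test module. If
  Q is nonzero, K embeds in Q, and for infinite K the sets Q x K and Q are equinumerous, which
  leaves room for the copy; if Q is zero, the equation to be solved is trivial. Characteristic 0
  enters through the infinity of K.

  A second obstacle is that a rational module is known only through maps from finite-dimensional
  modules, whose images are not known in advance to be subcomodules. Exactness of tensoring with the
  coordinate ring would settle this. Here a subspace stable under the generators receives a coaction
  from essential surjectivity, and fullness shows that the maps involved respect the
  coactions.\<close>

lemma submodule_abelian_subgroup:
  assumes "submodule R W M"
  shows "abelian_subgroup W M"
proof -
  interpret module R M using assms by (rule submodule.module)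
  note subset = submodule.subset[OF assms]
  have neg: "\<ominus>\<^bsub>M\<^esub> v \<in> W" if "v \<in> W" for v
  proof -
    have "(\<ominus>\<^bsub>R\<^esub> \<one>\<^bsub>R\<^esub>) \<odot>\<^bsub>M\<^esub> v \<in> W" by (rule submodule.smult_closed[OF assms]) (simp_all add: that)
    then show ?thesis using smult_minus_1[of v] that subset by (simp add: subset_iff)
  qed
  have "subgroup W (add_monoid M)"
  proof (rule M.add.subgroupI)
    show "W \<noteq> {}" using submodule.zero_closed[OF assms] by blast
  qed (auto simp: subset neg submodule.m_closed[OF assms])
  then show ?thesis
    by (intro abelian_subgroupI3 additive_subgroupI) (auto simp: M.abelian_group_axioms)
qed

context module
begin

lemma in_coset_iff:
  assumes "submodule R W M" "x \<in> carrier M"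
  shows "y \<in> W +>\<^bsub>M\<^esub> x \<longleftrightarrow> y \<in> carrier M \<and> y \<ominus>\<^bsub>M\<^esub> x \<in> W"
proof -
  interpret W: abelian_subgroup W M using assms(1) by (rule submodule_abelian_subgroup)
  show ?thesis
    using W.a_elemrcos_carrier W.a_rcos_module assms(2) unfolding M.minus_eq by blast
qed

lemma coset_eq_iff:
  assumes "submodule R W M" "x \<in> carrier M" "y \<in> carrier M"
  shows "W +>\<^bsub>M\<^esub> x = W +>\<^bsub>M\<^esub> y \<longleftrightarrow> x \<ominus>\<^bsub>M\<^esub> y \<in> W"
proof -
  interpret W: abelian_subgroup W M using assms(1) by (rule submodule_abelian_subgroup)
  show ?thesis
    using in_coset_iff[OF assms(1)] W.a_repr_independence'[of x y] W.a_rcos_self[of x] assms by blast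
qed

lemma quot_space_carrier:
  "carrier (quot_space M W) = (\<lambda>x. W +>\<^bsub>M\<^esub> x) ` carrier M"
  unfolding quot_space_def A_RCOSETS_def' by (simp add: image_def) blast

lemma coset_zero: "submodule R W M \<Longrightarrow> W +>\<^bsub>M\<^esub> \<zero>\<^bsub>M\<^esub> = W"
  by (rule M.a_coset_add_zero[OF submodule.subset])

lemma quot_space_zero: "submodule R W M \<Longrightarrow> \<zero>\<^bsub>quot_space M W\<^esub> = W +>\<^bsub>M\<^esub> \<zero>\<^bsub>M\<^esub>"
  by (simp add: coset_zero quot_space_def)

lemma quot_space_add:
  assumes "submodule R W M" "x \<in> carrier M" "y \<in> carrier M"
  shows "(W +>\<^bsub>M\<^esub> x) \<oplus>\<^bsub>quot_space M W\<^esub> (W +>\<^bsub>M\<^esub> y) = W +>\<^bsub>M\<^esub> (x \<oplus>\<^bsub>M\<^esub> y)"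
proof -
  interpret W: abelian_subgroup W M using assms(1) by (rule submodule_abelian_subgroup)
  show ?thesis using W.a_rcos_sum assms by (simp add: quot_space_def)
qed

text \<open>\<open>quot_space\<close> defines the scalar multiple as the union of the cosets of
  \<open>c y\<close> over all \<open>y\<close> in the given coset. These cosets coincide, since
  \<open>c y - c x = c (y - x)\<close> stays in \<open>W\<close>, and the union is over a nonempty
  set.\<close>

lemma quot_space_smult:
  assumes "submodule R W M" "x \<in> carrier M" "c \<in> carrier R"
  shows "c \<odot>\<^bsub>quot_space M W\<^esub> (W +>\<^bsub>M\<^esub> x) = W +>\<^bsub>M\<^esub> (c \<odot>\<^bsub>M\<^esub> x)"
proof -
  interpret W: abelian_subgroup W M using assms(1) by (rule submodule_abelian_subgroup)
  have *: "W +>\<^bsub>M\<^esub> (c \<odot>\<^bsub>M\<^esub> y) = W +>\<^bsub>M\<^esub> (c \<odot>\<^bsub>M\<^esub> x)" if "y \<in> W +>\<^bsub>M\<^esub> x" for y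
  proof -
    have y: "y \<in> carrier M" "y \<ominus>\<^bsub>M\<^esub> x \<in> W" using that assms in_coset_iff by auto
    have "c \<odot>\<^bsub>M\<^esub> y \<ominus>\<^bsub>M\<^esub> c \<odot>\<^bsub>M\<^esub> x = c \<odot>\<^bsub>M\<^esub> (y \<ominus>\<^bsub>M\<^esub> x)"
      using y assms by (simp add: M.minus_eq smult_r_distr smult_r_minus)
    then show ?thesis using y assms submodule.smult_closed[OF assms(1)] by (simp add: coset_eq_iff)
  qed
  have "(\<Union>y\<in>W +>\<^bsub>M\<^esub> x. W +>\<^bsub>M\<^esub> (c \<odot>\<^bsub>M\<^esub> y)) = W +>\<^bsub>M\<^esub> (c \<odot>\<^bsub>M\<^esub> x)"
    using * by (intro UN_constant_eq[OF W.a_rcos_self[OF assms(2)]]) blast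
  then show ?thesis by (simp add: quot_space_def)
qed

lemma quot_space_module:
  assumes W: "submodule R W M"
  shows "module R (quot_space M W)"
proof (rule module_criteria)
  show "cring R" by (rule R.cring_axioms)
  show "\<forall>v\<in>carrier (quot_space M W). \<exists>neg_v\<in>carrier (quot_space M W). v \<oplus>\<^bsub>quot_space M W\<^esub> neg_v = \<zero>\<^bsub>quot_space M W\<^esub>"
  proof
    fix v assume "v \<in> carrier (quot_space M W)"
    then obtain x where x: "x \<in> carrier M" "v = W +>\<^bsub>M\<^esub> x" by (auto simp: quot_space_carrier)
    then show "\<exists>neg_v\<in>carrier (quot_space M W). v \<oplus>\<^bsub>quot_space M W\<^esub> neg_v = \<zero>\<^bsub>quot_space M W\<^esub>"
      by (intro bexI[of _ "W +>\<^bsub>M\<^esub> (\<ominus>\<^bsub>M\<^esub> x)"])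
        (auto simp: quot_space_add[OF W] quot_space_zero[OF W] quot_space_carrier M.r_neg)
  qed
qed (auto simp: quot_space_carrier quot_space_add[OF W] quot_space_smult[OF W] quot_space_zero[OF W]
   M.a_ac smult_assoc1 smult_l_distr smult_r_distr)

lemma coset_hom:
  assumes W: "submodule R W M"
  shows "(\<lambda>x. W +>\<^bsub>M\<^esub> x) \<in> module_hom R M (quot_space M W)"
  by (auto simp: module_hom_def quot_space_carrier quot_space_add[OF W] quot_space_smult[OF W])

end

section \<open>Linear maps and the comparison of quotients\<close>

lemma mod_homI: "module K M \<Longrightarrow> module K N \<Longrightarrow> f \<in> module_hom K M N \<Longrightarrow> mod_hom K M N f"
  by (simp add: mod_hom_def mod_hom_axioms_def)

lemma module_homD:
  assumes "f \<in> module_hom K M N"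
  shows "x \<in> carrier M \<Longrightarrow> f x \<in> carrier N"
    and "x \<in> carrier M \<Longrightarrow> y \<in> carrier M \<Longrightarrow> f (x \<oplus>\<^bsub>M\<^esub> y) = f x \<oplus>\<^bsub>N\<^esub> f y"
    and "c \<in> carrier K \<Longrightarrow> x \<in> carrier M \<Longrightarrow> f (c \<odot>\<^bsub>M\<^esub> x) = c \<odot>\<^bsub>N\<^esub> f x"
  using assms by (auto simp: module_hom_def)

lemma module_hom_zero:
  "module K M \<Longrightarrow> module K N \<Longrightarrow> f \<in> module_hom K M N \<Longrightarrow> f \<zero>\<^bsub>M\<^esub> = \<zero>\<^bsub>N\<^esub>"
  by (rule mod_hom.f0_is_0[OF mod_homI])

lemma module_hom_minus:
  "module K M \<Longrightarrow> module K N \<Longrightarrow> f \<in> module_hom K M N \<Longrightarrow> x \<in> carrier M \<Longrightarrow> y \<in> carrier M \<Longrightarrow>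
     f (x \<ominus>\<^bsub>M\<^esub> y) = f x \<ominus>\<^bsub>N\<^esub> f y"
  by (rule mod_hom.f_minus[OF mod_homI])

lemma module_hom_compose:
  "f \<in> module_hom K M N \<Longrightarrow> g \<in> module_hom K N L \<Longrightarrow> (\<lambda>x. g (f x)) \<in> module_hom K M L"
  by (auto simp: module_hom_def Pi_iff)

lemma module_hom_id: "(\<lambda>x. x) \<in> module_hom K M M"
  by (auto simp: module_hom_def)

text \<open>Both quotients are the quotient of \<open>P\<close> by the common preimage of
  \<open>A0\<close> and \<open>B0\<close>. Comparing them through \<open>P\<close> avoids a map
  between \<open>A\<close> and \<open>B\<close>, for which there is no natural candidate; in degree
  1 this plays the role of the connecting homomorphism.\<close>

lemma quot_space_iso:
  fixes P :: "('k, 'p, 'x) module_scheme"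
  assumes P: "module K P" and A: "submodule K A0 A" and B: "submodule K B0 B"
    and f: "f \<in> module_hom K P A" "f ` carrier P = carrier A"
    and g: "g \<in> module_hom K P B" "g ` carrier P = carrier B"
    and eq: "\<And>p. p \<in> carrier P \<Longrightarrow> f p \<in> A0 \<longleftrightarrow> g p \<in> B0"
  shows "space_iso K (quot_space A A0) (quot_space B B0)"
proof -
  have mA: "module K A" and mB: "module K B" using A B by (auto simp: submodule.module)
  interpret P: module K P by (rule P)
  interpret A: module K A by (rule mA)
  interpret B: module K B by (rule mB)
  let ?a = "\<lambda>p. A0 +>\<^bsub>A\<^esub> f p" and ?b = "\<lambda>p. B0 +>\<^bsub>B\<^esub> g p"
  have carr: "carrier (quot_space A A0) = ?a ` carrier P" "carrier (quot_space B B0) = ?b ` carrier P"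
    unfolding A.quot_space_carrier B.quot_space_carrier f(2)[symmetric] g(2)[symmetric] by (simp_all add: image_image)
  have a: "?a \<in> module_hom K P (quot_space A A0)" by (rule module_hom_compose[OF f(1) A.coset_hom[OF A]])
  have b: "?b \<in> module_hom K P (quot_space B B0)" by (rule module_hom_compose[OF g(1) B.coset_hom[OF B]])
  have ab: "?a p = ?a q \<longleftrightarrow> ?b p = ?b q" if "p \<in> carrier P" "q \<in> carrier P" for p q
  proof -
    have "?a p = ?a q \<longleftrightarrow> f (p \<ominus>\<^bsub>P\<^esub> q) \<in> A0"
      using A.coset_eq_iff[OF A module_homD(1)[OF f(1) that(1)] module_homD(1)[OF f(1) that(2)]]
        module_hom_minus[OF P mA f(1) that] by simp
    also have "\<dots> \<longleftrightarrow> g (p \<ominus>\<^bsub>P\<^esub> q) \<in> B0" by (rule eq[OF P.M.minus_closed[OF that]])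
    also have "\<dots> \<longleftrightarrow> ?b p = ?b q"
      using B.coset_eq_iff[OF B module_homD(1)[OF g(1) that(1)] module_homD(1)[OF g(1) that(2)]]
        module_hom_minus[OF P mB g(1) that] by simp
    finally show ?thesis .
  qed
  \<comment> \<open>\<open>h\<close> sends a coset to the image of some preimage in
    \<open>P\<close>; by \<open>ab\<close> the choice is immaterial.\<close>
  define h where "h t = ?b (SOME p. p \<in> carrier P \<and> ?a p = t)" for t
  have h: "h (?a p) = ?b p" if p: "p \<in> carrier P" for p
  proof -
    have "(SOME q. q \<in> carrier P \<and> ?a q = ?a p) \<in> carrier P \<and> ?a (SOME q. q \<in> carrier P \<and> ?a q = ?a p) = ?a p"
      by (rule someI[of _ p]) (simp add: p)
    then show ?thesis unfolding h_def using ab p by blast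
  qed
  have "h (?a p \<oplus>\<^bsub>quot_space A A0\<^esub> ?a q) = h (?a p) \<oplus>\<^bsub>quot_space B B0\<^esub> h (?a q)"
    if "p \<in> carrier P" "q \<in> carrier P" for p q
    using module_homD(2)[OF a that] module_homD(2)[OF b that] h that h[of "p \<oplus>\<^bsub>P\<^esub> q"] by simp
  moreover have "h (c \<odot>\<^bsub>quot_space A A0\<^esub> ?a p) = c \<odot>\<^bsub>quot_space B B0\<^esub> h (?a p)"
    if "p \<in> carrier P" "c \<in> carrier K" for p c
    using module_homD(3)[OF a that(2,1)] module_homD(3)[OF b that(2,1)] h that h[of "c \<odot>\<^bsub>P\<^esub> p"] by simp
  ultimately have "h \<in> module_hom K (quot_space A A0) (quot_space B B0)"
    unfolding module_hom_def carr by (auto simp: h)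
  moreover have "bij_betw h (carrier (quot_space A A0)) (carrier (quot_space B B0))"
    unfolding bij_betw_def carr
  proof
    show "inj_on h (?a ` carrier P)"
    proof (rule inj_onI)
      fix t u assume "t \<in> ?a ` carrier P" "u \<in> ?a ` carrier P" and tu: "h t = h u"
      then obtain p q where "p \<in> carrier P" "t = ?a p" "q \<in> carrier P" "u = ?a q" by (elim imageE) simp
      then show "t = u" using tu ab[of p q] h by simp
    qed
    show "h ` ?a ` carrier P = ?b ` carrier P" by (simp add: image_image h cong: image_cong_simp)
  qed
  ultimately show ?thesis unfolding space_iso_def by blast
qed

lemma quot_space_self_iso:
  assumes M: "module K M"
  shows "space_iso K (quot_space M (carrier M)) zero_space"
proof -
  interpret M: module K M by (rule M)
  have sub: "submodule K (carrier M) M" using M by (intro submodule.intro) auto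
  have "carrier M +>\<^bsub>M\<^esub> x = carrier M" if "x \<in> carrier M" for x
    using M.coset_eq_iff[OF sub that M.M.zero_closed] M.coset_zero[OF sub] that by simp
  then have carr: "carrier (quot_space M (carrier M)) = {carrier M}"
    unfolding M.quot_space_carrier using M.M.zero_closed by force
  have "(\<lambda>_. ()) \<in> module_hom K (quot_space M (carrier M)) zero_space"
    by (auto simp: module_hom_def zero_space_def)
  then show ?thesis unfolding space_iso_def
    by (intro bexI[of _ "\<lambda>_. ()"]) (simp_all add: carr zero_space_def bij_betw_def)
qed

section \<open>Free modules and tensor products\<close>

lemma free_space_simps:
  "f \<in> carrier (free_space K B) \<longleftrightarrow>
     f ` B \<subseteq> carrier K \<and> (\<forall>x. x \<notin> B \<longrightarrow> f x = \<zero>\<^bsub>K\<^esub>) \<and> finite {x. f x \<noteq> \<zero>\<^bsub>K\<^esub>}"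
  "\<zero>\<^bsub>free_space K B\<^esub> = (\<lambda>_. \<zero>\<^bsub>K\<^esub>)"
  "f \<oplus>\<^bsub>free_space K B\<^esub> g = (\<lambda>x. f x \<oplus>\<^bsub>K\<^esub> g x)"
  "c \<odot>\<^bsub>free_space K B\<^esub> f = (\<lambda>x. c \<otimes>\<^bsub>K\<^esub> f x)"
  by (simp_all add: free_space_def)

context cring
begin

lemma free_space_value: "f \<in> carrier (free_space R B) \<Longrightarrow> f x \<in> carrier R"
  by (cases "x \<in> B") (auto simp: free_space_simps)

lemma free_space_support: "f \<in> carrier (free_space R B) \<Longrightarrow> {x. f x \<noteq> \<zero>\<^bsub>R\<^esub>} \<subseteq> B"
  by (auto simp: free_space_simps)

lemma free_space_add_closed:
  assumes "f \<in> carrier (free_space R B)" "g \<in> carrier (free_space R B)"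
  shows "(\<lambda>x. f x \<oplus> g x) \<in> carrier (free_space R B)"
proof -
  have "finite {x. f x \<oplus> g x \<noteq> \<zero>}"
    by (rule finite_subset[of _ "{x. f x \<noteq> \<zero>} \<union> {x. g x \<noteq> \<zero>}"])
      (use assms in \<open>auto simp: free_space_simps\<close>)
  then show ?thesis using assms by (auto simp: free_space_simps)
qed

lemma free_space_smult_closed:
  assumes "f \<in> carrier (free_space R B)" "c \<in> carrier R"
  shows "(\<lambda>x. c \<otimes> f x) \<in> carrier (free_space R B)"
proof -
  have "finite {x. c \<otimes> f x \<noteq> \<zero>}"
    by (rule finite_subset[of _ "{x. f x \<noteq> \<zero>}"]) (use assms in \<open>auto simp: free_space_simps\<close>)
  then show ?thesis using assms by (auto simp: free_space_simps)
qed

lemma free_space_module: "module R (free_space R B)"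
proof (rule module_criteria)
  show "\<forall>v\<in>carrier (free_space R B). \<exists>w\<in>carrier (free_space R B). v \<oplus>\<^bsub>free_space R B\<^esub> w = \<zero>\<^bsub>free_space R B\<^esub>"
  proof
    fix f assume f: "f \<in> carrier (free_space R B)"
    have "(\<lambda>x. \<ominus> \<one> \<otimes> f x) \<in> carrier (free_space R B)"
      by (rule free_space_smult_closed[OF f]) simp
    moreover have "f x \<oplus> \<ominus> \<one> \<otimes> f x = \<zero>" for x
      using free_space_value[OF f, of x] by (simp add: l_minus r_neg)
    ultimately show "\<exists>w\<in>carrier (free_space R B). f \<oplus>\<^bsub>free_space R B\<^esub> w = \<zero>\<^bsub>free_space R B\<^esub>"
      unfolding free_space_simps(2,3) by (intro bexI[of _ "\<lambda>x. \<ominus> \<one> \<otimes> f x"]) auto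
  qed
next
  show "\<zero>\<^bsub>free_space R B\<^esub> \<in> carrier (free_space R B)" by (auto simp: free_space_simps)
qed (auto simp: free_space_simps(2-4) free_space_add_closed free_space_smult_closed free_space_value
      is_cring a_ac m_assoc l_distr r_distr)

lemma free_gen_carrier: "x \<in> B \<Longrightarrow> free_gen R x \<in> carrier (free_space R B)"
  by (auto simp: free_space_simps free_gen_def)

text \<open>A finitely supported function is reached from zero by adding multiples of generators.
  The induction runs over a finite set containing the support, not over the support itself, so that
  erasing one value needs no case distinction on whether it was zero.\<close>

lemma free_space_induct [consumes 1, case_names zero add]:
  assumes f: "f \<in> carrier (free_space R B)"
    and zero: "P \<zero>\<^bsub>free_space R B\<^esub>"
    and add: "\<And>f c x. f \<in> carrier (free_space R B) \<Longrightarrow> P f \<Longrightarrow> c \<in> carrier R \<Longrightarrow> x \<in> B \<Longrightarrow>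
      P (f \<oplus>\<^bsub>free_space R B\<^esub> c \<odot>\<^bsub>free_space R B\<^esub> free_gen R x)"
  shows "P f"
proof -
  interpret F: module R "free_space R B" by (rule free_space_module)
  have "P f" if "finite A" "{x. f x \<noteq> \<zero>} \<subseteq> A" "A \<subseteq> B" "f \<in> carrier (free_space R B)" for A f
    using that
  proof (induction A arbitrary: f rule: finite_induct)
    case empty
    then have "f = \<zero>\<^bsub>free_space R B\<^esub>" by (auto simp: free_space_simps)
    then show ?case using zero by simp
  next
    case (insert a A)
    define g where "g = (\<lambda>x. if x = a then \<zero> else f x)"
    have "finite {x. g x \<noteq> \<zero>}"
      by (rule finite_subset[OF _ finite.insertI[OF insert.hyps(1), of a]])
        (use insert.prems in \<open>auto simp: g_def\<close>)
    then have g: "g \<in> carrier (free_space R B)" "{x. g x \<noteq> \<zero>} \<subseteq> A"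
      using insert.prems by (auto simp: free_space_simps g_def)
    have "f = g \<oplus>\<^bsub>free_space R B\<^esub> f a \<odot>\<^bsub>free_space R B\<^esub> free_gen R a"
      using free_space_value[OF insert.prems(3)]
      by (auto simp: free_space_simps g_def free_gen_def)
    moreover have "P g" using insert.IH g insert.prems by auto
    ultimately show ?case
      using add[OF g(1), of "f a" a] insert.prems free_space_value[OF insert.prems(3)] by auto
  qed
  from this[OF _ order_refl free_space_support[OF f] f] show ?thesis
    using f by (simp add: free_space_simps)
qed

end

text \<open>The sum that \<open>tensor_lift\<close> forms from its chosen representative, taken as a
  map on the free module before passing to the quotient.\<close>

definition free_lift :: "('k, 'r) ring_scheme \<Rightarrow> ('k, 't, 'x) module_scheme \<Rightarrow> ('p \<Rightarrow> 't) \<Rightarrow> ('p \<Rightarrow> 'k) \<Rightarrow> 't" where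
  "free_lift K T \<beta> f = (\<Oplus>\<^bsub>T\<^esub>p \<in> {p. f p \<noteq> \<zero>\<^bsub>K\<^esub>}. f p \<odot>\<^bsub>T\<^esub> \<beta> p)"

context module
begin

text \<open>Summands outside the support vanish, so any finite superset of it may be summed over.
  This gives two functions with different supports a common index set.\<close>

lemma free_lift_eq:
  assumes "f \<in> carrier (free_space R B)" "\<beta> \<in> B \<rightarrow> carrier M"
    and "finite A" "{p. f p \<noteq> \<zero>\<^bsub>R\<^esub>} \<subseteq> A" "A \<subseteq> B"
  shows "free_lift R M \<beta> f = (\<Oplus>\<^bsub>M\<^esub>p \<in> A. f p \<odot>\<^bsub>M\<^esub> \<beta> p)"
  unfolding free_lift_def
  by (rule M.add.finprod_mono_neutral_cong_left)
    (use assms R.free_space_value[OF assms(1)] in \<open>auto intro!: smult_closed simp: Pi_iff subset_iff\<close>)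

lemma free_lift_hom:
  assumes \<beta>: "\<beta> \<in> B \<rightarrow> carrier M"
  shows "free_lift R M \<beta> \<in> module_hom R (free_space R B) M"
proof -
  note val = R.free_space_value
  have fin: "finite {p. f p \<noteq> \<zero>\<^bsub>R\<^esub>}" if "f \<in> carrier (free_space R B)" for f
    using that by (simp add: free_space_simps)
  note sub = R.free_space_support
  have \<beta>': "\<beta> p \<in> carrier M" if "p \<in> B" for p using \<beta> that by auto
  have closed: "free_lift R M \<beta> f \<in> carrier M" if f: "f \<in> carrier (free_space R B)" for f
    unfolding free_lift_def using sub[OF f] val[OF f] \<beta>' by (intro M.finsum_closed) auto
  have add: "free_lift R M \<beta> (f \<oplus>\<^bsub>free_space R B\<^esub> g) = free_lift R M \<beta> f \<oplus>\<^bsub>M\<^esub> free_lift R M \<beta> g"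
    if f: "f \<in> carrier (free_space R B)" and g: "g \<in> carrier (free_space R B)" for f g
  proof -
    let ?A = "{p. f p \<noteq> \<zero>\<^bsub>R\<^esub>} \<union> {p. g p \<noteq> \<zero>\<^bsub>R\<^esub>}"
    have A: "finite ?A" "?A \<subseteq> B" using fin[OF f] fin[OF g] sub[OF f] sub[OF g] by auto
    have fg: "(\<lambda>x. f x \<oplus>\<^bsub>R\<^esub> g x) \<in> carrier (free_space R B)" by (rule R.free_space_add_closed[OF f g])
    have "free_lift R M \<beta> (\<lambda>x. f x \<oplus>\<^bsub>R\<^esub> g x) = (\<Oplus>\<^bsub>M\<^esub>p \<in> ?A. (f p \<oplus>\<^bsub>R\<^esub> g p) \<odot>\<^bsub>M\<^esub> \<beta> p)"
      by (rule free_lift_eq[OF fg \<beta>]) (use A in auto)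
    also have "\<dots> = (\<Oplus>\<^bsub>M\<^esub>p \<in> ?A. f p \<odot>\<^bsub>M\<^esub> \<beta> p \<oplus>\<^bsub>M\<^esub> g p \<odot>\<^bsub>M\<^esub> \<beta> p)"
      by (rule M.finsum_cong') (use A \<beta>' val[OF f] val[OF g] in \<open>auto simp: smult_l_distr subset_iff\<close>)
    also have "\<dots> = (\<Oplus>\<^bsub>M\<^esub>p \<in> ?A. f p \<odot>\<^bsub>M\<^esub> \<beta> p) \<oplus>\<^bsub>M\<^esub> (\<Oplus>\<^bsub>M\<^esub>p \<in> ?A. g p \<odot>\<^bsub>M\<^esub> \<beta> p)"
      by (rule M.finsum_addf) (use A \<beta>' val[OF f] val[OF g] in \<open>auto simp: subset_iff\<close>)
    also have "\<dots> = free_lift R M \<beta> f \<oplus>\<^bsub>M\<^esub> free_lift R M \<beta> g"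
      using free_lift_eq[OF f \<beta> A(1) _ A(2)] free_lift_eq[OF g \<beta> A(1) _ A(2)] by simp
    finally show ?thesis by (simp add: free_space_simps)
  qed
  have smult: "free_lift R M \<beta> (c \<odot>\<^bsub>free_space R B\<^esub> f) = c \<odot>\<^bsub>M\<^esub> free_lift R M \<beta> f"
    if f: "f \<in> carrier (free_space R B)" and c: "c \<in> carrier R" for f c
  proof -
    let ?A = "{p. f p \<noteq> \<zero>\<^bsub>R\<^esub>}"
    have A: "finite ?A" "?A \<subseteq> B" using fin[OF f] sub[OF f] by auto
    have cf: "(\<lambda>x. c \<otimes>\<^bsub>R\<^esub> f x) \<in> carrier (free_space R B)" by (rule R.free_space_smult_closed[OF f c])
    have "free_lift R M \<beta> (\<lambda>x. c \<otimes>\<^bsub>R\<^esub> f x) = (\<Oplus>\<^bsub>M\<^esub>p \<in> ?A. (c \<otimes>\<^bsub>R\<^esub> f p) \<odot>\<^bsub>M\<^esub> \<beta> p)"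
      by (rule free_lift_eq[OF cf \<beta>]) (use A c in auto)
    also have "\<dots> = (\<Oplus>\<^bsub>M\<^esub>p \<in> ?A. c \<odot>\<^bsub>M\<^esub> (f p \<odot>\<^bsub>M\<^esub> \<beta> p))"
      by (rule M.finsum_cong') (use A \<beta>' val[OF f] c in \<open>auto simp: smult_assoc1 subset_iff\<close>)
    also have "\<dots> = c \<odot>\<^bsub>M\<^esub> free_lift R M \<beta> f"
      unfolding free_lift_def
      by (rule finsum_smult[symmetric]) (use A \<beta>' val[OF f] c in \<open>auto simp: subset_iff\<close>)
    finally show ?thesis by (simp add: free_space_simps)
  qed
  show ?thesis by (simp add: module_hom_def closed add smult)
qed

lemma free_lift_gen:
  assumes "\<beta> \<in> B \<rightarrow> carrier M" "x \<in> B"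
  shows "free_lift R M \<beta> (free_gen R x) = \<beta> x"
proof -
  have "free_lift R M \<beta> (free_gen R x) = (\<Oplus>\<^bsub>M\<^esub>p \<in> {x}. free_gen R x p \<odot>\<^bsub>M\<^esub> \<beta> p)"
    by (rule free_lift_eq[OF R.free_gen_carrier[OF assms(2)] assms(1)]) (use assms in \<open>auto simp: free_gen_def\<close>)
  also have "\<dots> = \<beta> x" using assms by (subst M.finsum_insert) (auto simp: free_gen_def Pi_iff)
  finally show ?thesis .
qed

end

section \<open>Bilinear maps and the universal property of the tensor product\<close>

definition bilinear ::
    "('k, 'r) ring_scheme \<Rightarrow> ('k, 'v, 'x) module_scheme \<Rightarrow> ('k, 'w, 'y) module_scheme
      \<Rightarrow> ('k, 't, 'z) module_scheme \<Rightarrow> ('v \<Rightarrow> 'w \<Rightarrow> 't) \<Rightarrow> bool" where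
  "bilinear K V W T \<beta> \<longleftrightarrow> (\<forall>v \<in> carrier V. \<beta> v \<in> module_hom K W T)
     \<and> (\<forall>w \<in> carrier W. (\<lambda>v. \<beta> v w) \<in> module_hom K V T)"

lemma bilinear_relations_subset:
  assumes "module K V" "module K W"
  shows "bilinear_relations K V W \<subseteq> carrier (free_space K (carrier V \<times> carrier W))"
proof -
  interpret V: module K V by fact
  interpret W: module K W by fact
  interpret F: module K "free_space K (carrier V \<times> carrier W)" by (rule V.R.free_space_module)
  show ?thesis
    unfolding bilinear_relations_def Let_def
    by (intro Un_least subsetI; elim CollectE exE conjE; simp)
      (intro F.M.minus_closed F.M.add.m_closed F.smult_closed V.R.free_gen_carrier; simp)+
qed

lemma tensor_kernel_submodule:
  assumes "module K V" "module K W"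
  shows "submodule K (tensor_kernel K V W) (free_space K (carrier V \<times> carrier W))"
proof -
  interpret V: module K V by fact
  show ?thesis unfolding tensor_kernel_def
    by (rule module.span_is_submodule[OF V.R.free_space_module bilinear_relations_subset[OF assms]])
qed

lemma tensor_module:
  assumes "module K V" "module K W"
  shows "module K (tensor K V W)"
proof -
  interpret V: module K V by fact
  show ?thesis unfolding tensor_def
    by (rule module.quot_space_module[OF V.R.free_space_module tensor_kernel_submodule[OF assms]])
qed

lemma tensor_coset_hom:
  assumes "module K V" "module K W"
  shows "(\<lambda>f. tensor_kernel K V W +>\<^bsub>free_space K (carrier V \<times> carrier W)\<^esub> f)
     \<in> module_hom K (free_space K (carrier V \<times> carrier W)) (tensor K V W)"
proof -
  interpret V: module K V by fact
  show ?thesis unfolding tensor_def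
    by (rule module.coset_hom[OF V.R.free_space_module tensor_kernel_submodule[OF assms]])
qed

lemma pure_tensor_closed:
  assumes "module K V" "module K W" "v \<in> carrier V" "w \<in> carrier W"
  shows "pure_tensor K V W v w \<in> carrier (tensor K V W)"
proof -
  interpret V: module K V by fact
  show ?thesis unfolding pure_tensor_def
    by (rule module_homD(1)[OF tensor_coset_hom[OF assms(1,2)]]) (simp add: V.R.free_gen_carrier assms)
qed

lemma pure_tensor_bilinear:
  assumes VW: "module K V" "module K W"
  shows "bilinear K V W (tensor K V W) (pure_tensor K V W)"
proof -
  interpret V: module K V by fact
  interpret W: module K W by fact
  let ?F = "free_space K (carrier V \<times> carrier W)"
  interpret F: module K ?F by (rule V.R.free_space_module)
  note hom = module_homD[OF tensor_coset_hom[OF VW]]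
  have gen: "free_gen K (v, w) \<in> carrier ?F" if "v \<in> carrier V" "w \<in> carrier W" for v w
    using that by (simp add: V.R.free_gen_carrier)
  \<comment> \<open>Elements that differ by a generating relation have the same class; each of the
    four laws below is one such relation.\<close>
  have rel: "tensor_kernel K V W +>\<^bsub>?F\<^esub> x = tensor_kernel K V W +>\<^bsub>?F\<^esub> y"
    if "x \<ominus>\<^bsub>?F\<^esub> y \<in> bilinear_relations K V W" "x \<in> carrier ?F" "y \<in> carrier ?F" for x y
    unfolding F.coset_eq_iff[OF tensor_kernel_submodule[OF VW] that(2,3)]
    using F.in_own_span[OF bilinear_relations_subset[OF VW]] that(1) by (auto simp: tensor_kernel_def)
  have "pure_tensor K V W (v \<oplus>\<^bsub>V\<^esub> v') w = pure_tensor K V W v w \<oplus>\<^bsub>tensor K V W\<^esub> pure_tensor K V W v' w"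
    if "v \<in> carrier V" "v' \<in> carrier V" "w \<in> carrier W" for v v' w
    unfolding pure_tensor_def hom(2)[OF gen gen, OF that(1,3,2,3), symmetric]
    by (rule rel, unfold bilinear_relations_def Let_def) (use that in blast, simp_all add: gen that)
  moreover have "pure_tensor K V W v (w \<oplus>\<^bsub>W\<^esub> w') = pure_tensor K V W v w \<oplus>\<^bsub>tensor K V W\<^esub> pure_tensor K V W v w'"
    if "v \<in> carrier V" "w \<in> carrier W" "w' \<in> carrier W" for v w w'
    unfolding pure_tensor_def hom(2)[OF gen gen, OF that(1,2,1,3), symmetric]
    by (rule rel, unfold bilinear_relations_def Let_def) (use that in blast, simp_all add: gen that)
  moreover have "pure_tensor K V W (c \<odot>\<^bsub>V\<^esub> v) w = c \<odot>\<^bsub>tensor K V W\<^esub> pure_tensor K V W v w"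
    if "v \<in> carrier V" "w \<in> carrier W" "c \<in> carrier K" for v w c
    unfolding pure_tensor_def hom(3)[OF that(3) gen, OF that(1,2), symmetric]
    by (rule rel, unfold bilinear_relations_def Let_def) (use that in blast, simp_all add: gen that)
  moreover have "pure_tensor K V W v (c \<odot>\<^bsub>W\<^esub> w) = c \<odot>\<^bsub>tensor K V W\<^esub> pure_tensor K V W v w"
    if "v \<in> carrier V" "w \<in> carrier W" "c \<in> carrier K" for v w c
    unfolding pure_tensor_def hom(3)[OF that(3) gen, OF that(1,2), symmetric]
    by (rule rel, unfold bilinear_relations_def Let_def) (use that in blast, simp_all add: gen that)
  ultimately show ?thesis
    by (auto simp: bilinear_def module_hom_def pure_tensor_closed[OF VW])
qed

lemma bilinearD:
  assumes "bilinear K V W T \<beta>"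
  shows "v \<in> carrier V \<Longrightarrow> \<beta> v \<in> module_hom K W T" "w \<in> carrier W \<Longrightarrow> (\<lambda>v. \<beta> v w) \<in> module_hom K V T"
    "v \<in> carrier V \<Longrightarrow> w \<in> carrier W \<Longrightarrow> \<beta> v w \<in> carrier T"
    "v \<in> carrier V \<Longrightarrow> v' \<in> carrier V \<Longrightarrow> w \<in> carrier W \<Longrightarrow> \<beta> (v \<oplus>\<^bsub>V\<^esub> v') w = \<beta> v w \<oplus>\<^bsub>T\<^esub> \<beta> v' w"
    "v \<in> carrier V \<Longrightarrow> w \<in> carrier W \<Longrightarrow> w' \<in> carrier W \<Longrightarrow> \<beta> v (w \<oplus>\<^bsub>W\<^esub> w') = \<beta> v w \<oplus>\<^bsub>T\<^esub> \<beta> v w'"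
    "c \<in> carrier K \<Longrightarrow> v \<in> carrier V \<Longrightarrow> w \<in> carrier W \<Longrightarrow> \<beta> (c \<odot>\<^bsub>V\<^esub> v) w = c \<odot>\<^bsub>T\<^esub> \<beta> v w"
    "c \<in> carrier K \<Longrightarrow> v \<in> carrier V \<Longrightarrow> w \<in> carrier W \<Longrightarrow> \<beta> v (c \<odot>\<^bsub>W\<^esub> w) = c \<odot>\<^bsub>T\<^esub> \<beta> v w"
  using assms by (auto simp: bilinear_def module_hom_def)

lemma bilinearI:
  assumes "\<And>v w. v \<in> carrier V \<Longrightarrow> w \<in> carrier W \<Longrightarrow> \<beta> v w \<in> carrier T"
    "\<And>v v' w. v \<in> carrier V \<Longrightarrow> v' \<in> carrier V \<Longrightarrow> w \<in> carrier W \<Longrightarrow> \<beta> (v \<oplus>\<^bsub>V\<^esub> v') w = \<beta> v w \<oplus>\<^bsub>T\<^esub> \<beta> v' w"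
    "\<And>v w w'. v \<in> carrier V \<Longrightarrow> w \<in> carrier W \<Longrightarrow> w' \<in> carrier W \<Longrightarrow> \<beta> v (w \<oplus>\<^bsub>W\<^esub> w') = \<beta> v w \<oplus>\<^bsub>T\<^esub> \<beta> v w'"
    "\<And>c v w. c \<in> carrier K \<Longrightarrow> v \<in> carrier V \<Longrightarrow> w \<in> carrier W \<Longrightarrow> \<beta> (c \<odot>\<^bsub>V\<^esub> v) w = c \<odot>\<^bsub>T\<^esub> \<beta> v w"
    "\<And>c v w. c \<in> carrier K \<Longrightarrow> v \<in> carrier V \<Longrightarrow> w \<in> carrier W \<Longrightarrow> \<beta> v (c \<odot>\<^bsub>W\<^esub> w) = c \<odot>\<^bsub>T\<^esub> \<beta> v w"
  shows "bilinear K V W T \<beta>"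
  using assms by (auto simp: bilinear_def module_hom_def)

text \<open>Pure tensors generate additively: the coefficient of a generator is absorbed into the
  left factor, so no scalar multiples occur in the induction step.\<close>

lemma tensor_induct [consumes 3, case_names zero add]:
  assumes VW: "module K V" "module K W" and t: "t \<in> carrier (tensor K V W)"
    and zero: "P \<zero>\<^bsub>tensor K V W\<^esub>"
    and add: "\<And>t v w. t \<in> carrier (tensor K V W) \<Longrightarrow> P t \<Longrightarrow> v \<in> carrier V \<Longrightarrow> w \<in> carrier W \<Longrightarrow>
      P (t \<oplus>\<^bsub>tensor K V W\<^esub> pure_tensor K V W v w)"
  shows "P t"
proof -
  interpret V: module K V by fact
  let ?F = "free_space K (carrier V \<times> carrier W)"
  interpret F: module K ?F by (rule V.R.free_space_module)
  note hom = module_homD[OF tensor_coset_hom[OF VW]]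
  obtain f where f: "f \<in> carrier ?F" "t = tensor_kernel K V W +>\<^bsub>?F\<^esub> f"
    using t by (auto simp: tensor_def F.quot_space_carrier)
  have "P (tensor_kernel K V W +>\<^bsub>?F\<^esub> f)"
    using f(1)
  proof (induction f rule: V.R.free_space_induct)
    case zero
    then show ?case
      using assms(4) module_hom_zero[OF F.module_axioms tensor_module[OF VW] tensor_coset_hom[OF VW]] by simp
  next
    case (add f c p)
    obtain v w where p: "p = (v, w)" "v \<in> carrier V" "w \<in> carrier W" using add.hyps by auto
    have gen: "free_gen K p \<in> carrier ?F" using add.hyps by (simp add: V.R.free_gen_carrier)
    have "tensor_kernel K V W +>\<^bsub>?F\<^esub> (f \<oplus>\<^bsub>?F\<^esub> c \<odot>\<^bsub>?F\<^esub> free_gen K p)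
       = (tensor_kernel K V W +>\<^bsub>?F\<^esub> f) \<oplus>\<^bsub>tensor K V W\<^esub> c \<odot>\<^bsub>tensor K V W\<^esub> pure_tensor K V W v w"
      using hom gen add.hyps by (simp add: pure_tensor_def p)
    also have "c \<odot>\<^bsub>tensor K V W\<^esub> pure_tensor K V W v w = pure_tensor K V W (c \<odot>\<^bsub>V\<^esub> v) w"
      using bilinearD(6)[OF pure_tensor_bilinear[OF VW]] add.hyps p by simp
    finally show ?case
      using assms(5)[OF hom(1)[OF add.hyps(1)] add.IH, of "c \<odot>\<^bsub>V\<^esub> v" w] p add.hyps by simp
  qed
  then show ?thesis using f by simp
qed

lemma tensor_hom_eqI:
  assumes VW: "module K V" "module K W" "module K T"
    and f: "f \<in> module_hom K (tensor K V W) T" and g: "g \<in> module_hom K (tensor K V W) T"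
    and eq: "\<And>v w. v \<in> carrier V \<Longrightarrow> w \<in> carrier W \<Longrightarrow> f (pure_tensor K V W v w) = g (pure_tensor K V W v w)"
    and t: "t \<in> carrier (tensor K V W)"
  shows "f t = g t"
  using VW(1,2) t
proof (induction t rule: tensor_induct)
  case zero
  then show ?case using module_hom_zero[OF tensor_module[OF VW(1,2)] VW(3)] f g by metis
next
  case (add t v w)
  then show ?case
    using module_homD(2)[OF f] module_homD(2)[OF g] eq pure_tensor_closed[OF VW(1,2)] by simp
qed

text \<open>\<open>tensor_lift\<close> evaluates an arbitrarily chosen representative. The linear
  extension of \<beta> to the free module kills the bilinearity relations, hence their span, so all
  representatives give the same value.\<close>

lemma tensor_lift:
  assumes VW: "module K V" "module K W" "module K T" and \<beta>: "bilinear K V W T \<beta>"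
  shows "tensor_lift K T \<beta> \<in> module_hom K (tensor K V W) T"
    and "\<And>v w. v \<in> carrier V \<Longrightarrow> w \<in> carrier W \<Longrightarrow> tensor_lift K T \<beta> (pure_tensor K V W v w) = \<beta> v w"
proof -
  interpret V: module K V by fact
  interpret W: module K W by fact
  interpret T: module K T by fact
  let ?F = "free_space K (carrier V \<times> carrier W)"
  let ?\<beta> = "\<lambda>p. \<beta> (fst p) (snd p)"
  let ?q = "\<lambda>f. tensor_kernel K V W +>\<^bsub>?F\<^esub> f"
  interpret F: module K ?F by (rule V.R.free_space_module)
  note sub = tensor_kernel_submodule[OF VW(1,2)]
  note \<beta>D = bilinearD[OF \<beta>]
  have \<beta>': "?\<beta> \<in> carrier V \<times> carrier W \<rightarrow> carrier T" using \<beta>D(3) by auto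
  note gen = V.R.free_gen_carrier
  note lhom = T.free_lift_hom[OF \<beta>']
  note l = module_homD[OF lhom] T.free_lift_gen[OF \<beta>'] module_hom_minus[OF F.module_axioms VW(3) lhom]
  interpret l: mod_hom K ?F T "free_lift K T ?\<beta>" by (rule mod_homI[OF F.module_axioms VW(3) lhom])
  have "bilinear_relations K V W \<subseteq> l.ker"
  proof
    fix x assume x: "x \<in> bilinear_relations K V W"
    have "free_lift K T ?\<beta> x = \<zero>\<^bsub>T\<^esub>"
      using x unfolding bilinear_relations_def Let_def
      by (elim UnE CollectE exE conjE; simp add: l gen \<beta>D)
    then show "x \<in> l.ker" using x bilinear_relations_subset[OF VW(1,2)] by (auto simp: l.ker_def)
  qed
  then have ker: "tensor_kernel K V W \<subseteq> l.ker"
    unfolding tensor_kernel_def by (rule F.span_is_subset[OF _ l.ker_is_submodule])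
  have lift: "tensor_lift K T \<beta> (?q f) = free_lift K T ?\<beta> f" if f: "f \<in> carrier ?F" for f
  proof -
    define g where "g = (SOME g. g \<in> ?q f)"
    have "f \<in> ?q f" using F.in_coset_iff[OF sub f] f submodule.zero_closed[OF sub]
      by (simp add: F.M.minus_eq F.M.r_neg)
    then have "g \<in> ?q f" unfolding g_def some_in_eq by blast
    then have g: "g \<in> carrier ?F" "g \<ominus>\<^bsub>?F\<^esub> f \<in> tensor_kernel K V W"
      using F.in_coset_iff[OF sub f] by auto
    then have "free_lift K T ?\<beta> g \<ominus>\<^bsub>T\<^esub> free_lift K T ?\<beta> f = \<zero>\<^bsub>T\<^esub>"
      using ker l(5)[OF g(1) f] by (auto simp: l.ker_def)
    then have "free_lift K T ?\<beta> g = free_lift K T ?\<beta> f"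
      using l(1) f g(1) by simp
    then show ?thesis by (simp add: tensor_lift_def g_def[symmetric] free_lift_def)
  qed
  show pure: "tensor_lift K T \<beta> (pure_tensor K V W v w) = \<beta> v w" if "v \<in> carrier V" "w \<in> carrier W" for v w
    using that unfolding pure_tensor_def by (subst lift) (simp_all add: gen l)
  have carr: "carrier (tensor K V W) = ?q ` carrier ?F"
    by (simp add: tensor_def F.quot_space_carrier)
  note q = module_homD(2,3)[OF tensor_coset_hom[OF VW(1,2)], symmetric]
  have "tensor_lift K T \<beta> (?q f \<oplus>\<^bsub>tensor K V W\<^esub> ?q g) = tensor_lift K T \<beta> (?q f) \<oplus>\<^bsub>T\<^esub> tensor_lift K T \<beta> (?q g)"
    if "f \<in> carrier ?F" "g \<in> carrier ?F" for f g
    unfolding q(1)[OF that] using that by (simp add: lift l)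
  moreover have "tensor_lift K T \<beta> (c \<odot>\<^bsub>tensor K V W\<^esub> ?q f) = c \<odot>\<^bsub>T\<^esub> tensor_lift K T \<beta> (?q f)"
    if "f \<in> carrier ?F" "c \<in> carrier K" for f c
    unfolding q(2)[OF that(2,1)] using that by (simp add: lift l)
  ultimately show "tensor_lift K T \<beta> \<in> module_hom K (tensor K V W) T"
    unfolding module_hom_def carr by (auto simp: lift l(1))
qed

section \<open>Functoriality and associativity of the tensor product\<close>

lemma tensor_map:
  assumes VW: "module K V" "module K W" and VW': "module K V'" "module K W'"
    and f: "f \<in> module_hom K V V'" and g: "g \<in> module_hom K W W'"
  shows tensor_map_hom: "tensor_map K V' W' f g \<in> module_hom K (tensor K V W) (tensor K V' W')"
    and tensor_map_pure: "\<And>v w. v \<in> carrier V \<Longrightarrow> w \<in> carrier W \<Longrightarrow>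
        tensor_map K V' W' f g (pure_tensor K V W v w) = pure_tensor K V' W' (f v) (g w)"
proof -
  note b = bilinearD[OF pure_tensor_bilinear[OF VW']]
  have "bilinear K V W (tensor K V' W') (\<lambda>v w. pure_tensor K V' W' (f v) (g w))"
    by (rule bilinearI) (simp_all add: b module_homD[OF f] module_homD[OF g])
  from tensor_lift[OF VW tensor_module[OF VW'] this]
  show "tensor_map K V' W' f g \<in> module_hom K (tensor K V W) (tensor K V' W')"
    and "\<And>v w. v \<in> carrier V \<Longrightarrow> w \<in> carrier W \<Longrightarrow>
        tensor_map K V' W' f g (pure_tensor K V W v w) = pure_tensor K V' W' (f v) (g w)"
    unfolding tensor_map_def by blast+
qed

lemma tensor_map_compose:
  assumes VW: "module K V" "module K W" and VW': "module K V'" "module K W'" and VW'': "module K V''" "module K W''"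
    and f: "f \<in> module_hom K V V'" and g: "g \<in> module_hom K W W'"
    and f': "f' \<in> module_hom K V' V''" and g': "g' \<in> module_hom K W' W''"
    and t: "t \<in> carrier (tensor K V W)"
  shows "tensor_map K V'' W'' f' g' (tensor_map K V' W' f g t)
    = tensor_map K V'' W'' (\<lambda>x. f' (f x)) (\<lambda>x. g' (g x)) t"
  by (rule tensor_hom_eqI[OF VW tensor_module[OF VW''] _ _ _ t])
    (simp_all add: module_hom_compose[OF tensor_map_hom[OF VW VW' f g] tensor_map_hom[OF VW' VW'' f' g']]
      tensor_map_hom[OF VW VW'' module_hom_compose[OF f f'] module_hom_compose[OF g g']]
      tensor_map_pure[OF VW VW'' module_hom_compose[OF f f'] module_hom_compose[OF g g']]
      tensor_map_pure[OF VW VW' f g] tensor_map_pure[OF VW' VW'' f' g'] module_homD(1)[OF f] module_homD(1)[OF g])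

lemma tensor_map_id:
  assumes VW: "module K V" "module K W" and t: "t \<in> carrier (tensor K V W)"
  shows "tensor_map K V W (\<lambda>x. x) (\<lambda>x. x) t = t"
  using tensor_hom_eqI[OF VW tensor_module[OF VW] tensor_map_hom[OF VW VW module_hom_id module_hom_id] module_hom_id _ t]
    tensor_map_pure[OF VW VW module_hom_id module_hom_id] by simp

text \<open>\<open>tensor_assoc\<close> is a lift of lifts, so the inner lift has to depend linearly
  on \<open>u\<close>. On a general element of V \<otimes> W this is hidden by the choice of a
  representative; it is proved by induction over sums of pure tensors, where the value of the inner
  lift is known.\<close>

lemma tensor_assoc_pure:
  assumes U: "module K U" and V: "module K V" and W: "module K W"
    and uvw: "u \<in> carrier U" "v \<in> carrier V" "w \<in> carrier W"
  shows "tensor_assoc K U V W (pure_tensor K U (tensor K V W) u (pure_tensor K V W v w))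
    = pure_tensor K (tensor K U V) W (pure_tensor K U V u v) w"
proof -
  let ?UV = "tensor K U V" and ?VW = "tensor K V W" and ?T = "tensor K (tensor K U V) W"
  let ?b = "\<lambda>u v w. pure_tensor K ?UV W (pure_tensor K U V u v) w"
  note UV = tensor_module[OF U V] and VW = tensor_module[OF V W]
  note T = tensor_module[OF UV W]
  note b1 = bilinearD[OF pure_tensor_bilinear[OF U V]] bilinearD[OF pure_tensor_bilinear[OF UV W]]
  have b: "bilinear K V W ?T (?b u)" if "u \<in> carrier U" for u
    using that by (intro bilinearI) (simp_all add: b1)
  note l = tensor_lift[OF V W T b]
  interpret T: module K ?T by (rule T)
  have "bilinear K U ?VW ?T (\<lambda>u. tensor_lift K ?T (?b u))"
  proof (rule bilinearI)
    fix u u' t assume u: "u \<in> carrier U" "u' \<in> carrier U" and t: "t \<in> carrier ?VW"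
    have uu: "u \<oplus>\<^bsub>U\<^esub> u' \<in> carrier U" using u module.axioms(2)[OF U] by (simp add: abelian_groupE)
    from V W t show "tensor_lift K ?T (?b (u \<oplus>\<^bsub>U\<^esub> u')) t = tensor_lift K ?T (?b u) t \<oplus>\<^bsub>?T\<^esub> tensor_lift K ?T (?b u') t"
    proof (induction t rule: tensor_induct)
      case zero
      show ?case using module_hom_zero[OF VW T l(1)] u uu by simp
    next
      case (add t v w)
      then show ?case
        using u uu pure_tensor_closed[OF V W]
        by (simp add: module_homD[OF l(1)] l(2) b1 T.M.a_ac)
    qed
  next
    fix c u t assume u: "u \<in> carrier U" "c \<in> carrier K" and t: "t \<in> carrier ?VW"
    have uu: "c \<odot>\<^bsub>U\<^esub> u \<in> carrier U" using u module.smult_closed[OF U] by simp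
    from V W t show "tensor_lift K ?T (?b (c \<odot>\<^bsub>U\<^esub> u)) t = c \<odot>\<^bsub>?T\<^esub> tensor_lift K ?T (?b u) t"
    proof (induction t rule: tensor_induct)
      case zero
      show ?case using module_hom_zero[OF VW T l(1)] u uu by simp
    next
      case (add t v w)
      then show ?case
        using u uu pure_tensor_closed[OF V W]
        by (simp add: module_homD[OF l(1)] l(2) b1 T.smult_r_distr)
    qed
  qed (use module_homD[OF l(1)] in simp_all)
  from tensor_lift(2)[OF U VW T this]
  show ?thesis using uvw unfolding tensor_assoc_def Let_def by (simp add: l pure_tensor_closed[OF V W])
qed

section \<open>Finite-dimensional spaces and unipotent maps\<close>

lemma submodule_module: "submodule K U M \<Longrightarrow> module K (M\<lparr>carrier := U\<rparr>)"
  using module.submodule_is_module submodule.module by blast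

lemma submodule_vectorspace: "vectorspace K M \<Longrightarrow> submodule K U M \<Longrightarrow> vectorspace K (M\<lparr>carrier := U\<rparr>)"
  by (simp add: vectorspace.subspace_is_vs subspace_def)

lemma submodule_vimage:
  assumes "module K M" "submodule K U N" "f \<in> module_hom K M N"
  shows "submodule K {x \<in> carrier M. f x \<in> U} M"
proof -
  interpret M: module K M by fact
  show ?thesis
    using assms module_homD[OF assms(3)] module_hom_zero[OF assms(1) submodule.module[OF assms(2)] assms(3)]
    by (intro submodule.intro) (auto intro: submodule.m_closed submodule.zero_closed submodule.smult_closed)
qed

lemma module_hom_image_submodule:
  assumes "module K M" "module K N" "f \<in> module_hom K M N"
  shows "submodule K (f ` carrier M) N"
  using mod_hom.im_is_submodule[OF mod_homI[OF assms]] by (simp add: mod_hom.im_def[OF mod_homI[OF assms]])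

text \<open>Finite dimension is restated as: some finite set lies in no proper submodule. This form
  avoids \<open>span\<close> and combines directly with preimages and intersections of
  submodules.\<close>

lemma fin_dim_iff:
  assumes "vectorspace K V"
  shows "vectorspace.fin_dim K V \<longleftrightarrow>
    (\<exists>A. finite A \<and> A \<subseteq> carrier V \<and> (\<forall>U. submodule K U V \<longrightarrow> A \<subseteq> U \<longrightarrow> carrier V \<subseteq> U))"
proof -
  interpret vectorspace K V by fact
  have *: "span A = carrier V \<longleftrightarrow> (\<forall>U. submodule K U V \<longrightarrow> A \<subseteq> U \<longrightarrow> carrier V \<subseteq> U)" if "A \<subseteq> carrier V" for A
  proof
    assume "span A = carrier V"
    then show "\<forall>U. submodule K U V \<longrightarrow> A \<subseteq> U \<longrightarrow> carrier V \<subseteq> U" using span_is_subset[of A] by simp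
  next
    assume "\<forall>U. submodule K U V \<longrightarrow> A \<subseteq> U \<longrightarrow> carrier V \<subseteq> U"
    then have "carrier V \<subseteq> span A" using span_is_submodule[OF that] in_own_span[OF that] by simp
    then show "span A = carrier V" using span_is_subset2[OF that] by (rule subset_antisym[rotated])
  qed
  show ?thesis unfolding fin_dim_def by (intro iff_exI conj_cong refl *)
qed

lemma fin_dim_image:
  assumes V: "vectorspace K V" "vectorspace.fin_dim K V" and W: "vectorspace K W"
    and f: "f \<in> module_hom K V W" "f ` carrier V = carrier W"
  shows "vectorspace.fin_dim K W"
  by (rule linear_map.surj_fin_dim[OF _ V(2) f(2)])
    (use assms in \<open>simp add: linear_map_def mod_hom_def mod_hom_axioms_def vectorspace_def\<close>)

text \<open>A submodule containing generators of both summands pulls back along each inclusion to a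
  submodule containing a generating set, hence to the whole summand.\<close>

lemma fin_dim_direct_sum:
  assumes V: "vectorspace K V" "vectorspace.fin_dim K V" and W: "vectorspace K W" "vectorspace.fin_dim K W"
  shows "vectorspace.fin_dim K (direct_sum V W)"
proof -
  interpret V: vectorspace K V by fact
  interpret W: vectorspace K W by fact
  obtain A where A: "finite A" "A \<subseteq> carrier V" "\<And>U. submodule K U V \<Longrightarrow> A \<subseteq> U \<Longrightarrow> carrier V \<subseteq> U"
    using V(2)[unfolded fin_dim_iff[OF V(1)]] by blast
  obtain B where B: "finite B" "B \<subseteq> carrier W" "\<And>U. submodule K U W \<Longrightarrow> B \<subseteq> U \<Longrightarrow> carrier W \<subseteq> U"
    using W(2)[unfolded fin_dim_iff[OF W(1)]] by blast
  let ?i = "\<lambda>v. (v, \<zero>\<^bsub>W\<^esub>)" and ?j = "\<lambda>w. (\<zero>\<^bsub>V\<^esub>, w)"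
  have i: "?i \<in> module_hom K V (direct_sum V W)" and j: "?j \<in> module_hom K W (direct_sum V W)"
    by (auto simp: module_hom_def direct_sum_def)
  have *: "carrier (direct_sum V W) \<subseteq> U"
    if U: "submodule K U (direct_sum V W)" "?i ` A \<union> ?j ` B \<subseteq> U" for U
  proof -
    have iU: "carrier V \<subseteq> {v \<in> carrier V. ?i v \<in> U}"
      by (rule A(3)[OF submodule_vimage[OF V.module_axioms U(1) i]]) (use U A in auto)
    have jU: "carrier W \<subseteq> {v \<in> carrier W. ?j v \<in> U}"
      by (rule B(3)[OF submodule_vimage[OF W.module_axioms U(1) j]]) (use U B in auto)
    have "(v, w) \<in> U" if vw: "v \<in> carrier V" "w \<in> carrier W" for v w
    proof -
      have "?i v \<oplus>\<^bsub>direct_sum V W\<^esub> ?j w \<in> U"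
        by (rule submodule.m_closed[OF U(1)]) (use iU jU vw in blast)+
      then show ?thesis using vw by (simp add: direct_sum_def)
    qed
    then show ?thesis by (auto simp: direct_sum_def)
  qed
  show ?thesis
    unfolding fin_dim_iff[OF direct_sum_is_vs[OF V(1) W(1)]]
  proof (intro exI conjI allI impI)
    show "finite (?i ` A \<union> ?j ` B)" using A(1) B(1) by simp
    show "?i ` A \<union> ?j ` B \<subseteq> carrier (direct_sum V W)" using A(2) B(2) by (auto simp: direct_sum_def)
  qed (rule *)
qed

text \<open>Sets independent in \<open>U\<close> are independent in \<open>V\<close>, so their size
  is bounded by that of a finite generating set of \<open>V\<close>. A maximal one therefore exists,
  and it generates \<open>U\<close>.\<close>

lemma fin_dim_submodule:
  assumes V: "vectorspace K V" "vectorspace.fin_dim K V" and U: "submodule K U V"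
  shows "vectorspace.fin_dim K (V\<lparr>carrier := U\<rparr>)"
proof -
  interpret V: vectorspace K V by fact
  interpret U: vectorspace K "V\<lparr>carrier := U\<rparr>" by (rule submodule_vectorspace[OF V(1) U])
  let ?P = "\<lambda>S. S \<subseteq> carrier (V\<lparr>carrier := U\<rparr>) \<and> U.lin_indpt S"
  obtain B where B: "finite B" "B \<subseteq> carrier V" "V.gen_set B" using V(2) by (auto simp: V.fin_dim_def)
  have "finite A \<and> card A \<le> card B" if "?P A" for A
  proof -
    have A: "A \<subseteq> carrier V" "V.lin_indpt A"
      using that V.span_li_not_depend(2)[OF _ U, of A] submodule.subset[OF U] by auto
    have "finite A" by (rule V.fin_dim_li_fin[OF V(2) A(2,1)])
    then show ?thesis using V.li_smaller_than_gen[OF _ B(1) A(1) B(2) A(2) B(3)] by auto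
  qed
  moreover have "?P {}" by (auto simp: U.lin_dep_def)
  ultimately obtain A where A: "finite A" "maximal A ?P"
    using maximal_exists[of ?P "card B" "{}"] by auto
  then have "A \<subseteq> carrier (V\<lparr>carrier := U\<rparr>)" unfolding maximal_def by blast
  then show ?thesis using U.max_li_is_gen[OF A(2)] A(1) unfolding U.fin_dim_def by blast
qed

text \<open>The module axioms pass along a surjection that preserves the operations, so they come
  for free on \<open>Y\<close>. This turns transported and modified records into modules.\<close>

lemma module_image:
  fixes Y :: "('k, 'w, 'y) module_scheme"
  assumes L: "module K L" and f: "f ` carrier L = carrier Y" "f \<zero>\<^bsub>L\<^esub> = \<zero>\<^bsub>Y\<^esub>"
    "\<And>x y. x \<in> carrier L \<Longrightarrow> y \<in> carrier L \<Longrightarrow> f (x \<oplus>\<^bsub>L\<^esub> y) = f x \<oplus>\<^bsub>Y\<^esub> f y"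
    "\<And>c x. c \<in> carrier K \<Longrightarrow> x \<in> carrier L \<Longrightarrow> f (c \<odot>\<^bsub>L\<^esub> x) = c \<odot>\<^bsub>Y\<^esub> f x"
  shows "module K Y"
proof -
  interpret L: module K L by fact
  have "\<exists>b\<in>carrier L. f x \<oplus>\<^bsub>Y\<^esub> f b = f \<zero>\<^bsub>L\<^esub>" if "x \<in> carrier L" for x
    using that f(3)[of x "\<ominus>\<^bsub>L\<^esub> x"] by (intro bexI[of _ "\<ominus>\<^bsub>L\<^esub> x"]) (auto simp: L.M.r_neg)
  then show ?thesis
    by (intro module_criteria)
     (auto simp: f(1)[symmetric] f(2)[symmetric] f(3)[symmetric] f(4)[symmetric] L.R.is_cring L.M.a_ac
        L.smult_assoc1 L.smult_l_distr L.smult_r_distr)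
qed

text \<open>The equivalence with \<open>Unipotent(S)\<close> only sees spaces on \<open>'u\<close>;
  this copies a space on another type along an injection \<open>h\<close>. The fields
  \<open>mult\<close> and \<open>one\<close> are fillers.\<close>

definition transport :: "('v \<Rightarrow> 'u) \<Rightarrow> ('k, 'v, 'x) module_scheme \<Rightarrow> ('k, 'u) module" where
  "transport h L = (let g = inv_into (carrier L) h in
     \<lparr>carrier = h ` carrier L, mult = (\<lambda>_ _. h \<zero>\<^bsub>L\<^esub>), one = h \<zero>\<^bsub>L\<^esub>, zero = h \<zero>\<^bsub>L\<^esub>,
      add = (\<lambda>a b. h (g a \<oplus>\<^bsub>L\<^esub> g b)), smult = (\<lambda>c a. h (c \<odot>\<^bsub>L\<^esub> g a))\<rparr>)"

lemma transport_hom: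
  assumes "module K L" "inj_on h (carrier L)"
  shows "module K (transport h L)" "h \<in> module_hom K L (transport h L)"
    and "bij_betw h (carrier L) (carrier (transport h L))"
proof -
  show "module K (transport h L)"
    by (rule module_image[OF assms(1), of h]) (use assms in \<open>auto simp: transport_def Let_def\<close>)
  show "h \<in> module_hom K L (transport h L)"
    using assms(2) by (auto simp: module_hom_def transport_def Let_def)
  show "bij_betw h (carrier L) (carrier (transport h L))"
    using assms(2) by (auto simp: bij_betw_def transport_def Let_def)
qed

text \<open>Nilpotence of \<open>f - 1\<close> already forces \<open>f\<close> to be bijective.\<close>

lemma unipotentI:
  assumes V: "module K V" and f: "f \<in> module_hom K V V"
    and nil: "\<And>v. v \<in> carrier V \<Longrightarrow> ((\<lambda>w. f w \<ominus>\<^bsub>V\<^esub> w) ^^ n) v = \<zero>\<^bsub>V\<^esub>"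
  shows "unipotent K V f"
proof -
  interpret V: module K V by fact
  let ?d = "\<lambda>w. f w \<ominus>\<^bsub>V\<^esub> w"
  note fD = module_homD[OF f]
  have d: "?d v \<in> carrier V" if "v \<in> carrier V" for v using that fD by simp
  \<comment> \<open>If \<open>f v = 0\<close>, then \<open>?d v\<close> is again killed by
    \<open>f\<close> and vanishes after one application of \<open>?d\<close> less. So
    \<open>?d v = 0\<close>, whence \<open>v = f v = 0\<close>.\<close>
  have inj0: "v = \<zero>\<^bsub>V\<^esub>" if "(?d ^^ m) v = \<zero>\<^bsub>V\<^esub>" "v \<in> carrier V" "f v = \<zero>\<^bsub>V\<^esub>" for v m
    using that
  proof (induction m arbitrary: v)
    case (Suc m)
    have "(?d ^^ m) (?d v) = \<zero>\<^bsub>V\<^esub>" using Suc.prems(1) by (simp only: funpow_Suc_right o_apply)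
    moreover have "f (?d v) = \<zero>\<^bsub>V\<^esub>"
      using module_hom_minus[OF V V f fD(1)[OF Suc.prems(2)] Suc.prems(2)]
      by (simp add: Suc.prems(3) module_hom_zero[OF V V f])
    ultimately have "?d v = \<zero>\<^bsub>V\<^esub>" using Suc.IH d[OF Suc.prems(2)] by blast
    then have "f v = v"
      by (rule iffD1[OF V.M.minus_other_side[OF fD(1)[OF Suc.prems(2)] Suc.prems(2)]])
    then show ?case using Suc.prems(3) by simp
  qed simp
  have surj: "\<exists>x\<in>carrier V. f x = v" if "(?d ^^ m) v = \<zero>\<^bsub>V\<^esub>" "v \<in> carrier V" for v m
    using that
  proof (induction m arbitrary: v)
    case 0
    then show ?case using module_hom_zero[OF V V f] by auto
  next
    case (Suc m)
    have "(?d ^^ m) (?d v) = \<zero>\<^bsub>V\<^esub>" using Suc.prems(1) by (simp only: funpow_Suc_right o_apply)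
    then obtain x where x: "x \<in> carrier V" "f x = ?d v" using Suc.IH d[OF Suc.prems(2)] by blast
    \<comment> \<open>The preimage of \<open>v\<close> is \<open>v - x\<close>, because
      \<open>f x = f v - v\<close>.\<close>
    have "f (v \<ominus>\<^bsub>V\<^esub> x) = f v \<ominus>\<^bsub>V\<^esub> (f v \<ominus>\<^bsub>V\<^esub> v)"
      using x Suc.prems by (simp add: module_hom_minus[OF V V f])
    also have "\<dots> = v" using fD(1)[OF Suc.prems(2)] Suc.prems(2)
      by (simp add: V.M.minus_eq V.M.minus_add V.M.r_neg1 V.M.minus_minus V.M.a_assoc[symmetric] V.M.r_neg)
    finally show ?case using x Suc.prems by (intro bexI[of _ "v \<ominus>\<^bsub>V\<^esub> x"]) auto
  qed
  have "inj_on f (carrier V)"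
  proof (rule inj_onI)
    fix x y assume xy: "x \<in> carrier V" "y \<in> carrier V" "f x = f y"
    have "f (x \<ominus>\<^bsub>V\<^esub> y) = \<zero>\<^bsub>V\<^esub>"
      using xy fD(1) by (simp add: module_hom_minus[OF V V f])
    then have "x \<ominus>\<^bsub>V\<^esub> y = \<zero>\<^bsub>V\<^esub>" using inj0[OF nil] xy by simp
    then show "x = y" using xy by simp
  qed
  moreover have "f ` carrier V = carrier V" using surj[OF nil] fD(1) by auto
  ultimately show ?thesis using nil f by (auto simp: unipotent_def bij_betw_def)
qed

section \<open>Iterates of a map minus the identity; auxiliary submodules and function
  spaces\<close>

lemma minus_id_funpow_closed:
  assumes V: "module K V" and a: "a \<in> carrier V \<rightarrow> carrier V" and v: "v \<in> carrier V"
  shows "((\<lambda>w. a w \<ominus>\<^bsub>V\<^esub> w) ^^ n) v \<in> carrier V"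
proof -
  interpret V: module K V by fact
  show ?thesis using v a by (induction n) auto
qed

lemma minus_id_funpow_commute:
  assumes V: "module K V" and W: "module K W" and f: "f \<in> module_hom K V W"
    and a: "a \<in> carrier V \<rightarrow> carrier V" and eq: "\<And>v. v \<in> carrier V \<Longrightarrow> f (a v) = b (f v)"
    and v: "v \<in> carrier V"
  shows "f (((\<lambda>w. a w \<ominus>\<^bsub>V\<^esub> w) ^^ n) v) = ((\<lambda>w. b w \<ominus>\<^bsub>W\<^esub> w) ^^ n) (f v)"
  using minus_id_funpow_closed[OF V a v] a
  by (induction n) (auto simp: module_hom_minus[OF V W f] eq Pi_iff)

lemma submodule_restrict:
  assumes U: "submodule K U M" and W: "submodule K W M"
  shows "submodule K (W \<inter> U) (M\<lparr>carrier := U\<rparr>)"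
  using submodule_module[OF U] submodule.m_closed[OF U] submodule.zero_closed[OF U] submodule.smult_closed[OF U]
    submodule.m_closed[OF W] submodule.zero_closed[OF W] submodule.smult_closed[OF W]
  by (intro submodule.intro) auto

lemma submodule_inter:
  assumes U: "submodule K U M" and W: "submodule K W M"
  shows "submodule K (U \<inter> W) M"
  using submodule.module[OF U] submodule.subset[OF U]
    submodule.m_closed[OF U] submodule.zero_closed[OF U] submodule.smult_closed[OF U]
    submodule.m_closed[OF W] submodule.zero_closed[OF W] submodule.smult_closed[OF W]
  by (intro submodule.intro) auto

lemma unipotent_objectD:
  assumes "unipotent_object K S V \<alpha>"
  shows "vectorspace K V" "vectorspace.fin_dim K V" "module K V" "s \<in> S \<Longrightarrow> \<alpha> s \<in> module_hom K V V"
  using assms by (auto simp: unipotent_object_def unipotent_def vectorspace_def)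

lemma map_space_simps:
  "carrier (map_space S V) = S \<rightarrow>\<^sub>E carrier V" "\<zero>\<^bsub>map_space S V\<^esub> = (\<lambda>s\<in>S. \<zero>\<^bsub>V\<^esub>)"
  "f \<oplus>\<^bsub>map_space S V\<^esub> g = (\<lambda>s\<in>S. f s \<oplus>\<^bsub>V\<^esub> g s)" "c \<odot>\<^bsub>map_space S V\<^esub> f = (\<lambda>s\<in>S. c \<odot>\<^bsub>V\<^esub> f s)"
  by (simp_all add: map_space_def)

lemma map_space_module:
  assumes V: "module K V"
  shows "module K (map_space S V)"
proof -
  interpret V: module K V by (rule V)
  have ext: "f = (\<lambda>s\<in>S. g s)" if "f \<in> S \<rightarrow>\<^sub>E carrier V" "\<And>s. s \<in> S \<Longrightarrow> f s = g s" for f g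
    by (rule extensionalityI[of _ S]) (use that in \<open>simp_all add: PiE_def\<close>)
  have mem: "f s \<in> carrier V" if "f \<in> S \<rightarrow>\<^sub>E carrier V" "s \<in> S" for f s
    using that by (rule PiE_mem)
  show ?thesis
  proof (rule module_criteria, unfold map_space_simps)
    show "cring K" by (rule V.R.is_cring)
    show "\<forall>f\<in>S \<rightarrow>\<^sub>E carrier V. \<exists>g\<in>S \<rightarrow>\<^sub>E carrier V. (\<lambda>s\<in>S. f s \<oplus>\<^bsub>V\<^esub> g s) = (\<lambda>s\<in>S. \<zero>\<^bsub>V\<^esub>)"
    proof
      fix f assume f: "f \<in> S \<rightarrow>\<^sub>E carrier V"
      show "\<exists>g\<in>S \<rightarrow>\<^sub>E carrier V. (\<lambda>s\<in>S. f s \<oplus>\<^bsub>V\<^esub> g s) = (\<lambda>s\<in>S. \<zero>\<^bsub>V\<^esub>)"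
      proof
        show "(\<lambda>s\<in>S. f s \<oplus>\<^bsub>V\<^esub> (\<lambda>s\<in>S. \<ominus>\<^bsub>V\<^esub> f s) s) = (\<lambda>s\<in>S. \<zero>\<^bsub>V\<^esub>)"
          by (rule restrict_ext) (simp add: mem[OF f] V.M.r_neg)
      qed (auto simp: mem[OF f])
    qed
    show "\<forall>f\<in>S \<rightarrow>\<^sub>E carrier V. (\<lambda>s\<in>S. f s \<oplus>\<^bsub>V\<^esub> (\<lambda>s\<in>S. \<zero>\<^bsub>V\<^esub>) s) = f"
      by (intro ballI ext[symmetric]) (simp_all add: mem)
    show "\<forall>f\<in>S \<rightarrow>\<^sub>E carrier V. (\<lambda>s\<in>S. \<one>\<^bsub>K\<^esub> \<odot>\<^bsub>V\<^esub> f s) = f"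
      by (intro ballI ext[symmetric]) (simp_all add: mem)
  qed (auto intro!: restrict_ext simp: mem V.M.a_ac V.smult_assoc1 V.smult_l_distr V.smult_r_distr)
qed

lemma submodule_kernel:
  assumes U: "submodule K U M" and N: "module K N" and f: "f \<in> module_hom K M N"
  shows "submodule K {x \<in> U. f x = \<zero>\<^bsub>N\<^esub>} M"
proof -
  interpret N: module K N by (rule N)
  note mM = submodule.module[OF U]
  have UM: "x \<in> carrier M" if "x \<in> U" for x using submodule.subset[OF U] that by auto
  show ?thesis
    using mM module_homD[OF f] module_hom_zero[OF mM N f] submodule.m_closed[OF U] submodule.zero_closed[OF U]
      submodule.smult_closed[OF U] submodule.subset[OF U]
    by (intro submodule.intro) (auto simp: UM)
qed

lemma zero_submodule:
  assumes M: "module K M"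
  shows "submodule K {\<zero>\<^bsub>M\<^esub>} M"
proof -
  interpret M: module K M by (rule M)
  show ?thesis using M by (intro submodule.intro) auto
qed

text \<open>By Lagrange in the additive group, the order of a finite ring annihilates its unit. The
  infinity of \<open>K\<close> provides the room in \<open>'u\<close> for extensions by a
  line.\<close>

lemma infinite_of_char_zero:
  assumes "ring K" and char: "\<And>n::nat. n > 0 \<Longrightarrow> [n] \<cdot>\<^bsub>K\<^esub> \<one>\<^bsub>K\<^esub> \<noteq> \<zero>\<^bsub>K\<^esub>"
  shows "infinite (carrier K)"
proof
  assume fin: "finite (carrier K)"
  interpret ring K by fact
  have "card (carrier K) > 0" using fin by (auto simp: card_gt_0_iff)
  moreover have "[card (carrier K)] \<cdot>\<^bsub>K\<^esub> \<one>\<^bsub>K\<^esub> = \<zero>\<^bsub>K\<^esub>"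
    using group.pow_order_eq_1[OF add.is_group, of "\<one>\<^bsub>K\<^esub>"] by (simp add: add_pow_def order_def)
  ultimately show False using char by blast
qed

section \<open>Constructions of objects of \<open>Unipotent(S)\<close>\<close>

lemma unipotent_object_nilpotent:
  assumes "unipotent_object K S V \<alpha>" "s \<in> S"
  obtains n where "\<And>v. v \<in> carrier V \<Longrightarrow> ((\<lambda>w. \<alpha> s w \<ominus>\<^bsub>V\<^esub> w) ^^ n) v = \<zero>\<^bsub>V\<^esub>"
proof -
  have "unipotent K V (\<alpha> s)" using assms by (simp add: unipotent_object_def)
  then show thesis using that unfolding unipotent_def by blast
qed

text \<open>Nilpotence of \<open>\<alpha> s - 1\<close> descends along an equivariant surjection.
  Linearity of \<open>\<beta> s\<close> descends in the same way, so \<beta> may be given as any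
  family of maps intertwined with \<alpha> by \<open>f\<close>.\<close>

lemma unipotent_object_image:
  assumes L: "unipotent_object K S L \<alpha>" and W: "vectorspace K W"
    and f: "f \<in> module_hom K L W" "f ` carrier L = carrier W"
    and eq: "\<And>s x. s \<in> S \<Longrightarrow> x \<in> carrier L \<Longrightarrow> f (\<alpha> s x) = \<beta> s (f x)"
  shows "unipotent_object K S W \<beta>"
proof -
  have L': "vectorspace K L" "vectorspace.fin_dim K L" using L by (auto simp: unipotent_object_def)
  have mL: "module K L" and mW: "module K W" using L' W by (auto simp: vectorspace_def)
  note fD = module_homD[OF f(1)]
  interpret L: module K L by (rule mL)
  have "unipotent K W (\<beta> s)" if s: "s \<in> S" for s
  proof -
    have \<alpha>: "\<alpha> s \<in> module_hom K L L" using L s by (auto simp: unipotent_object_def unipotent_def)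
    obtain n where n: "\<And>v. v \<in> carrier L \<Longrightarrow> ((\<lambda>w. \<alpha> s w \<ominus>\<^bsub>L\<^esub> w) ^^ n) v = \<zero>\<^bsub>L\<^esub>"
      by (rule unipotent_object_nilpotent[OF L s]) blast
    note \<alpha>D = module_homD[OF \<alpha>]
    have \<beta>: "\<beta> s (f x) = f (\<alpha> s x)" if "x \<in> carrier L" for x using eq[OF s that] by simp
    show ?thesis
    proof (rule unipotentI[OF mW])
      have "\<beta> s (f x \<oplus>\<^bsub>W\<^esub> f y) = \<beta> s (f x) \<oplus>\<^bsub>W\<^esub> \<beta> s (f y)" if "x \<in> carrier L" "y \<in> carrier L" for x y
        using that \<beta>[of "x \<oplus>\<^bsub>L\<^esub> y"] by (simp add: \<beta> fD \<alpha>D)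
      moreover have "\<beta> s (c \<odot>\<^bsub>W\<^esub> f x) = c \<odot>\<^bsub>W\<^esub> \<beta> s (f x)" if "x \<in> carrier L" "c \<in> carrier K" for x c
        using that \<beta>[of "c \<odot>\<^bsub>L\<^esub> x"] by (simp add: \<beta> fD \<alpha>D)
      moreover have "\<beta> s (f x) \<in> carrier W" if "x \<in> carrier L" for x
        using that by (simp add: \<beta> fD \<alpha>D)
      ultimately show "\<beta> s \<in> module_hom K W W"
        unfolding module_hom_def f(2)[symmetric] by auto
      fix w assume "w \<in> carrier W"
      then obtain x where x: "x \<in> carrier L" "w = f x" using f(2) by auto
      have "((\<lambda>w. \<beta> s w \<ominus>\<^bsub>W\<^esub> w) ^^ n) (f x) = f (((\<lambda>w. \<alpha> s w \<ominus>\<^bsub>L\<^esub> w) ^^ n) x)"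
        by (rule minus_id_funpow_commute[OF mL mW f(1) _ _ x(1), symmetric]) (use \<alpha>D(1) eq[OF s] in auto)
      then show "((\<lambda>w. \<beta> s w \<ominus>\<^bsub>W\<^esub> w) ^^ n) w = \<zero>\<^bsub>W\<^esub>"
        using n[OF x(1)] module_hom_zero[OF mL mW f(1)] x(2) by simp
    qed
  qed
  then show ?thesis using fin_dim_image[OF L' W f] W by (simp add: unipotent_object_def)
qed

lemma unipotent_object_direct_sum:
  assumes V: "unipotent_object K S V \<alpha>" and W: "unipotent_object K S W \<beta>"
  shows "unipotent_object K S (direct_sum V W) (\<lambda>s p. (\<alpha> s (fst p), \<beta> s (snd p)))"
proof -
  have V': "vectorspace K V" "vectorspace.fin_dim K V" and W': "vectorspace K W" "vectorspace.fin_dim K W"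
    using V W by (auto simp: unipotent_object_def)
  have mV: "module K V" and mW: "module K W" using V' W' by (auto simp: vectorspace_def)
  let ?D = "direct_sum V W"
  note D = direct_sum_is_vs[OF V'(1) W'(1)]
  have mD: "module K ?D" by (rule direct_sum_is_module[OF mV mW])
  interpret V: module K V by (rule mV)
  interpret W: module K W by (rule mW)
  have fs: "fst \<in> module_hom K ?D V" "snd \<in> module_hom K ?D W"
    by (auto simp: module_hom_def direct_sum_def)
  have "unipotent K ?D (\<lambda>p. (\<alpha> s (fst p), \<beta> s (snd p)))" (is "unipotent K ?D ?f") if s: "s \<in> S" for s
  proof -
    have \<alpha>: "\<alpha> s \<in> module_hom K V V" and \<beta>: "\<beta> s \<in> module_hom K W W"
      using V W s by (auto simp: unipotent_object_def unipotent_def)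
    note \<alpha>D = module_homD[OF \<alpha>] and \<beta>D = module_homD[OF \<beta>]
    obtain m where m: "\<And>v. v \<in> carrier V \<Longrightarrow> ((\<lambda>w. \<alpha> s w \<ominus>\<^bsub>V\<^esub> w) ^^ m) v = \<zero>\<^bsub>V\<^esub>"
      by (rule unipotent_object_nilpotent[OF V s]) blast
    obtain n where n: "\<And>v. v \<in> carrier W \<Longrightarrow> ((\<lambda>w. \<beta> s w \<ominus>\<^bsub>W\<^esub> w) ^^ n) v = \<zero>\<^bsub>W\<^esub>"
      by (rule unipotent_object_nilpotent[OF W s]) blast
    have f: "?f \<in> carrier ?D \<rightarrow> carrier ?D" using \<alpha>D(1) \<beta>D(1) by (auto simp: direct_sum_def)
    show ?thesis
    proof (rule unipotentI[OF mD])
      show "?f \<in> module_hom K ?D ?D"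
        using \<alpha>D \<beta>D by (auto simp: module_hom_def direct_sum_def)
      fix p assume p: "p \<in> carrier ?D"
      then have p': "fst p \<in> carrier V" "snd p \<in> carrier W" by (auto simp: direct_sum_def)
      \<comment> \<open>The sum of the two nilpotence exponents serves both coordinates, as each
        projection intertwines \<open>?f\<close> with the action on its summand.\<close>
      have "fst (((\<lambda>w. ?f w \<ominus>\<^bsub>?D\<^esub> w) ^^ (n + m)) p) = ((\<lambda>w. \<alpha> s w \<ominus>\<^bsub>V\<^esub> w) ^^ (n + m)) (fst p)"
        by (rule minus_id_funpow_commute[OF mD mV fs(1) f _ p]) simp
      also have "\<dots> = ((\<lambda>w. \<alpha> s w \<ominus>\<^bsub>V\<^esub> w) ^^ m) (((\<lambda>w. \<alpha> s w \<ominus>\<^bsub>V\<^esub> w) ^^ n) (fst p))"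
        by (subst add.commute) (simp only: funpow_add o_apply)
      also have "\<dots> = \<zero>\<^bsub>V\<^esub>"
        by (rule m, rule minus_id_funpow_closed[OF mV _ p'(1)]) (use \<alpha>D(1) in auto)
      finally have 1: "fst (((\<lambda>w. ?f w \<ominus>\<^bsub>?D\<^esub> w) ^^ (n + m)) p) = \<zero>\<^bsub>V\<^esub>" .
      have "snd (((\<lambda>w. ?f w \<ominus>\<^bsub>?D\<^esub> w) ^^ (n + m)) p) = ((\<lambda>w. \<beta> s w \<ominus>\<^bsub>W\<^esub> w) ^^ (n + m)) (snd p)"
        by (rule minus_id_funpow_commute[OF mD mW fs(2) f _ p]) simp
      also have "\<dots> = ((\<lambda>w. \<beta> s w \<ominus>\<^bsub>W\<^esub> w) ^^ n) (((\<lambda>w. \<beta> s w \<ominus>\<^bsub>W\<^esub> w) ^^ m) (snd p))"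
        by (simp only: funpow_add o_apply)
      also have "\<dots> = \<zero>\<^bsub>W\<^esub>"
        by (rule n, rule minus_id_funpow_closed[OF mW _ p'(2)]) (use \<beta>D(1) in auto)
      finally have 2: "snd (((\<lambda>w. ?f w \<ominus>\<^bsub>?D\<^esub> w) ^^ (n + m)) p) = \<zero>\<^bsub>W\<^esub>" .
      show "((\<lambda>w. ?f w \<ominus>\<^bsub>?D\<^esub> w) ^^ (n + m)) p = \<zero>\<^bsub>?D\<^esub>"
        by (rule prod_eqI) (simp_all add: 1 2, simp_all add: direct_sum_def)
    qed
  qed
  then show ?thesis
    using D fin_dim_direct_sum[OF V' W'] by (simp add: unipotent_object_def)
qed

definition self_space :: "('k, 'r) ring_scheme \<Rightarrow> ('k, 'k) module" where
  "self_space K = \<lparr>carrier = carrier K, mult = mult K, one = \<one>\<^bsub>K\<^esub>, zero = \<zero>\<^bsub>K\<^esub>, add = add K, smult = mult K\<rparr>"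

lemma self_space_simps [simp]:
  "carrier (self_space K) = carrier K" "\<zero>\<^bsub>self_space K\<^esub> = \<zero>\<^bsub>K\<^esub>"
  "a \<oplus>\<^bsub>self_space K\<^esub> b = a \<oplus>\<^bsub>K\<^esub> b" "a \<odot>\<^bsub>self_space K\<^esub> b = a \<otimes>\<^bsub>K\<^esub> b"
  by (simp_all add: self_space_def)

lemma (in cring) self_space_module: "module R (self_space R)"
  by (rule module_criteria) (auto simp: a_ac m_assoc l_distr r_distr is_cring intro!: bexI[of _ "\<ominus> _"] r_neg)

lemma self_space_vectorspace:
  assumes "field K"
  shows "vectorspace K (self_space K)" "vectorspace.fin_dim K (self_space K)"
proof -
  interpret field K by fact
  show vs: "vectorspace K (self_space K)"
    by (simp add: vectorspace_def assms self_space_module)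
  have "carrier K \<subseteq> U" if U: "submodule K U (self_space K)" "{\<one>\<^bsub>K\<^esub>} \<subseteq> U" for U
  proof
    fix c assume "c \<in> carrier K"
    then show "c \<in> U" using submodule.smult_closed[OF U(1), of c "\<one>\<^bsub>K\<^esub>"] U(2) by simp
  qed
  then show "vectorspace.fin_dim K (self_space K)"
    unfolding fin_dim_iff[OF vs] by (intro exI[of _ "{\<one>\<^bsub>K\<^esub>}"]) auto
qed

text \<open>The action is block triangular with diagonal blocks \<open>\<alpha> s\<close> and 1: an
  extension of the trivial line by \<open>V\<close>. The generators are free, so the vectors
  \<open>c s\<close> need not satisfy any compatibility and every map \<open>c\<close> defines an
  object.\<close>

lemma unipotent_object_extension:
  assumes V: "unipotent_object K S V \<alpha>" and c: "c \<in> S \<rightarrow> carrier V" and K: "field K"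
  shows "unipotent_object K S (direct_sum V (self_space K)) (\<lambda>s p. (\<alpha> s (fst p) \<oplus>\<^bsub>V\<^esub> snd p \<odot>\<^bsub>V\<^esub> c s, snd p))"
proof -
  have V': "vectorspace K V" "vectorspace.fin_dim K V" using V by (auto simp: unipotent_object_def)
  have mV: "module K V" using V' by (auto simp: vectorspace_def)
  let ?L = "self_space K"
  note L = self_space_vectorspace[OF K]
  have mL: "module K ?L" using L(1) by (auto simp: vectorspace_def)
  let ?D = "direct_sum V ?L"
  note D = direct_sum_is_vs[OF V'(1) L(1)]
  have mD: "module K ?D" by (rule direct_sum_is_module[OF mV mL])
  interpret V: module K V by (rule mV)
  interpret L: module K ?L by (rule mL)
  interpret D: module K ?D by (rule mD)
  let ?i = "\<lambda>v. (v, \<zero>\<^bsub>K\<^esub>)"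
  have fs: "fst \<in> module_hom K ?D V" "snd \<in> module_hom K ?D ?L" and i: "?i \<in> module_hom K V ?D"
    by (auto simp: module_hom_def direct_sum_def)
  have "unipotent K ?D (\<lambda>p. (\<alpha> s (fst p) \<oplus>\<^bsub>V\<^esub> snd p \<odot>\<^bsub>V\<^esub> c s, snd p))" (is "unipotent K ?D ?f") if s: "s \<in> S" for s
  proof -
    have cs: "c s \<in> carrier V" using c s by auto
    have \<alpha>: "\<alpha> s \<in> module_hom K V V"
      using V s by (auto simp: unipotent_object_def unipotent_def)
    note \<alpha>D = module_homD[OF \<alpha>]
    obtain m where m: "\<And>v. v \<in> carrier V \<Longrightarrow> ((\<lambda>w. \<alpha> s w \<ominus>\<^bsub>V\<^esub> w) ^^ m) v = \<zero>\<^bsub>V\<^esub>"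
      by (rule unipotent_object_nilpotent[OF V s]) blast
    have f: "?f \<in> module_hom K ?D ?D"
      using \<alpha>D cs by (auto simp: module_hom_def direct_sum_def V.smult_l_distr V.smult_r_distr V.smult_assoc1 V.M.a_ac)
    show ?thesis
    proof (rule unipotentI[OF mD f])
      fix p assume p: "p \<in> carrier ?D"
      define q where "q = ?f p \<ominus>\<^bsub>?D\<^esub> p"
      have fp: "?f p \<in> carrier ?D" by (rule module_homD(1)[OF f p])
      have q: "q \<in> carrier ?D" unfolding q_def by (rule D.M.minus_closed[OF fp p])
      have "snd q = snd (?f p) \<ominus>\<^bsub>?L\<^esub> snd p"
        unfolding q_def by (rule module_hom_minus[OF mD mL fs(2) fp p])
      also have "\<dots> = \<zero>\<^bsub>?L\<^esub>" using module_homD(1)[OF fs(2) p] by (simp add: L.M.minus_eq L.M.r_neg del: self_space_simps)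
      finally have q': "q = ?i (fst q)" by (simp add: prod_eq_iff)
      have fq: "fst q \<in> carrier V" by (rule module_homD(1)[OF fs(1) q])
      \<comment> \<open>One application of \<open>?f - 1\<close> lands in \<open>V\<close>, where
        the operator becomes \<open>\<alpha> s - 1\<close>; hence the exponent
        \<open>Suc m\<close>.\<close>
      have "((\<lambda>w. ?f w \<ominus>\<^bsub>?D\<^esub> w) ^^ Suc m) p = ((\<lambda>w. ?f w \<ominus>\<^bsub>?D\<^esub> w) ^^ m) (?i (fst q))"
        using q' by (simp only: funpow_Suc_right o_apply q_def)
      also have "\<dots> = ?i (((\<lambda>w. \<alpha> s w \<ominus>\<^bsub>V\<^esub> w) ^^ m) (fst q))"
        by (rule minus_id_funpow_commute[OF mV mD i _ _ fq, symmetric]) (use \<alpha>D(1) cs in auto)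
      also have "\<dots> = \<zero>\<^bsub>?D\<^esub>" unfolding m[OF fq] by (simp add: direct_sum_def)
      finally show "((\<lambda>w. ?f w \<ominus>\<^bsub>?D\<^esub> w) ^^ Suc m) p = \<zero>\<^bsub>?D\<^esub>" .
    qed
  qed
  then show ?thesis
    using D fin_dim_direct_sum[OF V' L] by (simp add: unipotent_object_def)
qed

text \<open>\<open>B\<close> is infinite because it contains a copy of \<open>A\<close>, so B x B is
  equinumerous with \<open>B\<close>. With B = Q and A = K this makes room in \<open>'u\<close> for
  Q \<oplus> K.\<close>

lemma inj_times_infinite:
  fixes A :: "'a set" and B :: "'b set"
  assumes A: "infinite A" and f: "inj_on f A" "f ` A \<subseteq> B"
  obtains h :: "'b \<times> 'a \<Rightarrow> 'b" where "inj_on h (B \<times> A)"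
proof -
  have "infinite B" using A f by (meson finite_imageD finite_subset)
  then obtain g where g: "bij_betw g (B \<times> B) B"
    using card_of_Times_same_infinite card_of_ordIso by blast
  have "inj_on (\<lambda>p. (fst p, f (snd p))) (B \<times> A)" using f(1) by (auto simp: inj_on_def)
  moreover have "(\<lambda>p. (fst p, f (snd p))) ` (B \<times> A) \<subseteq> B \<times> B" using f(2) by auto
  ultimately have "inj_on (g \<circ> (\<lambda>p. (fst p, f (snd p)))) (B \<times> A)"
    using g by (meson bij_betw_def comp_inj_on inj_on_subset)
  then show thesis by (rule that)
qed

section \<open>Comodules\<close>

locale affine_group =
  fixes K :: "('k, 'r) ring_scheme" and G :: "('k, 'a) group_scheme"
  assumes ags: "affine_group_scheme K G"
begin

lemma G_algebra: "algebra K G"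
  using ags by (simp add: affine_group_scheme_def)

lemma G_module: "module K G"
  by (rule algebra.module[OF G_algebra])

lemma K_field: "field K"
  using ags by (simp add: affine_group_scheme_def)

lemma G_one: "\<one>\<^bsub>G\<^esub> \<in> carrier G"
  by (rule cring.cring_simprules(6)[OF algebra.M_cring[OF G_algebra]])

lemma vectorspace_iff: "vectorspace K V \<longleftrightarrow> module K V"
  using K_field by (simp add: vectorspace_def)

lemma comoduleD:
  assumes "comodule K G V"
  shows "module K V" "coact V \<in> module_hom K V (tensor K V G)"
  using assms by (auto simp: comodule_def vectorspace_def)

lemma rep_homD:
  assumes "f \<in> rep_hom K G V W"
  shows "f \<in> module_hom K V W" "v \<in> carrier V \<Longrightarrow> coact W (f v) = tensor_map K W G f (\<lambda>a. a) (coact V v)"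
  using assms by (auto simp: rep_hom_def)

section \<open>Rational points acting on comodules\<close>

lemma point_simps:
  assumes "g \<in> points K G"
  shows "a \<in> carrier G \<Longrightarrow> g a \<in> carrier K"
    "a \<in> carrier G \<Longrightarrow> b \<in> carrier G \<Longrightarrow> g (a \<oplus>\<^bsub>G\<^esub> b) = g a \<oplus>\<^bsub>K\<^esub> g b"
    "c \<in> carrier K \<Longrightarrow> a \<in> carrier G \<Longrightarrow> g (c \<odot>\<^bsub>G\<^esub> a) = c \<otimes>\<^bsub>K\<^esub> g a"
    "g \<one>\<^bsub>G\<^esub> = \<one>\<^bsub>K\<^esub>"
  using assms by (auto simp: points_def ring_hom_def)

lemma action_bilinear:
  assumes g: "g \<in> points K G" and V: "module K V"
  shows "bilinear K V G V (\<lambda>w a. g a \<odot>\<^bsub>V\<^esub> w)"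
proof -
  interpret V: module K V by fact
  show ?thesis
    by (rule bilinearI)
      (auto simp: point_simps[OF g] V.smult_l_distr V.smult_r_distr V.smult_assoc1[symmetric] V.R.m_comm)
qed

lemma action_hom:
  assumes g: "g \<in> points K G" and V: "comodule K G V"
  shows "action K V g \<in> module_hom K V V"
  using module_hom_compose[OF comoduleD(2)[OF V] tensor_lift(1)[OF comoduleD(1)[OF V] G_module comoduleD(1)[OF V]
      action_bilinear[OF g comoduleD(1)[OF V]]]]
  by (simp add: action_def[abs_def])

text \<open>\<open>f\<close> acts on the left tensor factor and evaluation at \<open>g\<close> on
  the right one, so the two commute. This is checked on pure tensors and then applied to the
  coaction of \<open>v\<close>.\<close>

lemma rep_hom_action:
  assumes g: "g \<in> points K G" and V: "comodule K G V" and W: "comodule K G W"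
    and f: "f \<in> rep_hom K G V W" and v: "v \<in> carrier V"
  shows "f (action K V g v) = action K W g (f v)"
proof -
  note mV = comoduleD(1)[OF V] and mW = comoduleD(1)[OF W]
  note fh = rep_homD(1)[OF f]
  note lV = tensor_lift[OF mV G_module mV action_bilinear[OF g mV]]
  note lW = tensor_lift[OF mW G_module mW action_bilinear[OF g mW]]
  note tm = tensor_map[OF mV G_module mW G_module fh module_hom_id]
  have "f (tensor_lift K V (\<lambda>w a. g a \<odot>\<^bsub>V\<^esub> w) (coact V v))
    = tensor_lift K W (\<lambda>w a. g a \<odot>\<^bsub>W\<^esub> w) (tensor_map K W G f (\<lambda>a. a) (coact V v))"
    by (rule tensor_hom_eqI[OF mV G_module mW module_hom_compose[OF lV(1) fh] module_hom_compose[OF tm(1) lW(1)]])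
      (simp_all add: lV(2) lW(2) tm(2) module_homD[OF fh] point_simps[OF g] module_homD(1)[OF comoduleD(2)[OF V]] v)
  then show ?thesis using rep_homD(2)[OF f v] by (simp add: action_def)
qed

lemma rep_hom_id:
  assumes V: "comodule K G V"
  shows "(\<lambda>x. x) \<in> rep_hom K G V V"
  using tensor_map_id[OF comoduleD(1)[OF V] G_module] module_homD(1)[OF comoduleD(2)[OF V]]
  by (simp add: rep_hom_def module_hom_id)

text \<open>If \<open>e\<close> and the composite of \<psi> with \<open>e\<close> are comodule maps,
  then \<psi> respects the coactions on the image of \<open>e\<close>. This produces comodule maps
  out of \<open>Q\<close> without injectivity of any map between tensor products.\<close>

lemma coact_factor:
  assumes W: "comodule K G W" and Q: "comodule K G Q" and M: "comodule K G M"
    and e: "e \<in> rep_hom K G W Q" and f: "f \<in> rep_hom K G W M" and \<psi>: "\<psi> \<in> module_hom K Q M"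
    and eq: "\<And>w. w \<in> carrier W \<Longrightarrow> \<psi> (e w) = f w" and w: "w \<in> carrier W"
  shows "coact M (\<psi> (e w)) = tensor_map K M G \<psi> (\<lambda>a. a) (coact Q (e w))"
proof -
  note mW = comoduleD(1)[OF W] and mQ = comoduleD(1)[OF Q] and mM = comoduleD(1)[OF M]
  have cw: "coact W w \<in> carrier (tensor K W G)" by (rule module_homD(1)[OF comoduleD(2)[OF W] w])
  have "coact M (\<psi> (e w)) = tensor_map K M G f (\<lambda>a. a) (coact W w)"
    using eq[OF w] rep_homD(2)[OF f w] by simp
  \<comment> \<open>\<open>f\<close> and the composite agree only on the carrier of
    \<open>W\<close>, so the induced maps of tensor products are compared on pure tensors.\<close>
  also have "\<dots> = tensor_map K M G (\<lambda>x. \<psi> (e x)) (\<lambda>a. a) (coact W w)"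
    by (rule tensor_hom_eqI[OF mW G_module tensor_module[OF mM G_module]
          tensor_map_hom[OF mW G_module mM G_module rep_homD(1)[OF f] module_hom_id]
          tensor_map_hom[OF mW G_module mM G_module module_hom_compose[OF rep_homD(1)[OF e] \<psi>] module_hom_id] _ cw])
      (simp add: tensor_map_pure[OF mW G_module mM G_module rep_homD(1)[OF f] module_hom_id]
          tensor_map_pure[OF mW G_module mM G_module module_hom_compose[OF rep_homD(1)[OF e] \<psi>] module_hom_id] eq)
  also have "\<dots> = tensor_map K M G \<psi> (\<lambda>a. a) (tensor_map K Q G e (\<lambda>a. a) (coact W w))"
    by (rule tensor_map_compose[OF mW G_module mQ G_module mM G_module rep_homD(1)[OF e] module_hom_id \<psi>
          module_hom_id cw, symmetric])
  also have "\<dots> = tensor_map K M G \<psi> (\<lambda>a. a) (coact Q (e w))"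
    using rep_homD(2)[OF e w] by simp
  finally show ?thesis .
qed

lemma fd_rational: "fd_module K G V \<Longrightarrow> rational_module K G V"
  unfolding rational_module_def fd_module_def using rep_hom_id by blast

lemma tensor_lift_action_one:
  assumes g: "g \<in> points K G" and V: "module K V" and v: "v \<in> carrier V"
  shows "tensor_lift K V (\<lambda>w a. g a \<odot>\<^bsub>V\<^esub> w) (pure_tensor K V G v \<one>\<^bsub>G\<^esub>) = v"
  using tensor_lift(2)[OF V G_module V action_bilinear[OF g V] v G_one] point_simps(4)[OF g] v
    module.smult_one[OF V] by simp

lemma action_invariant:
  assumes g: "g \<in> points K G" and V: "module K V" and v: "v \<in> carrier V"
    and c: "coact V v = pure_tensor K V G v \<one>\<^bsub>G\<^esub>"
  shows "action K V g v = v"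
  unfolding action_def c by (rule tensor_lift_action_one[OF g V v])

section \<open>Trivial comodules\<close>

definition trivial_rep :: "('k, 'a, 'u) rep \<Rightarrow> ('k, 'a, 'u) rep" where
  "trivial_rep V = V\<lparr>coact := (\<lambda>v. pure_tensor K V G v \<one>\<^bsub>G\<^esub>)\<rparr>"

lemma trivial_rep_simps [simp]:
  "carrier (trivial_rep V) = carrier V" "add (trivial_rep V) = add V" "zero (trivial_rep V) = zero V"
  "smult (trivial_rep V) = smult V" "mult (trivial_rep V) = mult V" "one (trivial_rep V) = one V"
  by (simp_all add: trivial_rep_def)

text \<open>Replacing the coaction leaves carrier, addition and scalar multiplication unchanged, and
  the tensor product is built from these. A coaction written with tensors of \<open>V\<close> can
  thus be read as one with tensors of \<open>trivial_rep V\<close>.\<close>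

lemma trivial_rep_tensor:
  "tensor_kernel K (trivial_rep V) G = tensor_kernel K V G"
  "pure_tensor K (trivial_rep V) G = pure_tensor K V G"
proof -
  show *: "tensor_kernel K (trivial_rep V) G = tensor_kernel K V G"
    by (simp only: tensor_kernel_def bilinear_relations_def trivial_rep_simps)
  show "pure_tensor K (trivial_rep V) G = pure_tensor K V G"
    by (intro ext) (simp only: pure_tensor_def * trivial_rep_simps)
qed

lemma trivial_rep_coact: "coact (trivial_rep V) v = pure_tensor K (trivial_rep V) G v \<one>\<^bsub>G\<^esub>"
  unfolding trivial_rep_tensor(2) by (simp add: trivial_rep_def)

text \<open>Both sides of coassociativity are (v \<otimes> 1) \<otimes> 1, because comultiplication
  preserves the unit; the counit law holds because the counit, being a rational point, sends 1 to
  1.\<close>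

lemma trivial_rep_comodule:
  assumes V: "vectorspace K V"
  shows "comodule K G (trivial_rep V)"
proof -
  let ?T = "trivial_rep V"
  have mV: "module K V" using V by (simp add: vectorspace_iff)
  have mT: "module K ?T"
    by (rule module_image[OF mV, of "\<lambda>x. x"]) simp_all
  have GG: "module K (tensor K G G)" and TG: "module K (tensor K ?T G)"
    by (rule tensor_module[OF G_module G_module] tensor_module[OF mT G_module])+
  have c: "coact ?T \<in> module_hom K ?T (tensor K ?T G)"
    using bilinearD(2)[OF pure_tensor_bilinear[OF mT G_module] G_one]
    by (simp only: trivial_rep_coact[abs_def, symmetric])
  have comult: "comult G \<in> module_hom K G (tensor K G G)" "comult G \<one>\<^bsub>G\<^esub> = pure_tensor K G G \<one>\<^bsub>G\<^esub> \<one>\<^bsub>G\<^esub>"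
    and counit: "counit G \<in> points K G"
    using ags by (simp_all add: affine_group_scheme_def)
  have "tensor_map K (tensor K ?T G) G (coact ?T) (\<lambda>a. a) (coact ?T v)
      = tensor_assoc K ?T G G (tensor_map K ?T (tensor K G G) (\<lambda>w. w) (comult G) (coact ?T v))"
    if v: "v \<in> carrier ?T" for v
  proof -
    have "tensor_map K (tensor K ?T G) G (coact ?T) (\<lambda>a. a) (pure_tensor K ?T G v \<one>\<^bsub>G\<^esub>)
      = pure_tensor K (tensor K ?T G) G (coact ?T v) \<one>\<^bsub>G\<^esub>"
      by (rule tensor_map_pure[OF mT G_module TG G_module c module_hom_id v G_one])
    moreover have "tensor_map K ?T (tensor K G G) (\<lambda>w. w) (comult G) (pure_tensor K ?T G v \<one>\<^bsub>G\<^esub>)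
      = pure_tensor K ?T (tensor K G G) v (pure_tensor K G G \<one>\<^bsub>G\<^esub> \<one>\<^bsub>G\<^esub>)"
      using tensor_map_pure[OF mT G_module mT GG module_hom_id comult(1) v G_one] comult(2) by simp
    moreover have "tensor_assoc K ?T G G (pure_tensor K ?T (tensor K G G) v (pure_tensor K G G \<one>\<^bsub>G\<^esub> \<one>\<^bsub>G\<^esub>))
      = pure_tensor K (tensor K ?T G) G (pure_tensor K ?T G v \<one>\<^bsub>G\<^esub>) \<one>\<^bsub>G\<^esub>"
      by (rule tensor_assoc_pure[OF mT G_module G_module v G_one G_one])
    ultimately show ?thesis unfolding trivial_rep_coact by simp
  qed
  moreover have "tensor_lift K ?T (\<lambda>w a. counit G a \<odot>\<^bsub>?T\<^esub> w) (coact ?T v) = v" if "v \<in> carrier ?T" for v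
    unfolding trivial_rep_coact by (rule tensor_lift_action_one[OF counit mT that])
  ultimately show ?thesis
    unfolding comodule_def vectorspace_iff using mT c by blast
qed

end

section \<open>Modules over the group with free unipotent generators\<close>

locale free_unipotent = affine_group K N
  for K :: "('k, 'r) ring_scheme" and N :: "('k, 'a) group_scheme" +
  fixes universe :: "'u itself" and S :: "'s set" and \<sigma> :: "'s \<Rightarrow> 'a \<Rightarrow> 'k"
  assumes free: "free_unipotent_group universe K S N \<sigma>"
    and infinite_K: "infinite (carrier K)"
begin

lemma points: "s \<in> S \<Longrightarrow> \<sigma> s \<in> points K N"
  using free by (simp add: free_unipotent_group_def)

lemma fd_unipotent: "fd_module K N (V :: ('k, 'a, 'u) rep) \<Longrightarrow> unipotent_object K S V (\<lambda>s. action K V (\<sigma> s))"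
  using free by (simp add: free_unipotent_group_def)

lemma rep_hom_eq: "fd_module K N (V :: ('k, 'a, 'u) rep) \<Longrightarrow> fd_module K N W \<Longrightarrow>
    rep_hom K N V W = unipotent_hom K S V (\<lambda>s. action K V (\<sigma> s)) W (\<lambda>s. action K W (\<sigma> s))"
  using free by (simp add: free_unipotent_group_def)

lemma fd_comodule: "fd_module K N V \<Longrightarrow> comodule K N V"
  by (simp add: fd_module_def)

text \<open>Essential surjectivity extended to spaces on any type that inject into
  \<open>'u\<close>: the copy on \<open>'u\<close> receives the conjugated action, and the two
  isomorphisms are composed.\<close>

lemma unipotent_object_transport:
  fixes L :: "('k, 'v, 'x) module_scheme" and h :: "'v \<Rightarrow> 'u"
  assumes L: "unipotent_object K S L \<alpha>" and h: "inj_on h (carrier L)"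
  obtains W :: "('k, 'a, 'u) rep" and \<phi> where "fd_module K N W"
    "\<phi> \<in> unipotent_hom K S L \<alpha> W (\<lambda>s. action K W (\<sigma> s))" "bij_betw \<phi> (carrier L) (carrier W)"
proof -
  note LD = unipotent_objectD[OF L]
  let ?T = "transport h L" and ?\<beta> = "\<lambda>s y. h (\<alpha> s (inv_into (carrier L) h y))"
  note T = transport_hom[OF LD(3) h]
  have T': "vectorspace K ?T" using T(1) by (simp add: vectorspace_iff)
  have "unipotent_object K S ?T ?\<beta>"
    by (rule unipotent_object_image[OF L T' T(2)]) (use h T(3) in \<open>auto simp: bij_betw_def\<close>)
  then obtain W :: "('k, 'a, 'u) rep" and \<phi> where W: "fd_module K N W"
    "\<phi> \<in> unipotent_hom K S ?T ?\<beta> W (\<lambda>s. action K W (\<sigma> s))" "bij_betw \<phi> (carrier ?T) (carrier W)"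
    using free unfolding free_unipotent_group_def by blast
  have "(\<lambda>x. \<phi> (h x)) \<in> module_hom K L W"
    using module_hom_compose[OF T(2), of \<phi> W] W(2) by (simp add: unipotent_hom_def)
  moreover have "\<phi> (h (\<alpha> s x)) = action K W (\<sigma> s) (\<phi> (h x))" if "s \<in> S" "x \<in> carrier L" for s x
  proof -
    have "\<phi> (?\<beta> s (h x)) = action K W (\<sigma> s) (\<phi> (h x))"
      using W(2) that module_homD(1)[OF T(2)] by (simp add: unipotent_hom_def)
    then show ?thesis using that h by simp
  qed
  moreover have "bij_betw (\<lambda>x. \<phi> (h x)) (carrier L) (carrier W)"
    using bij_betw_trans[OF T(3) W(3)] by (simp add: comp_def)
  ultimately show thesis using that[OF W(1), of "\<lambda>x. \<phi> (h x)"] by (simp add: unipotent_hom_def)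
qed

text \<open>Full faithfulness replaces the usual flatness argument that makes the sum of two images a submodule.\<close>

lemma sum_of_images:
  fixes M W\<^sub>1 W\<^sub>2 :: "('k, 'a, 'u) rep"
  assumes M: "comodule K N M" and W: "fd_module K N W\<^sub>1" "fd_module K N W\<^sub>2"
    and f: "f\<^sub>1 \<in> rep_hom K N W\<^sub>1 M" "f\<^sub>2 \<in> rep_hom K N W\<^sub>2 M"
  obtains Q :: "('k, 'a, 'u) rep" and \<psi> where "fd_module K N Q" "\<psi> \<in> rep_hom K N Q M" "inj_on \<psi> (carrier Q)"
    "f\<^sub>1 ` carrier W\<^sub>1 \<subseteq> \<psi> ` carrier Q" "f\<^sub>2 ` carrier W\<^sub>2 \<subseteq> \<psi> ` carrier Q"
proof -
  note cW = fd_comodule[OF W(1)] fd_comodule[OF W(2)]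
  note mW = comoduleD(1)[OF cW(1)] comoduleD(1)[OF cW(2)] and mM = comoduleD(1)[OF M]
  note f' = rep_homD(1)[OF f(1)] rep_homD(1)[OF f(2)]
  note fD = module_homD[OF f'(1)] module_homD[OF f'(2)]
  interpret M: module K M by (rule mM)
  interpret W1: module K W\<^sub>1 by (rule mW)
  interpret W2: module K W\<^sub>2 by (rule mW)
  let ?D = "direct_sum W\<^sub>1 W\<^sub>2" and ?F = "\<lambda>p. f\<^sub>1 (fst p) \<oplus>\<^bsub>M\<^esub> f\<^sub>2 (snd p)"
  note D = unipotent_object_direct_sum[OF fd_unipotent[OF W(1)] fd_unipotent[OF W(2)]]
  note mD = unipotent_objectD(3)[OF D]
  have F: "?F \<in> module_hom K ?D M"
    by (auto simp: module_hom_def direct_sum_def fD M.smult_r_distr M.M.a_ac)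
  define U where "U = ?F ` carrier ?D"
  have U: "submodule K U M" unfolding U_def by (rule module_hom_image_submodule[OF mD mM F])
  let ?L = "M\<lparr>carrier := U\<rparr>"
  have mL: "module K ?L" by (rule submodule_module[OF U])
  have F': "?F \<in> module_hom K ?D ?L" using module_homD[OF F] by (auto simp: module_hom_def U_def)
  \<comment> \<open>As an equivariant image of the direct sum, \<open>U\<close> lies in
    \<open>Unipotent(S)\<close>. It carries no coaction yet; the equivalence supplies one on an
    isomorphic space \<open>Q\<close>.\<close>
  have "unipotent_object K S ?L (\<lambda>s. action K M (\<sigma> s))"
  proof (rule unipotent_object_image[OF D _ F'])
    show "vectorspace K ?L" using mL by (simp add: vectorspace_iff)
    show "?F ` carrier ?D = carrier ?L" by (simp add: U_def)
    fix s p assume s: "s \<in> S" and p: "p \<in> carrier ?D"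
    then have p': "fst p \<in> carrier W\<^sub>1" "snd p \<in> carrier W\<^sub>2" by (auto simp: direct_sum_def)
    show "?F (action K W\<^sub>1 (\<sigma> s) (fst p), action K W\<^sub>2 (\<sigma> s) (snd p)) = action K M (\<sigma> s) (?F p)"
      using rep_hom_action[OF points[OF s] cW(1) M f(1) p'(1)] rep_hom_action[OF points[OF s] cW(2) M f(2) p'(2)]
        module_homD(2)[OF action_hom[OF points[OF s] M]] p' fD by simp
  qed
  then obtain Q :: "('k, 'a, 'u) rep" and \<phi> where Q: "fd_module K N Q"
    "\<phi> \<in> unipotent_hom K S ?L (\<lambda>s. action K M (\<sigma> s)) Q (\<lambda>s. action K Q (\<sigma> s))" "bij_betw \<phi> (carrier ?L) (carrier Q)"
    by (rule unipotent_object_transport[of ?L _ "\<lambda>x. x"]) auto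
  have \<phi>: "\<phi> \<in> module_hom K ?L Q" using Q(2) by (simp add: unipotent_hom_def)
  note \<phi>D = module_homD[OF \<phi>, simplified]
  note cQ = fd_comodule[OF Q(1)] and mQ = comoduleD(1)[OF fd_comodule[OF Q(1)]]
  define \<psi> where "\<psi> = inv_into U \<phi>"
  have bij: "bij_betw \<phi> U (carrier Q)" using Q(3) by simp
  have \<psi>\<phi>: "\<psi> (\<phi> x) = x" if "x \<in> U" for x
    using that bij_betw_inv_into_left[OF bij] by (simp add: \<psi>_def)
  have onto: "\<exists>x\<in>U. q = \<phi> x" if "q \<in> carrier Q" for q using that bij by (auto simp: bij_betw_def)
  have \<psi>: "\<psi> \<in> module_hom K Q M"
  proof -
    have "\<psi> (\<phi> x \<oplus>\<^bsub>Q\<^esub> \<phi> y) = \<psi> (\<phi> x) \<oplus>\<^bsub>M\<^esub> \<psi> (\<phi> y)" if "x \<in> U" "y \<in> U" for x y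
      using that by (simp add: \<phi>D(2)[symmetric] \<psi>\<phi> submodule.m_closed[OF U])
    moreover have "\<psi> (c \<odot>\<^bsub>Q\<^esub> \<phi> x) = c \<odot>\<^bsub>M\<^esub> \<psi> (\<phi> x)" if "x \<in> U" "c \<in> carrier K" for x c
      using that by (simp add: \<phi>D(3)[symmetric] \<psi>\<phi> submodule.smult_closed[OF U])
    moreover have "\<psi> (\<phi> x) \<in> carrier M" if "x \<in> U" for x
      using that \<psi>\<phi> submodule.subset[OF U] by auto
    moreover have "carrier Q = \<phi> ` U" using bij by (simp add: bij_betw_def)
    ultimately show ?thesis unfolding module_hom_def by auto
  qed
  have f1U: "f\<^sub>1 w \<in> U" if "w \<in> carrier W\<^sub>1" for w
  proof -
    have "?F (w, \<zero>\<^bsub>W\<^sub>2\<^esub>) = f\<^sub>1 w" using that by (simp add: fD module_hom_zero[OF mW(2) mM f'(2)])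
    then show ?thesis unfolding U_def using that by (intro image_eqI[of _ _ "(w, \<zero>\<^bsub>W\<^sub>2\<^esub>)"]) (auto simp: direct_sum_def)
  qed
  have f2U: "f\<^sub>2 w \<in> U" if "w \<in> carrier W\<^sub>2" for w
  proof -
    have "?F (\<zero>\<^bsub>W\<^sub>1\<^esub>, w) = f\<^sub>2 w" using that by (simp add: fD module_hom_zero[OF mW(1) mM f'(1)])
    then show ?thesis unfolding U_def using that by (intro image_eqI[of _ _ "(\<zero>\<^bsub>W\<^sub>1\<^esub>, w)"]) (auto simp: direct_sum_def)
  qed
  have equiv: "\<phi> (action K M (\<sigma> s) x) = action K Q (\<sigma> s) (\<phi> x)" if "s \<in> S" "x \<in> U" for s x
    using Q(2) that by (simp add: unipotent_hom_def)
  \<comment> \<open>A comodule map into \<open>M\<close> with values in \<open>U\<close>, carried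
    over to \<open>Q\<close>, commutes with the generators. It now runs between finite-dimensional
    modules, so fullness makes it a comodule map.\<close>
  have e: "(\<lambda>w. \<phi> (f w)) \<in> rep_hom K N W Q"
    if W: "fd_module K N W" and f: "f \<in> rep_hom K N W M" and fU: "\<And>w. w \<in> carrier W \<Longrightarrow> f w \<in> U"
    for W :: "('k, 'a, 'u) rep" and f
  proof -
    have "(\<lambda>w. \<phi> (f w)) \<in> module_hom K W Q"
      using module_homD[OF rep_homD(1)[OF f]] fU \<phi>D by (auto simp: module_hom_def)
    moreover have "\<phi> (f (action K W (\<sigma> s) w)) = action K Q (\<sigma> s) (\<phi> (f w))" if "s \<in> S" "w \<in> carrier W" for s w
      using rep_hom_action[OF points[OF that(1)] fd_comodule[OF W] M f that(2)] equiv[OF that(1) fU[OF that(2)]] by simp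
    ultimately show ?thesis unfolding rep_hom_eq[OF W Q(1)] by (simp add: unipotent_hom_def)
  qed
  note e1 = e[OF W(1) f(1) f1U] and e2 = e[OF W(2) f(2) f2U]
  let ?t = "tensor_map K M N \<psi> (\<lambda>a. a)"
  note cQ' = comoduleD(2)[OF cQ]
  \<comment> \<open>Every \<open>q\<close> is a sum of vectors coming from \<open>W\<^sub>1\<close>
    and \<open>W\<^sub>2\<close>. On each of these parts compatibility follows from having comodule
    maps into both \<open>Q\<close> and \<open>M\<close>.\<close>
  have "coact M (\<psi> q) = ?t (coact Q q)" if qc: "q \<in> carrier Q" for q
  proof -
    obtain p where p: "p \<in> carrier ?D" "q = \<phi> (?F p)" using onto[OF qc] by (auto simp: U_def)
    then have p': "fst p \<in> carrier W\<^sub>1" "snd p \<in> carrier W\<^sub>2" by (auto simp: direct_sum_def)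
    let ?q1 = "\<phi> (f\<^sub>1 (fst p))" and ?q2 = "\<phi> (f\<^sub>2 (snd p))"
    have c1: "coact M (\<psi> ?q1) = ?t (coact Q ?q1)"
      by (rule coact_factor[OF cW(1) cQ M e1 f(1) \<psi> _ p'(1)]) (simp_all add: \<psi>\<phi> f1U)
    have c2: "coact M (\<psi> ?q2) = ?t (coact Q ?q2)"
      by (rule coact_factor[OF cW(2) cQ M e2 f(2) \<psi> _ p'(2)]) (simp_all add: \<psi>\<phi> f2U)
    have q12: "?q1 \<in> carrier Q" "?q2 \<in> carrier Q" using \<phi>D(1) f1U f2U p' by auto
    have q: "q = ?q1 \<oplus>\<^bsub>Q\<^esub> ?q2" using p(2) \<phi>D(2)[OF f1U[OF p'(1)] f2U[OF p'(2)]] by simp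
    have "coact M (\<psi> q) = coact M (\<psi> ?q1) \<oplus>\<^bsub>tensor K M N\<^esub> coact M (\<psi> ?q2)"
      unfolding q using q12 module_homD[OF \<psi>] module_homD[OF comoduleD(2)[OF M]] by simp
    also have "\<dots> = ?t (coact Q ?q1 \<oplus>\<^bsub>tensor K Q N\<^esub> coact Q ?q2)"
      unfolding c1 c2
      using q12 module_homD[OF tensor_map_hom[OF mQ G_module mM G_module \<psi> module_hom_id]] module_homD[OF cQ'] by simp
    also have "\<dots> = ?t (coact Q q)" unfolding q using q12 module_homD[OF cQ'] by simp
    finally show ?thesis .
  qed
  then have "\<psi> \<in> rep_hom K N Q M" using \<psi> by (simp add: rep_hom_def)
  moreover have "inj_on \<psi> (carrier Q)"
    unfolding \<psi>_def using bij by (metis bij_betw_def inj_on_inv_into order_refl)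
  moreover have "\<psi> ` carrier Q = U"
    unfolding \<psi>_def using bij_betw_inv_into[OF bij] by (simp add: bij_betw_def)
  ultimately show thesis using that[OF Q(1)] f1U f2U by blast
qed

end

section \<open>Displacements and invariants\<close>

context free_unipotent
begin

definition disp :: "('k, 'a, 'u) rep \<Rightarrow> 's \<Rightarrow> 'u \<Rightarrow> 'u" where
  "disp M s v = action K M (\<sigma> s) v \<ominus>\<^bsub>M\<^esub> v"

lemma disp_hom:
  assumes M: "comodule K N M" and s: "s \<in> S"
  shows "disp M s \<in> module_hom K M M"
proof -
  note a = module_homD[OF action_hom[OF points[OF s] M]]
  interpret M: module K M by (rule comoduleD(1)[OF M])
  show ?thesis
    by (auto simp: module_hom_def disp_def a M.M.minus_eq M.smult_r_distr M.smult_r_minus M.M.minus_add M.M.a_ac)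
qed

lemma rep_hom_disp:
  assumes M: "comodule K N M" and M': "comodule K N M'" and f: "f \<in> rep_hom K N M M'"
    and s: "s \<in> S" and v: "v \<in> carrier M"
  shows "f (disp M s v) = disp M' s (f v)"
  unfolding disp_def
  using module_hom_minus[OF comoduleD(1)[OF M] comoduleD(1)[OF M'] rep_homD(1)[OF f], of "action K M (\<sigma> s) v" v]
    module_homD(1)[OF action_hom[OF points[OF s] M] v] v rep_hom_action[OF points[OF s] M M' f v] by simp

lemma disp_eq_zero_iff:
  assumes M: "comodule K N M" and s: "s \<in> S" and v: "v \<in> carrier M"
  shows "disp M s v = \<zero>\<^bsub>M\<^esub> \<longleftrightarrow> action K M (\<sigma> s) v = v"
proof -
  interpret M: module K M by (rule comoduleD(1)[OF M])
  show ?thesis unfolding disp_def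
    by (rule M.M.minus_other_side[OF module_homD(1)[OF action_hom[OF points[OF s] M] v] v])
qed

lemma rational_comodule: "rational_module K N (M :: ('k, 'a, 'u) rep) \<Longrightarrow> comodule K N M"
  by (simp add: rational_module_def)

lemma injective_rational: "injective_module K N (M :: ('k, 'a, 'u) rep) \<Longrightarrow> rational_module K N M"
  by (simp add: injective_module_def)

text \<open>The subspace fixed by all generators, with the trivial coaction, is a finite-dimensional
  module on which every generator acts as the identity. Its inclusion into \<open>Q\<close> is
  therefore equivariant, by fullness a comodule map, and this forces the coaction of
  \<open>Q\<close> to be trivial on that subspace.\<close>

lemma fd_invariant:
  fixes Q :: "('k, 'a, 'u) rep"
  assumes Q: "fd_module K N Q" and q: "q \<in> carrier Q" and inv: "\<And>s. s \<in> S \<Longrightarrow> action K Q (\<sigma> s) q = q"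
  shows "coact Q q = pure_tensor K Q N q \<one>\<^bsub>N\<^esub>"
proof -
  note cQ = fd_comodule[OF Q] and mQ = comoduleD(1)[OF fd_comodule[OF Q]]
  interpret Q: module K Q by (rule mQ)
  have vQ: "vectorspace K Q" "vectorspace.fin_dim K Q" using Q by (auto simp: fd_module_def comodule_def)
  let ?D = "\<lambda>s. action K Q (\<sigma> s)"
  let ?U = "{v \<in> carrier Q. \<forall>s\<in>S. ?D s v = v}"
  have U: "submodule K ?U Q"
    using mQ module_homD[OF action_hom[OF points cQ]] module_hom_zero[OF mQ mQ action_hom[OF points cQ]]
    by (intro submodule.intro) auto
  let ?T = "trivial_rep (Q\<lparr>carrier := ?U\<rparr>)"
  have vT: "vectorspace K (Q\<lparr>carrier := ?U\<rparr>)" by (rule submodule_vectorspace[OF vQ(1) U])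
  have cT: "comodule K N ?T" by (rule trivial_rep_comodule[OF vT])
  have fdT: "vectorspace.fin_dim K ?T"
    by (rule fin_dim_image[OF vT fin_dim_submodule[OF vQ U], of _ "\<lambda>x. x"])
      (use cT in \<open>auto simp: comodule_def module_hom_def\<close>)
  have T: "fd_module K N ?T" using cT fdT by (simp add: fd_module_def)
  have aT: "action K ?T (\<sigma> s) v = v" if "s \<in> S" "v \<in> ?U" for s v
    by (rule action_invariant[OF points[OF that(1)] comoduleD(1)[OF cT] _ trivial_rep_coact]) (use that in simp)
  have incl: "(\<lambda>x. x) \<in> module_hom K ?T Q" by (auto simp: module_hom_def)
  have "(\<lambda>x. x) \<in> rep_hom K N ?T Q"
    unfolding rep_hom_eq[OF T Q] using incl aT by (simp add: unipotent_hom_def)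
  moreover have qT: "q \<in> carrier ?T" using q inv by simp
  ultimately have "coact Q q = tensor_map K Q N (\<lambda>x. x) (\<lambda>a. a) (coact ?T q)"
    by (rule rep_homD(2))
  also have "\<dots> = pure_tensor K Q N q \<one>\<^bsub>N\<^esub>"
    unfolding trivial_rep_coact
    by (rule tensor_map_pure[OF comoduleD(1)[OF cT] G_module mQ G_module incl module_hom_id qT G_one])
  finally show ?thesis .
qed

text \<open>The gain over the definition of a rational module is that \<psi> is injective. It comes
  from forming the sum of the image of \<open>f\<close> with itself, which replaces \<open>W\<close>
  by its image in \<open>M\<close>.\<close>

lemma rational_element:
  fixes M :: "('k, 'a, 'u) rep"
  assumes M: "rational_module K N M" and v: "v \<in> carrier M"
  obtains Q :: "('k, 'a, 'u) rep" and \<psi> q where "fd_module K N Q" "\<psi> \<in> rep_hom K N Q M" "inj_on \<psi> (carrier Q)"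
    "q \<in> carrier Q" "\<psi> q = v"
proof -
  obtain W :: "('k, 'a, 'u) rep" and f where W: "fd_module K N W" "f \<in> rep_hom K N W M" "v \<in> f ` carrier W"
    using M v unfolding rational_module_def by blast
  obtain Q :: "('k, 'a, 'u) rep" and \<psi> where Q: "fd_module K N Q" "\<psi> \<in> rep_hom K N Q M" "inj_on \<psi> (carrier Q)"
    "f ` carrier W \<subseteq> \<psi> ` carrier Q"
    by (rule sum_of_images[OF rational_comodule[OF M] W(1,1,2,2)]) blast
  then obtain q where "q \<in> carrier Q" "\<psi> q = v" using W(3) by auto
  then show thesis by (rule that[OF Q(1-3)])
qed

text \<open>One direction evaluates the coaction at the points \<open>\<sigma> s\<close>. For the
  other, \<open>v\<close> is pulled back to a finite-dimensional \<open>Q\<close>, where full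
  faithfulness applies; injectivity of \<psi> makes the preimage fixed as well.\<close>

lemma invariants_iff:
  fixes M :: "('k, 'a, 'u) rep"
  assumes M: "rational_module K N M"
  shows "carrier (invariants K N M) = {v \<in> carrier M. \<forall>s\<in>S. disp M s v = \<zero>\<^bsub>M\<^esub>}"
proof -
  note cM = rational_comodule[OF M] and mM = comoduleD(1)[OF rational_comodule[OF M]]
  have "coact M v = pure_tensor K M N v \<one>\<^bsub>N\<^esub> \<longleftrightarrow> (\<forall>s\<in>S. disp M s v = \<zero>\<^bsub>M\<^esub>)" if v: "v \<in> carrier M" for v
  proof
    assume "coact M v = pure_tensor K M N v \<one>\<^bsub>N\<^esub>"
    then show "\<forall>s\<in>S. disp M s v = \<zero>\<^bsub>M\<^esub>"
      using action_invariant[OF points mM v] disp_eq_zero_iff[OF cM _ v] by simp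
  next
    assume d: "\<forall>s\<in>S. disp M s v = \<zero>\<^bsub>M\<^esub>"
    obtain Q :: "('k, 'a, 'u) rep" and \<psi> q where Q: "fd_module K N Q" "\<psi> \<in> rep_hom K N Q M" "inj_on \<psi> (carrier Q)"
      and q: "q \<in> carrier Q" "\<psi> q = v"
      by (rule rational_element[OF M v])
    note cQ = fd_comodule[OF Q(1)] and mQ = comoduleD(1)[OF fd_comodule[OF Q(1)]]
    have "action K Q (\<sigma> s) q = q" if s: "s \<in> S" for s
    proof (rule inj_onD[OF Q(3)])
      show "\<psi> (action K Q (\<sigma> s) q) = \<psi> q"
        using rep_hom_action[OF points[OF s] cQ cM Q(2) q(1)] d disp_eq_zero_iff[OF cM s v] s q(2) by simp
      show "action K Q (\<sigma> s) q \<in> carrier Q"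
        by (rule module_homD(1)[OF action_hom[OF points[OF s] cQ] q(1)])
    qed (rule q(1))
    then have "coact Q q = pure_tensor K Q N q \<one>\<^bsub>N\<^esub>" by (rule fd_invariant[OF Q(1) q(1)])
    then show "coact M v = pure_tensor K M N v \<one>\<^bsub>N\<^esub>"
      using rep_homD(2)[OF Q(2) q(1)] q(2) G_one
        tensor_map_pure[OF mQ G_module mM G_module rep_homD(1)[OF Q(2)] module_hom_id q(1) G_one] by simp
  qed
  then show ?thesis unfolding invariants_def by auto
qed

text \<open>Injectivity splits the extension of the trivial line by \<open>Q\<close> with cocycle \<open>c\<close> after pushing out to \<open>I\<close>.\<close>

lemma injective_disp_surj:
  fixes I Q :: "('k, 'a, 'u) rep"
  assumes I: "injective_module K N I" and Q: "fd_module K N Q" and \<psi>: "\<psi> \<in> rep_hom K N Q I"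
    and c: "c \<in> S \<rightarrow> carrier Q"
  shows "\<exists>y \<in> carrier I. \<forall>s\<in>S. disp I s y = \<psi> (c s)"
proof -
  note cI = rational_comodule[OF injective_rational[OF I]]
  note mI = comoduleD(1)[OF cI]
  note cQ = fd_comodule[OF Q] and mQ = comoduleD(1)[OF fd_comodule[OF Q]]
  interpret Q: module K Q by (rule mQ)
  interpret I: module K I by (rule mI)
  interpret field K by (rule K_field)
  show ?thesis
  proof (cases "carrier Q = {\<zero>\<^bsub>Q\<^esub>}")
    \<comment> \<open>The zero module does not provide a copy of \<open>K\<close> inside
      \<open>'u\<close>; here the equation is solved by 0.\<close>
    case True
    then have "\<psi> (c s) = \<zero>\<^bsub>I\<^esub>" if "s \<in> S" for s
      using Pi_mem[OF c that] module_hom_zero[OF mQ mI rep_homD(1)[OF \<psi>]] by simp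
    then show ?thesis
      using module_hom_zero[OF mI mI disp_hom[OF cI]] by (intro bexI[of _ "\<zero>\<^bsub>I\<^esub>"]) auto
  next
    case False
    then obtain q where q: "q \<in> carrier Q" "q \<noteq> \<zero>\<^bsub>Q\<^esub>" using Q.M.zero_closed by blast
    \<comment> \<open>The line through a nonzero \<open>q\<close> is a copy of \<open>K\<close> in
      \<open>Q\<close>, so Q x K can be injected into \<open>'u\<close>.\<close>
    have 1: "inj_on (\<lambda>c. c \<odot>\<^bsub>Q\<^esub> q) (carrier K)"
    proof (rule inj_onI)
      fix a b assume ab: "a \<in> carrier K" "b \<in> carrier K" "a \<odot>\<^bsub>Q\<^esub> q = b \<odot>\<^bsub>Q\<^esub> q"
      have "(a \<ominus>\<^bsub>K\<^esub> b) \<odot>\<^bsub>Q\<^esub> q = \<zero>\<^bsub>Q\<^esub>"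
        using ab q by (simp add: a_minus_def Q.smult_l_distr Q.smult_l_minus Q.M.r_neg)
      moreover have "vectorspace K Q" using mQ by (simp add: vectorspace_iff)
      moreover have ab': "a \<ominus>\<^bsub>K\<^esub> b \<in> carrier K" using ab by simp
      ultimately have "q = inv\<^bsub>K\<^esub> (a \<ominus>\<^bsub>K\<^esub> b) \<odot>\<^bsub>Q\<^esub> \<zero>\<^bsub>Q\<^esub>" if "a \<ominus>\<^bsub>K\<^esub> b \<noteq> \<zero>\<^bsub>K\<^esub>"
        using vectorspace.mult_inverse[of K Q "a \<ominus>\<^bsub>K\<^esub> b" q "\<zero>\<^bsub>Q\<^esub>"] q(1) that by blast
      then have "a \<ominus>\<^bsub>K\<^esub> b = \<zero>\<^bsub>K\<^esub>"
        using Q.rmult_0[OF inverse_exists[OF ab']] q(2) by (cases "a \<ominus>\<^bsub>K\<^esub> b = \<zero>\<^bsub>K\<^esub>") simp_all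
      then show "a = b" using ab by simp
    qed
    have 2: "(\<lambda>c. c \<odot>\<^bsub>Q\<^esub> q) ` carrier K \<subseteq> carrier Q" using q by auto
    obtain h :: "'u \<times> 'k \<Rightarrow> 'u" where h: "inj_on h (carrier Q \<times> carrier K)"
      by (rule inj_times_infinite[OF infinite_K 1 2])
    let ?E = "direct_sum Q (self_space K)"
    let ?\<alpha> = "\<lambda>s p. (action K Q (\<sigma> s) (fst p) \<oplus>\<^bsub>Q\<^esub> snd p \<odot>\<^bsub>Q\<^esub> c s, snd p)"
    note E = unipotent_object_extension[OF fd_unipotent[OF Q] c K_field]
    have carrE: "carrier ?E = carrier Q \<times> carrier K" by (simp add: direct_sum_def)
    obtain W :: "('k, 'a, 'u) rep" and \<phi> where W: "fd_module K N W"
      "\<phi> \<in> unipotent_hom K S ?E ?\<alpha> W (\<lambda>s. action K W (\<sigma> s))" "bij_betw \<phi> (carrier ?E) (carrier W)"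
      by (rule unipotent_object_transport[OF E, of h]) (use h carrE in auto)
    note cW = fd_comodule[OF W(1)] and mW = comoduleD(1)[OF fd_comodule[OF W(1)]]
    note mE = unipotent_objectD(3)[OF E]
    have \<phi>: "\<phi> \<in> module_hom K ?E W" using W(2) by (simp add: unipotent_hom_def)
    have equiv: "\<phi> (?\<alpha> s p) = action K W (\<sigma> s) (\<phi> p)" if "s \<in> S" "p \<in> carrier ?E" for s p
      using W(2) that unfolding unipotent_hom_def by blast
    let ?i = "\<lambda>v. \<phi> (v, \<zero>\<^bsub>K\<^esub>)"
    have i: "(\<lambda>v. (v, \<zero>\<^bsub>K\<^esub>)) \<in> module_hom K Q ?E"
      by (auto simp: module_hom_def direct_sum_def)
    \<comment> \<open>By fullness, equivariance suffices; at a vector (v, 0) the term with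
      \<open>c s\<close> has coefficient 0.\<close>
    have "?i \<in> rep_hom K N Q W"
      unfolding rep_hom_eq[OF Q W(1)] unipotent_hom_def
    proof (intro CollectI conjI ballI)
      show "?i \<in> module_hom K Q W" by (rule module_hom_compose[OF i \<phi>])
      fix s v assume s: "s \<in> S" and v: "v \<in> carrier Q"
      have "c s \<in> carrier Q" using c s by auto
      then show "?i (action K Q (\<sigma> s) v) = action K W (\<sigma> s) (?i v)"
        using equiv[OF s, of "(v, \<zero>\<^bsub>K\<^esub>)"] v module_homD(1)[OF action_hom[OF points[OF s] cQ] v] by (simp add: carrE)
    qed
    moreover have "inj_on ?i (carrier Q)"
    proof (rule inj_onI)
      fix x y assume "x \<in> carrier Q" "y \<in> carrier Q" "?i x = ?i y"
      then show "x = y"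
        using inj_onD[OF bij_betw_imp_inj_on[OF W(3)], of "(x, \<zero>\<^bsub>K\<^esub>)" "(y, \<zero>\<^bsub>K\<^esub>)"] by (simp add: carrE)
    qed
    ultimately obtain g where g: "g \<in> rep_hom K N W I" "\<And>x. x \<in> carrier Q \<Longrightarrow> g (?i x) = \<psi> x"
      using I \<psi> fd_rational[OF Q] fd_rational[OF W(1)] unfolding injective_module_def by blast
    \<comment> \<open>The vector (0, 1) has displacement (c s, 0) in the extension, and the map
      \<open>g\<close> extending \<psi> carries this to \<open>\<psi> (c s)\<close>.\<close>
    let ?w = "\<phi> (\<zero>\<^bsub>Q\<^esub>, \<one>\<^bsub>K\<^esub>)"
    have wE: "(\<zero>\<^bsub>Q\<^esub>, \<one>\<^bsub>K\<^esub>) \<in> carrier ?E" by (simp add: carrE)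
    have w: "?w \<in> carrier W" by (rule module_homD(1)[OF \<phi> wE])
    have "disp I s (g ?w) = \<psi> (c s)" if s: "s \<in> S" for s
    proof -
      have cs: "c s \<in> carrier Q" using c s by auto
      have "?\<alpha> s (\<zero>\<^bsub>Q\<^esub>, \<one>\<^bsub>K\<^esub>) = (c s, \<zero>\<^bsub>K\<^esub>) \<oplus>\<^bsub>?E\<^esub> (\<zero>\<^bsub>Q\<^esub>, \<one>\<^bsub>K\<^esub>)"
        using cs module_hom_zero[OF mQ mQ action_hom[OF points[OF s] cQ]] by (simp add: direct_sum_def)
      then have "action K W (\<sigma> s) ?w = ?i (c s) \<oplus>\<^bsub>W\<^esub> ?w"
        using equiv[OF s wE] module_homD(2)[OF \<phi> _ wE, of "(c s, \<zero>\<^bsub>K\<^esub>)"] cs by (simp add: carrE)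
      then have "action K I (\<sigma> s) (g ?w) = \<psi> (c s) \<oplus>\<^bsub>I\<^esub> g ?w"
        using rep_hom_action[OF points[OF s] cW cI g(1) w] g(2)[OF cs] w
          module_homD(1)[OF module_hom_compose[OF i \<phi>] cs] module_homD(2)[OF rep_homD(1)[OF g(1)]] by simp
      moreover have "\<psi> (c s) \<in> carrier I" "g ?w \<in> carrier I"
        using module_homD(1)[OF rep_homD(1)[OF \<psi>] cs] module_homD(1)[OF rep_homD(1)[OF g(1)] w] by auto
      ultimately show ?thesis
        by (simp add: disp_def I.M.minus_eq I.M.a_assoc I.M.r_neg)
    qed
    then show ?thesis using module_homD(1)[OF rep_homD(1)[OF g(1)] w] by blast
  qed
qed

lemma finite_subset_rational:
  fixes M :: "('k, 'a, 'u) rep"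
  assumes M: "rational_module K N M" and A: "finite A" "A \<subseteq> carrier M"
  shows "\<exists>(Q :: ('k, 'a, 'u) rep) \<psi>. fd_module K N Q \<and> \<psi> \<in> rep_hom K N Q M \<and> A \<subseteq> \<psi> ` carrier Q"
  using A
proof (induction A rule: finite_induct)
  case empty
  interpret M: module K M by (rule comoduleD(1)[OF rational_comodule[OF M]])
  show ?case by (rule rational_element[OF M M.M.zero_closed]) blast
next
  case (insert a A)
  then obtain W :: "('k, 'a, 'u) rep" and f where W: "fd_module K N W" "f \<in> rep_hom K N W M" "A \<subseteq> f ` carrier W"
    by blast
  obtain L :: "('k, 'a, 'u) rep" and g x where L: "fd_module K N L" "g \<in> rep_hom K N L M" "x \<in> carrier L" "g x = a"
    by (rule rational_element[OF M, of a]) (use insert.prems in auto)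
  obtain Q :: "('k, 'a, 'u) rep" and \<psi> where Q: "fd_module K N Q" "\<psi> \<in> rep_hom K N Q M"
    "f ` carrier W \<subseteq> \<psi> ` carrier Q" "g ` carrier L \<subseteq> \<psi> ` carrier Q"
    by (rule sum_of_images[OF rational_comodule[OF M] W(1) L(1) W(2) L(2)]) blast
  have "insert a A \<subseteq> \<psi> ` carrier Q" using Q(3,4) W(3) L(3,4) by auto
  then show ?case using Q(1,2) by blast
qed

text \<open>
  For infinite \<open>S\<close> a lift has to take its values in one finite-dimensional submodule: otherwise
  it need not be a displacement.
\<close>

lemma lift_cocycle:
  fixes M M' Q :: "('k, 'a, 'u) rep"
  assumes M: "rational_module K N M" and M': "comodule K N M'" and d: "d \<in> rep_hom K N M M'"
    and Q: "fd_module K N Q" and \<psi>: "\<psi> \<in> rep_hom K N Q M'"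
    and c: "c ` S \<subseteq> \<psi> ` carrier Q \<inter> d ` carrier M"
  obtains W :: "('k, 'a, 'u) rep" and f b where "fd_module K N W" "f \<in> rep_hom K N W M"
    "b \<in> S \<rightarrow> carrier W" "\<And>s. s \<in> S \<Longrightarrow> d (f (b s)) = c s"
proof -
  note cM = rational_comodule[OF M] and mM = comoduleD(1)[OF rational_comodule[OF M]]
  note cQ = fd_comodule[OF Q] and mQ = comoduleD(1)[OF fd_comodule[OF Q]] and mM' = comoduleD(1)[OF M']
  have vQ: "vectorspace K Q" "vectorspace.fin_dim K Q" using Q by (auto simp: fd_module_def comodule_def)
  have vM': "vectorspace K M'" using mM' by (simp add: vectorspace_iff)
  note \<psi>' = rep_homD(1)[OF \<psi>] and d' = rep_homD(1)[OF d]
  let ?P = "\<psi> ` carrier Q" and ?R = "d ` carrier M"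
  have P: "submodule K ?P M'" by (rule module_hom_image_submodule[OF mQ mM' \<psi>'])
  have R: "submodule K ?R M'" by (rule module_hom_image_submodule[OF mM mM' d'])
  have vP: "vectorspace K (M'\<lparr>carrier := ?P\<rparr>)" by (rule submodule_vectorspace[OF vM' P])
  have fP: "vectorspace.fin_dim K (M'\<lparr>carrier := ?P\<rparr>)"
    by (rule fin_dim_image[OF vQ vP, of \<psi>]) (use module_homD[OF \<psi>'] in \<open>auto simp: module_hom_def\<close>)
  have RP: "submodule K (?R \<inter> ?P) (M'\<lparr>carrier := ?P\<rparr>)" by (rule submodule_restrict[OF P R])
  \<comment> \<open>All values of \<open>c\<close> lie in this intersection, which is
    finite-dimensional as a subspace of the image of \<open>Q\<close>.\<close>
  let ?L = "M'\<lparr>carrier := ?R \<inter> ?P\<rparr>"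
  have "vectorspace.fin_dim K ?L" "vectorspace K ?L"
    using fin_dim_submodule[OF vP fP RP] submodule_vectorspace[OF vP RP] by simp_all
  then obtain A where A: "finite A" "A \<subseteq> ?R \<inter> ?P"
    "\<And>U. submodule K U ?L \<Longrightarrow> A \<subseteq> U \<Longrightarrow> ?R \<inter> ?P \<subseteq> U"
    unfolding fin_dim_iff[OF \<open>vectorspace K ?L\<close>] by auto
  \<comment> \<open>Only finitely many generators are lifted to \<open>M\<close>, so a single
    finite-dimensional \<open>W\<close> covers the lifts.\<close>
  obtain B where B: "finite B" "B \<subseteq> carrier M" "A = d ` B"
    using finite_subset_image[OF A(1), of d "carrier M"] A(2) by auto
  obtain W :: "('k, 'a, 'u) rep" and f where W: "fd_module K N W" "f \<in> rep_hom K N W M" "B \<subseteq> f ` carrier W"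
    using finite_subset_rational[OF M B(1,2)] by blast
  let ?g = "\<lambda>w. d (f w)"
  have g: "?g \<in> module_hom K W M'" by (rule module_hom_compose[OF rep_homD(1)[OF W(2)] d'])
  have gW: "submodule K (?g ` carrier W) M'"
    by (rule module_hom_image_submodule[OF comoduleD(1)[OF fd_comodule[OF W(1)]] mM' g])
  \<comment> \<open>The image of \<open>W\<close> meets the intersection in a submodule containing
    its generators, and so contains all of it.\<close>
  have "?R \<inter> ?P \<subseteq> ?g ` carrier W \<inter> (?R \<inter> ?P)"
    by (rule A(3)[OF submodule_restrict[OF submodule_inter[OF R P] gW]]) (use A(2) B(3) W(3) in auto)
  then have "\<forall>s\<in>S. \<exists>w\<in>carrier W. ?g w = c s" using c by fastforce
  then obtain b where "\<forall>s\<in>S. b s \<in> carrier W \<and> ?g (b s) = c s" by metis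
  then show thesis using that[OF W(1,2), of b] by auto
qed

text \<open>The solution is \<open>d y\<close>, where \<open>y\<close> has the lifted values as
  displacements. It lies in the image of \<open>d\<close>, and hence, at an exact place of a
  complex, in the kernel of the next map; corrections by it do not change images there.\<close>

lemma image_disp_surj:
  fixes I M' Q :: "('k, 'a, 'u) rep"
  assumes I: "injective_module K N I" and M': "comodule K N M'" and d: "d \<in> rep_hom K N I M'"
    and Q: "fd_module K N Q" and \<psi>: "\<psi> \<in> rep_hom K N Q M'"
    and c: "c ` S \<subseteq> \<psi> ` carrier Q \<inter> d ` carrier I"
  shows "\<exists>z \<in> d ` carrier I. \<forall>s\<in>S. disp M' s z = c s"
proof -
  note cI = rational_comodule[OF injective_rational[OF I]]
  show ?thesis
  proof (rule lift_cocycle[OF injective_rational[OF I] M' d Q \<psi> c])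
    fix W :: "('k, 'a, 'u) rep" and f b
    assume W: "fd_module K N W" "f \<in> rep_hom K N W I" "b \<in> S \<rightarrow> carrier W"
      and db: "\<And>s. s \<in> S \<Longrightarrow> d (f (b s)) = c s"
    obtain y where y: "y \<in> carrier I" "\<forall>s\<in>S. disp I s y = f (b s)"
      using injective_disp_surj[OF I W] by blast
    have "disp M' s (d y) = c s" if "s \<in> S" for s
      using rep_hom_disp[OF cI M' d that y(1)] y(2) db that by simp
    then show ?thesis using y(1) by blast
  qed
qed

text \<open>The displacements of \<open>y\<close> lie in the kernel of \<open>d'\<close>, which is
  the image of \<open>d\<close>, and in a finite-dimensional submodule containing \<open>y\<close>.
  They are therefore also the displacements of some \<open>z\<close> in that kernel, and
  \<open>y - z\<close> is invariant with the same image under \<open>d'\<close>. In other words,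
  that kernel is a quotient of an injective module, and its first cohomology does not obstruct the
  lifting of invariants.\<close>

lemma lift_invariant:
  fixes I M M' :: "('k, 'a, 'u) rep"
  assumes I: "injective_module K N I" and M: "rational_module K N M" and M': "comodule K N M'"
    and d: "d \<in> rep_hom K N I M" and d': "d' \<in> rep_hom K N M M'"
    and exact: "d ` carrier I = {x \<in> carrier M. d' x = \<zero>\<^bsub>M'\<^esub>}"
    and y: "y \<in> carrier M" and inv: "\<And>s. s \<in> S \<Longrightarrow> disp M' s (d' y) = \<zero>\<^bsub>M'\<^esub>"
  shows "\<exists>y' \<in> carrier M. d' y' = d' y \<and> (\<forall>s\<in>S. disp M s y' = \<zero>\<^bsub>M\<^esub>)"
proof -
  note cM = rational_comodule[OF M] and mM = comoduleD(1)[OF rational_comodule[OF M]]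
  note mM' = comoduleD(1)[OF M']
  interpret M: module K M by (rule mM)
  interpret M': module K M' by (rule mM')
  obtain Q :: "('k, 'a, 'u) rep" and \<psi> q where Q: "fd_module K N Q" "\<psi> \<in> rep_hom K N Q M"
    and q: "q \<in> carrier Q" "\<psi> q = y"
    by (rule rational_element[OF M y])
  note cQ = fd_comodule[OF Q(1)]
  have "disp M s y \<in> \<psi> ` carrier Q \<inter> d ` carrier I" if s: "s \<in> S" for s
  proof -
    have "disp M s y = \<psi> (disp Q s q)" using rep_hom_disp[OF cQ cM Q(2) s q(1)] q(2) by simp
    moreover have "disp Q s q \<in> carrier Q" by (rule module_homD(1)[OF disp_hom[OF cQ s] q(1)])
    moreover have "d' (disp M s y) = \<zero>\<^bsub>M'\<^esub>" using rep_hom_disp[OF cM M' d' s y] inv[OF s] by simp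
    moreover have "disp M s y \<in> carrier M" by (rule module_homD(1)[OF disp_hom[OF cM s] y])
    ultimately show ?thesis unfolding exact by auto
  qed
  then obtain z where z: "z \<in> d ` carrier I" "\<forall>s\<in>S. disp M s z = disp M s y"
    using image_disp_surj[OF I cM d Q, of "\<lambda>s. disp M s y"] by auto
  then have z': "z \<in> carrier M" "d' z = \<zero>\<^bsub>M'\<^esub>" unfolding exact by auto
  have d'y: "d' y \<in> carrier M'" by (rule module_homD(1)[OF rep_homD(1)[OF d'] y])
  have "d' (y \<ominus>\<^bsub>M\<^esub> z) = d' y"
    using module_hom_minus[OF mM mM' rep_homD(1)[OF d'] y z'(1)] z'(2) d'y by (simp add: M'.M.minus_eq)
  moreover have "disp M s (y \<ominus>\<^bsub>M\<^esub> z) = \<zero>\<^bsub>M\<^esub>" if s: "s \<in> S" for s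
    using module_hom_minus[OF mM mM disp_hom[OF cM s] y z'(1)] z(2) s module_homD(1)[OF disp_hom[OF cM s] y]
    by (simp add: M.M.minus_eq M.M.r_neg)
  ultimately show ?thesis using y z'(1) by (intro bexI[of _ "y \<ominus>\<^bsub>M\<^esub> z"]) auto
qed

end

section \<open>Cohomology\<close>

context free_unipotent
begin

definition inv_set :: "('k, 'a, 'u) rep \<Rightarrow> 'u set" where
  "inv_set M = {v \<in> carrier M. \<forall>s\<in>S. disp M s v = \<zero>\<^bsub>M\<^esub>}"

lemma inv_set_submodule:
  assumes M: "comodule K N M"
  shows "submodule K (inv_set M) M"
proof -
  note mM = comoduleD(1)[OF M] and d = module_homD[OF disp_hom[OF M]]
  interpret M: module K M by (rule mM)
  show ?thesis
    using mM module_hom_zero[OF mM mM disp_hom[OF M]]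
    by (intro submodule.intro) (auto simp: inv_set_def d)
qed

lemma invariants_eq:
  "rational_module K N (M :: ('k, 'a, 'u) rep) \<Longrightarrow> invariants K N M = M\<lparr>carrier := inv_set M\<rparr>"
  using invariants_iff[of M] by (simp add: invariants_def inv_set_def)

lemma displacement_eq: "displacement K S \<sigma> V v = (\<lambda>s\<in>S. disp V s v)"
  by (simp add: displacement_def disp_def)

lemma displacement_hom:
  fixes V :: "('k, 'a, 'u) rep"
  assumes V: "comodule K N V"
  shows "displacement K S \<sigma> V \<in> module_hom K V (map_space S V)"
proof -
  note d = module_homD[OF disp_hom[OF V]]
  interpret V: module K V by (rule comoduleD(1)[OF V])
  show ?thesis unfolding module_hom_def displacement_eq map_space_simps
    by (auto intro!: restrict_ext simp: d)
qed

lemma restrict_eq_iff: "restrict f S = restrict g S \<longleftrightarrow> (\<forall>s\<in>S. f s = g s)"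
  by (metis restrict_apply' restrict_ext)

end

section \<open>Invariants of a fixed resolution\<close>

locale resolved_module = free_unipotent K N universe S \<sigma>
  for K :: "('k, 'r) ring_scheme" and N :: "('k, 'a) group_scheme" and universe :: "'u itself"
    and S :: "'s set" and \<sigma> :: "'s \<Rightarrow> 'a \<Rightarrow> 'k" +
  fixes V :: "('k, 'a, 'u) rep" and \<eta> :: "'u \<Rightarrow> 'u" and I :: "nat \<Rightarrow> ('k, 'a, 'u) rep" and d :: "nat \<Rightarrow> 'u \<Rightarrow> 'u"
  assumes V: "fd_module K N V" and resolution: "injective_resolution K N V \<eta> I d"
begin

lemma I: "injective_module K N (I n)"
  and \<eta>: "\<eta> \<in> rep_hom K N V (I 0)" and d: "d n \<in> rep_hom K N (I n) (I (Suc n))"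
  and \<eta>_inj: "inj_on \<eta> (carrier V)"
  and exact_0: "\<eta> ` carrier V = {x \<in> carrier (I 0). d 0 x = \<zero>\<^bsub>I 1\<^esub>}"
  and exact_Suc: "d n ` carrier (I n) = {x \<in> carrier (I (Suc n)). d (Suc n) x = \<zero>\<^bsub>I (Suc (Suc n))\<^esub>}"
  using resolution unfolding injective_resolution_def by blast+

lemmas rI = injective_rational[OF I]
lemmas cI = rational_comodule[OF rI]
lemmas mI = comoduleD(1)[OF cI]
lemmas cV = fd_comodule[OF V]
lemmas mV = comoduleD(1)[OF cV]
lemmas d_hom = rep_homD(1)[OF d]
lemmas \<eta>_hom = rep_homD(1)[OF \<eta>]

lemma d_inv: "x \<in> inv_set (I n) \<Longrightarrow> d n x \<in> inv_set (I (Suc n))"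
  using module_homD(1)[OF d_hom] rep_hom_disp[OF cI cI d, symmetric] module_hom_zero[OF mI mI d_hom]
  by (auto simp: inv_set_def)

definition cocycles :: "nat \<Rightarrow> 'u set" where
  "cocycles n = {x \<in> inv_set (I n). d n x = \<zero>\<^bsub>I (Suc n)\<^esub>}"

lemma cocycles_submodule: "submodule K (cocycles n) (I n)"
  unfolding cocycles_def by (rule submodule_kernel[OF inv_set_submodule[OF cI] mI d_hom])

lemma rational_cohomology_0:
  "rational_cohomology K N I d 0 = quot_space ((I 0)\<lparr>carrier := cocycles 0\<rparr>) {\<zero>\<^bsub>I 0\<^esub>}"
  by (simp add: rational_cohomology_def cohomology_at_def zero_space_def invariants_eq[OF rI] cocycles_def)

lemma rational_cohomology_Suc:
  "rational_cohomology K N I d (Suc n)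
     = quot_space ((I (Suc n))\<lparr>carrier := cocycles (Suc n)\<rparr>) (d n ` inv_set (I n))"
  by (simp add: rational_cohomology_def cohomology_at_def invariants_eq[OF rI] cocycles_def)

lemma disp_mem: "comodule K N M \<Longrightarrow> s \<in> S \<Longrightarrow> v \<in> carrier M \<Longrightarrow> disp M s v \<in> carrier M"
  by (rule module_homD(1)[OF disp_hom])

text \<open>\<eta> identifies \<open>V\<close> with the kernel of \<open>d 0\<close>. As it is
  injective and commutes with displacements, the invariants of \<open>V\<close> correspond exactly
  to the cocycles of degree 0.\<close>

lemma cohomology_0:
  "space_iso K (rational_cohomology K N I d 0)
     (cohomology_at (zero_space :: ('k, unit) module) (\<lambda>_. \<zero>\<^bsub>V\<^esub>) V (displacement K S \<sigma> V) (map_space S V))"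
proof -
  interpret V: module K V by (rule mV)
  have ker: "{v \<in> carrier V. displacement K S \<sigma> V v = \<zero>\<^bsub>map_space S V\<^esub>} = inv_set V"
    by (simp add: displacement_eq map_space_simps restrict_eq_iff inv_set_def)
  have sV: "submodule K (inv_set V) V" by (rule inv_set_submodule[OF cV])
  let ?P = "V\<lparr>carrier := inv_set V\<rparr>" and ?A = "(I 0)\<lparr>carrier := cocycles 0\<rparr>"
  have mP: "module K ?P" by (rule submodule_module[OF sV])
  have mA: "module K ?A" by (rule submodule_module[OF cocycles_submodule])
  have im: "\<eta> ` inv_set V = cocycles 0"
  proof (intro subset_antisym subsetI)
    fix x assume "x \<in> \<eta> ` inv_set V"
    then obtain v where v: "v \<in> carrier V" "\<And>s. s \<in> S \<Longrightarrow> disp V s v = \<zero>\<^bsub>V\<^esub>" "x = \<eta> v" by (auto simp: inv_set_def)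
    moreover have "disp (I 0) s x = \<zero>\<^bsub>I 0\<^esub>" if "s \<in> S" for s
      using rep_hom_disp[OF cV cI \<eta> that v(1)] v(2)[OF that] v(3) module_hom_zero[OF mV mI \<eta>_hom] by simp
    moreover have "x \<in> {x \<in> carrier (I 0). d 0 x = \<zero>\<^bsub>I 1\<^esub>}" using exact_0 v by auto
    ultimately show "x \<in> cocycles 0" by (auto simp: cocycles_def inv_set_def)
  next
    fix x assume x: "x \<in> cocycles 0"
    then have "x \<in> \<eta> ` carrier V" using exact_0 by (auto simp: cocycles_def inv_set_def)
    then obtain v where v: "v \<in> carrier V" "x = \<eta> v" by auto
    have "disp V s v = \<zero>\<^bsub>V\<^esub>" if s: "s \<in> S" for s
    proof (rule inj_onD[OF \<eta>_inj])
      have "disp (I 0) s (\<eta> v) = \<zero>\<^bsub>I 0\<^esub>" using x s v(2) by (auto simp: cocycles_def inv_set_def)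
      then show "\<eta> (disp V s v) = \<eta> \<zero>\<^bsub>V\<^esub>"
        using rep_hom_disp[OF cV cI \<eta> s v(1)] module_hom_zero[OF mV mI \<eta>_hom] by simp
      show "\<zero>\<^bsub>V\<^esub> \<in> carrier V" by (rule V.M.zero_closed)
    qed (rule disp_mem[OF cV s v(1)])
    then show "x \<in> \<eta> ` inv_set V" using v by (auto simp: inv_set_def)
  qed
  have "space_iso K (quot_space ?A {\<zero>\<^bsub>I 0\<^esub>}) (quot_space ?P {\<zero>\<^bsub>V\<^esub>})"
  proof (rule quot_space_iso[OF mP, where f = \<eta> and g = "\<lambda>x. x"])
    show "submodule K {\<zero>\<^bsub>I 0\<^esub>} ?A" "submodule K {\<zero>\<^bsub>V\<^esub>} ?P"
      using zero_submodule[OF mA] zero_submodule[OF mP] by simp_all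
    show "\<eta> \<in> module_hom K ?P ?A"
      using module_homD[OF \<eta>_hom] im submodule.subset[OF sV] by (auto simp: module_hom_def subset_iff)
    show "\<eta> ` carrier ?P = carrier ?A" using im by simp
    fix p assume "p \<in> carrier ?P"
    then have p: "p \<in> carrier V" by (simp add: inv_set_def)
    show "\<eta> p \<in> {\<zero>\<^bsub>I 0\<^esub>} \<longleftrightarrow> p \<in> {\<zero>\<^bsub>V\<^esub>}"
      using inj_on_eq_iff[OF \<eta>_inj p V.M.zero_closed] module_hom_zero[OF mV mI \<eta>_hom] by auto
  qed (simp_all add: module_hom_id)
  then show ?thesis
    unfolding rational_cohomology_0 cohomology_at_def ker by (simp add: zero_space_def)
qed

text \<open>\<open>?P\<close> consists of the vectors of \<open>I 0\<close> whose image in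
  \<open>I 1\<close> is invariant. By exactness \<open>d 0\<close> maps it onto the cocycles of
  degree 1; by injectivity of \<open>I 0\<close> the map \<open>?g\<close>, which reads
  displacements back in \<open>V\<close> through \<eta>, sends it onto all maps from
  \<open>S\<close> to \<open>V\<close>. The coboundaries on either side pull back to the same
  subspace of \<open>?P\<close>, so both quotients are quotients of \<open>?P\<close> by it and no
  connecting map has to be built.\<close>

lemma cohomology_1:
  "space_iso K (rational_cohomology K N I d 1)
     (cohomology_at V (displacement K S \<sigma> V) (map_space S V) (\<lambda>_. ()) (zero_space :: ('k, unit) module))"
proof -
  let ?D = "displacement K S \<sigma> V"
  let ?P = "{y \<in> carrier (I 0). d 0 y \<in> inv_set (I 1)}"
  let ?A = "(I 1)\<lparr>carrier := cocycles 1\<rparr>"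
  have d0: "d 0 \<in> rep_hom K N (I 0) (I 1)" using d[of 0] by simp
  note d0_hom = rep_homD(1)[OF d0]
  interpret I0: module K "I 0" by (rule mI)
  interpret V: module K V by (rule mV)
  have sP: "submodule K ?P (I 0)" by (rule submodule_vimage[OF mI inv_set_submodule[OF cI] d0_hom])
  have mP: "module K ((I 0)\<lparr>carrier := ?P\<rparr>)" by (rule submodule_module[OF sP])
  have disp_d: "d 0 (disp (I 0) s y) = disp (I 1) s (d 0 y)" if "s \<in> S" "y \<in> carrier (I 0)" for s y
    by (rule rep_hom_disp[OF cI cI d0 that])
  have disp_\<eta>: "\<eta> (disp V s v) = disp (I 0) s (\<eta> v)" if "s \<in> S" "v \<in> carrier V" for s v
    by (rule rep_hom_disp[OF cV cI \<eta> that])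
  let ?e = "inv_into (carrier V) \<eta>"
  let ?g = "\<lambda>y. \<lambda>s\<in>S. ?e (disp (I 0) s y)"
  have e: "?e (\<eta> v) = v" if "v \<in> carrier V" for v by (rule inv_into_f_f[OF \<eta>_inj that])
  \<comment> \<open>\<open>d 0\<close> carries the displacements of \<open>y\<close> to those of an
    invariant vector, hence to 0, and exactness places them in the image of \<eta>.\<close>
  have dispP: "\<exists>v\<in>carrier V. disp (I 0) s y = \<eta> v" if s: "s \<in> S" and y: "y \<in> ?P" for s y
  proof -
    have "disp (I 0) s y \<in> carrier (I 0)" using disp_mem[OF cI s] y by simp
    moreover have "d 0 (disp (I 0) s y) = \<zero>\<^bsub>I 1\<^esub>" using disp_d[OF s] y s by (simp add: inv_set_def)
    ultimately show ?thesis using exact_0 by auto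
  qed
  have g: "?g y s \<in> carrier V" "\<eta> (?g y s) = disp (I 0) s y" if "s \<in> S" "y \<in> ?P" for s y
    using dispP[OF that] e that(1) by auto
  have eqV: "v = w" if "v \<in> carrier V" "w \<in> carrier V" "\<eta> v = \<eta> w" for v w
    using inj_onD[OF \<eta>_inj] that by blast
  have eqD: "?g y = ?D v \<longleftrightarrow> (\<forall>s\<in>S. disp (I 0) s y = disp (I 0) s (\<eta> v))" if y: "y \<in> ?P" and v: "v \<in> carrier V" for y v
  proof -
    have "?e (disp (I 0) s y) = disp V s v \<longleftrightarrow> disp (I 0) s y = disp (I 0) s (\<eta> v)" if s: "s \<in> S" for s
      using g[OF s y] disp_\<eta>[OF s v] s e[OF disp_mem[OF cV s v]] by auto
    then show ?thesis unfolding displacement_eq restrict_eq_iff by simp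
  qed
  note D0 = module_homD[OF disp_hom[OF cI[of 0]]]
  have "space_iso K (quot_space ?A (d 0 ` inv_set (I 0))) (quot_space (map_space S V) (?D ` carrier V))"
  proof (rule quot_space_iso[OF mP, where f = "d 0" and g = ?g])
    have "submodule K (d 0 ` inv_set (I 0) \<inter> cocycles 1) ?A"
    proof (rule submodule_restrict[OF cocycles_submodule])
      have "submodule K (d 0 ` carrier ((I 0)\<lparr>carrier := inv_set (I 0)\<rparr>)) (I 1)"
        by (rule module_hom_image_submodule[OF submodule_module[OF inv_set_submodule[OF cI]] mI])
          (use module_homD[OF d0_hom] in \<open>auto simp: module_hom_def inv_set_def\<close>)
      then show "submodule K (d 0 ` inv_set (I 0)) (I 1)" by simp
    qed
    moreover have "d 0 ` inv_set (I 0) \<subseteq> cocycles 1"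
      using d_inv[of _ 0] exact_Suc[of 0] by (auto simp: cocycles_def inv_set_def)
    ultimately show "submodule K (d 0 ` inv_set (I 0)) ?A" by (simp add: Int_absorb2)
    show "submodule K (?D ` carrier V) (map_space S V)"
      by (rule module_hom_image_submodule[OF mV map_space_module[OF mV] displacement_hom[OF cV]])
    have "d 0 ` ?P = cocycles 1"
      using exact_Suc[of 0] by (auto simp: cocycles_def inv_set_def)
    then show "d 0 ` carrier ((I 0)\<lparr>carrier := ?P\<rparr>) = carrier ?A" by simp
    then show "d 0 \<in> module_hom K ((I 0)\<lparr>carrier := ?P\<rparr>) ?A"
      using module_homD[OF d0_hom] unfolding module_hom_def by auto
    show "?g \<in> module_hom K ((I 0)\<lparr>carrier := ?P\<rparr>) (map_space S V)"
      unfolding module_hom_def map_space_simps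
    proof (intro CollectI conjI allI impI; (elim conjE)?)
      show "?g \<in> carrier ((I 0)\<lparr>carrier := ?P\<rparr>) \<rightarrow> (S \<rightarrow>\<^sub>E carrier V)"
        using g(1) by auto
      fix y z assume yz: "y \<in> carrier ((I 0)\<lparr>carrier := ?P\<rparr>)" "z \<in> carrier ((I 0)\<lparr>carrier := ?P\<rparr>)"
      then have y: "y \<in> ?P" and z: "z \<in> ?P" by auto
      have yz': "y \<oplus>\<^bsub>I 0\<^esub> z \<in> ?P" by (rule submodule.m_closed[OF sP y z])
      have "?g (y \<oplus>\<^bsub>I 0\<^esub> z) s = ?g y s \<oplus>\<^bsub>V\<^esub> ?g z s" if s: "s \<in> S" for s
      proof (rule eqV)
        show "\<eta> (?g (y \<oplus>\<^bsub>I 0\<^esub> z) s) = \<eta> (?g y s \<oplus>\<^bsub>V\<^esub> ?g z s)"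
          using g(2)[OF s yz'] g[OF s y] g[OF s z] module_homD(2)[OF \<eta>_hom g(1)[OF s y] g(1)[OF s z]] D0(2)[OF s, of y z] y z
          by simp
      qed (use g(1)[OF s yz'] g(1)[OF s y] g(1)[OF s z] in auto)
      then show "?g (y \<oplus>\<^bsub>(I 0)\<lparr>carrier := ?P\<rparr>\<^esub> z) = (\<lambda>s\<in>S. ?g y s \<oplus>\<^bsub>V\<^esub> ?g z s)"
        by (intro restrict_ext) simp
    next
      fix c y assume cy: "c \<in> carrier K" "y \<in> carrier ((I 0)\<lparr>carrier := ?P\<rparr>)"
      then have y: "y \<in> ?P" by auto
      have cy': "c \<odot>\<^bsub>I 0\<^esub> y \<in> ?P" by (rule submodule.smult_closed[OF sP cy(1) y])
      have "?g (c \<odot>\<^bsub>I 0\<^esub> y) s = c \<odot>\<^bsub>V\<^esub> ?g y s" if s: "s \<in> S" for s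
      proof (rule eqV)
        show "\<eta> (?g (c \<odot>\<^bsub>I 0\<^esub> y) s) = \<eta> (c \<odot>\<^bsub>V\<^esub> ?g y s)"
          using g(2)[OF s cy'] g[OF s y] module_homD(3)[OF \<eta>_hom cy(1) g(1)[OF s y]] D0(3)[OF s cy(1), of y] y
          by simp
      qed (use g(1)[OF s cy'] g(1)[OF s y] cy in auto)
      then show "?g (c \<odot>\<^bsub>(I 0)\<lparr>carrier := ?P\<rparr>\<^esub> y) = (\<lambda>s\<in>S. c \<odot>\<^bsub>V\<^esub> ?g y s)"
        by (intro restrict_ext) simp
    qed
    show "?g ` carrier ((I 0)\<lparr>carrier := ?P\<rparr>) = carrier (map_space S V)"
    proof (intro subset_antisym subsetI)
      fix c assume "c \<in> ?g ` carrier ((I 0)\<lparr>carrier := ?P\<rparr>)"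
      then show "c \<in> carrier (map_space S V)" unfolding map_space_simps using g(1) by auto
    next
      fix c assume "c \<in> carrier (map_space S V)"
      then have c: "c \<in> S \<rightarrow>\<^sub>E carrier V" by (simp add: map_space_simps)
      then have c': "c \<in> S \<rightarrow> carrier V" by auto
      \<comment> \<open>\<open>V\<close> itself is finite-dimensional, so it may serve as the module
        in which an arbitrary \<open>c\<close> takes its values.\<close>
      obtain y where y: "y \<in> carrier (I 0)" "\<forall>s\<in>S. disp (I 0) s y = \<eta> (c s)"
        using injective_disp_surj[OF I V \<eta> c'] by blast
      have "disp (I 1) s (d 0 y) = \<zero>\<^bsub>I 1\<^esub>" if s: "s \<in> S" for s
      proof -
        have "\<eta> (c s) \<in> {x \<in> carrier (I 0). d 0 x = \<zero>\<^bsub>I 1\<^esub>}" using exact_0 Pi_mem[OF c' s] by auto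
        then show ?thesis using disp_d[OF s y(1)] y(2) s by simp
      qed
      then have yP: "y \<in> ?P" using y(1) module_homD(1)[OF d0_hom] by (simp add: inv_set_def)
      have "?g y s = c s" for s
        using y(2) e Pi_mem[OF c'] PiE_arb[OF c] by (cases "s \<in> S") auto
      then have "?g y = c" by (rule ext)
      then show "c \<in> ?g ` carrier ((I 0)\<lparr>carrier := ?P\<rparr>)" using yP by auto
    qed
    fix y assume "y \<in> carrier ((I 0)\<lparr>carrier := ?P\<rparr>)"
    then have y: "y \<in> ?P" by simp
    then have yI: "y \<in> carrier (I 0)" by simp
    \<comment> \<open>Both conditions say that \<open>y\<close> is the sum of an invariant vector of
      \<open>I 0\<close> and an element of the image of \<eta>, which is the kernel of
      \<open>d 0\<close>.\<close>
    show "d 0 y \<in> d 0 ` inv_set (I 0) \<longleftrightarrow> ?g y \<in> ?D ` carrier V"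
    proof
      assume "d 0 y \<in> d 0 ` inv_set (I 0)"
      then obtain x where x: "x \<in> carrier (I 0)" "\<And>s. s \<in> S \<Longrightarrow> disp (I 0) s x = \<zero>\<^bsub>I 0\<^esub>" "d 0 y = d 0 x"
        by (auto simp: inv_set_def)
      have "d 0 (y \<ominus>\<^bsub>I 0\<^esub> x) = \<zero>\<^bsub>I 1\<^esub>"
        using module_hom_minus[OF mI mI d0_hom yI x(1)] x(3) module_homD(1)[OF d0_hom x(1)]
          abelian_group.minus_other_side[OF module.axioms(2)[OF mI]] by simp
      then have "y \<ominus>\<^bsub>I 0\<^esub> x \<in> \<eta> ` carrier V" using exact_0 yI x(1) by simp
      then obtain v where v: "v \<in> carrier V" "y \<ominus>\<^bsub>I 0\<^esub> x = \<eta> v" by auto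
      have "disp (I 0) s y = disp (I 0) s (\<eta> v)" if s: "s \<in> S" for s
        using module_hom_minus[OF mI mI disp_hom[OF cI s] yI x(1)] x(2)[OF s] v(2) D0(1)[OF s yI]
        by (simp add: I0.M.minus_eq)
      then have "?g y = ?D v" using eqD[OF y v(1)] by blast
      then show "?g y \<in> ?D ` carrier V" using v(1) by blast
    next
      assume "?g y \<in> ?D ` carrier V"
      then obtain v where v: "v \<in> carrier V" "?g y = ?D v" by blast
      then have dv: "\<forall>s\<in>S. disp (I 0) s y = disp (I 0) s (\<eta> v)" using eqD[OF y v(1)] by blast
      have "\<eta> v \<in> {x \<in> carrier (I 0). d 0 x = \<zero>\<^bsub>I 1\<^esub>}" using exact_0 v(1) by auto
      then have \<eta>v: "\<eta> v \<in> carrier (I 0)" "d 0 (\<eta> v) = \<zero>\<^bsub>I 1\<^esub>" by auto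
      interpret I1: module K "I (Suc 0)" by (rule mI)
      have "y \<ominus>\<^bsub>I 0\<^esub> \<eta> v \<in> inv_set (I 0)"
        using module_hom_minus[OF mI mI disp_hom[OF cI] yI \<eta>v(1)] dv D0(1)[OF _ \<eta>v(1)] yI \<eta>v(1)
        by (simp add: inv_set_def)
      moreover have "d 0 (y \<ominus>\<^bsub>I 0\<^esub> \<eta> v) = d 0 y"
        using module_hom_minus[OF mI mI d0_hom yI \<eta>v(1)] \<eta>v(2) module_homD(1)[OF d0_hom yI]
        by (simp add: I1.M.minus_eq)
      ultimately show "d 0 y \<in> d 0 ` inv_set (I 0)" by (metis imageI)
    qed
  qed
  then show ?thesis
    using rational_cohomology_Suc[of 0] by (simp add: cohomology_at_def zero_space_def)
qed

text \<open>A cocycle is the image of some \<open>y\<close> by exactness, and \<open>y\<close> can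
  be corrected to an invariant vector. The correction takes place in the kernel of
  \<open>d (Suc n)\<close>, a quotient of \<open>I n\<close>. In degree 1 that kernel would be the
  image of \<open>V\<close>, which need not be a quotient of an injective module; hence the start at
  \<open>Suc (Suc n)\<close>.\<close>

lemma cohomology_vanishes: "space_iso K (rational_cohomology K N I d (Suc (Suc n))) (zero_space :: ('k, unit) module)"
proof -
  have "d (Suc n) ` inv_set (I (Suc n)) = cocycles (Suc (Suc n))"
  proof (intro subset_antisym subsetI)
    fix x assume "x \<in> d (Suc n) ` inv_set (I (Suc n))"
    then obtain y where y: "y \<in> inv_set (I (Suc n))" "x = d (Suc n) y" by blast
    then have "x \<in> d (Suc n) ` carrier (I (Suc n))" by (simp add: inv_set_def)
    then show "x \<in> cocycles (Suc (Suc n))"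
      using d_inv[OF y(1)] y(2) unfolding exact_Suc by (simp add: cocycles_def)
  next
    fix x assume x: "x \<in> cocycles (Suc (Suc n))"
    then have "x \<in> d (Suc n) ` carrier (I (Suc n))" unfolding exact_Suc by (simp add: cocycles_def inv_set_def)
    then obtain y where y: "y \<in> carrier (I (Suc n))" "x = d (Suc n) y" by blast
    have "disp (I (Suc (Suc n))) s (d (Suc n) y) = \<zero>\<^bsub>I (Suc (Suc n))\<^esub>" if "s \<in> S" for s
      using x y(2) that by (simp add: cocycles_def inv_set_def)
    then obtain y' where "y' \<in> carrier (I (Suc n))" "d (Suc n) y' = d (Suc n) y"
      "\<forall>s\<in>S. disp (I (Suc n)) s y' = \<zero>\<^bsub>I (Suc n)\<^esub>"
      using lift_invariant[OF I rI cI d d exact_Suc y(1)] by blast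
    then show "x \<in> d (Suc n) ` inv_set (I (Suc n))" using y(2)
      by (intro image_eqI[of _ _ y']) (simp_all add: inv_set_def)
  qed
  then show ?thesis
    unfolding rational_cohomology_Suc
    using quot_space_self_iso[OF submodule_module[OF cocycles_submodule[of "Suc (Suc n)"]]] by simp
qed

end

text \<open>The resolution is arbitrary while the right-hand sides do not involve it, so every
  choice yields isomorphic cohomology.\<close>

theorem proposition3p10:
  fixes K :: "'k ring" and S :: "'s set"
    and N :: "('k, 'a) group_scheme" and \<sigma> :: "'s \<Rightarrow> 'a \<Rightarrow> 'k"
    and V :: "('k, 'a, 'u) rep"
    and \<eta> :: "'u \<Rightarrow> 'u" and I :: "nat \<Rightarrow> ('k, 'a, 'u) rep" and d :: "nat \<Rightarrow> 'u \<Rightarrow> 'u"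
  assumes "algebraically_closed K"
    and char_0: "\<And>n::nat. n > 0 \<Longrightarrow> [n] \<cdot>\<^bsub>K\<^esub> \<one>\<^bsub>K\<^esub> \<noteq> \<zero>\<^bsub>K\<^esub>"
    and "S \<noteq> {}"
    and "free_unipotent_group TYPE('u) K S N \<sigma>"
    and "fd_module K N V"
    and "injective_resolution K N V \<eta> I d"
  shows "space_iso K (rational_cohomology K N I d 0)
           (cohomology_at (zero_space :: ('k, unit) module) (\<lambda>_. \<zero>\<^bsub>V\<^esub>) V (displacement K S \<sigma> V) (map_space S V))
       \<and> space_iso K (rational_cohomology K N I d 1)
           (cohomology_at V (displacement K S \<sigma> V) (map_space S V) (\<lambda>_. ()) (zero_space :: ('k, unit) module))
       \<and> (\<forall>n\<ge>2. space_iso K (rational_cohomology K N I d n) (zero_space :: ('k, unit) module))"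
proof -
  have ags: "affine_group_scheme K N" using assms(4) by (simp add: free_unipotent_group_def)
  then have "field K" by (simp add: affine_group_scheme_def)
  then have "ring K" by (simp add: field_def domain_def cring_def)
  then have "infinite (carrier K)" by (rule infinite_of_char_zero[OF _ char_0])
  then interpret resolved_module K N "TYPE('u)" S \<sigma> V \<eta> I d
    using ags assms(4-6)
    by (simp add: resolved_module_def resolved_module_axioms_def free_unipotent_def free_unipotent_axioms_def affine_group_def)
  have "space_iso K (rational_cohomology K N I d n) (zero_space :: ('k, unit) module)" if "n \<ge> 2" for n
  proof -
    have "n = Suc (Suc (n - 2))" using that by simp
    then show ?thesis using cohomology_vanishes[of "n - 2"] by simp
  qed
  then show ?thesis using cohomology_0 cohomology_1 by simp
qed

end
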